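(* Let $1<r\leq 2$ and let $0<\rho<1$. Suppose that $m\in\mathbb{R}$ satisfies $m\leq -n(1-\rho)/r$, and let $\sigma\in S^m_{\rho,\rho}(\mathbb{T}^n\times\mathbb{Z}^n)$. Then there is a constant $C>0$, independent of $f$ and $x$, such that $$\mathcal{M}^\#_r(T_\sigma f)(x)\leq C\,\mathrm{M}_r f(x),\qquad x\in\mathbb{T}^n,$$ for all $f\in C^\infty(\mathbb{T}^n)$.
   Context: $\mathbb{T}^n=\mathbb{R}^n/\mathbb{Z}^n$; functions on $\mathbb{T}^n$ are identified with 1-periodic functions on $\mathbb{R}^n$. $\langle\xi\rangle=(1+|\xi|^2)^{1/2}$. For $f\in C^\infty(\mathbb{T}^n)$, $(\mathcal{F}_{\mathbb{T}^n}f)(\xi)=\int_{\mathbb{T}^n}e^{-i2\pi x\cdot\xi}f(x)\,dx$, $\xi\in\mathbb{Z}^n$. Difference operators: for $\sigma:\mathbb{Z}^n\to\mathbb{C}$, $\Delta_{\xi_j}\sigma(\xi)=\sigma(\xi+e_j)-\sigma(\xi)$, where $e_j$ is the $j$-th standard basis vector, and $\Delta_\xi^\alpha=\Delta_{\xi_1}^{\alpha_1}\cdots\Delta_{\xi_n}^{\alpha_n}$. Symbol class: for $m\in\mathbb{R}$ and $0\leq\delta,\rho\leq 1$, a function $\sigma(x,\xi)$ on $\mathbb{T}^n\times\mathbb{Z}^n$, smooth in $x$ for every $\xi$, belongs to $S^m_{\rho,\delta}(\mathbb{T}^n\times\mathbb{Z}^n)$ if for all multi-indices $\alpha,\beta\in\mathbb{N}_0^n$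 there is $C_{\alpha\beta}$ with $|\partial_x^\beta\Delta_\xi^\alpha\sigma(x,\xi)|\leq C_{\alpha\beta}\langle\xi\rangle^{m-\rho|\alpha|+\delta|\beta|}$ for all $x\in\mathbb{T}^n$, $\xi\in\mathbb{Z}^n$. Toroidal pseudo-differential operator: $T_\sigma f(x)=\sum_{\xi\in\mathbb{Z}^n}e^{i2\pi x\cdot\xi}\sigma(x,\xi)(\mathcal{F}_{\mathbb{T}^n}f)(\xi)$. Maximal functions: for integrable $f$ on $\mathbb{T}^n$, $$\mathcal{M}^\#_r f(x)=\sup_{Q:x\in Q}\inf_{c_Q\in\mathbb{C}}\left(\frac1{|Q|}\int_Q|f(y)-c_Q|^r\,dy\right)^{1/r},\qquad \mathrm{M}_rf(x)=\sup_{Q:x\in Q}\left(\frac1{|Q|}\int_Q|f(y)|^r\,dy\right)^{1/r},$$ the suprema being over all cubes $Q$ in $\mathbb{T}^n$ with sides parallel to the axes. *)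

theory Defs
  imports "HOL-Analysis.Analysis"
begin

text \<open>
  Functions on the torus are represented by 1-periodic functions on \<open>real ^ 'n\<close>, and the
  frequency lattice by \<open>int ^ 'n\<close>; the dimension is \<open>CARD('n)\<close>.
\<close>

definition real_vec :: "int ^ 'n \<Rightarrow> real ^ 'n" where
  "real_vec \<xi> = (\<chi> i. real_of_int (\<xi> $ i))"

definition periodic1 :: "(real ^ 'n \<Rightarrow> complex) \<Rightarrow> bool" where
  "periodic1 f \<longleftrightarrow> (\<forall>x (k :: int ^ 'n). f (x + real_vec k) = f x)"

definition japanese_bracket :: "int ^ 'n \<Rightarrow> real" where
  "japanese_bracket \<xi> = sqrt (1 + (norm (real_vec \<xi>))\<^sup>2)"


text \<open>
  A fixed enumeration of the coordinates, used only to compose one-coordinate operators in a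
  definite order. The operators to which it is applied below commute.
\<close>

definition coord_list :: "'n::finite list" where
  "coord_list = (SOME js. distinct js \<and> set js = UNIV)"

lemma coord_list: "distinct (coord_list :: 'n::finite list)" "set (coord_list :: 'n list) = UNIV"
proof -
  have "\<exists>js :: 'n list. distinct js \<and> set js = UNIV"
    using finite_distinct_list[of "UNIV :: 'n set"] by auto
  from someI_ex[OF this]
  show "distinct (coord_list :: 'n list)" "set (coord_list :: 'n list) = UNIV"
    unfolding coord_list_def by auto
qed

text \<open>
  \<open>multi_power D \<alpha>\<close> is the product of the powers \<open>D j ^^ \<alpha> j\<close> over all coordinates \<open>j\<close>.
\<close>

definition multi_power :: "('n::finite \<Rightarrow> 'a \<Rightarrow> 'a) \<Rightarrow> ('n \<Rightarrow> nat) \<Rightarrow> 'a \<Rightarrow> 'a" where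
  "multi_power D \<alpha> = foldr (\<lambda>j. D j ^^ \<alpha> j) coord_list"

definition order_of :: "('n::finite \<Rightarrow> nat) \<Rightarrow> nat" where
  "order_of \<alpha> = (\<Sum>j\<in>UNIV. \<alpha> j)"


definition partial :: "'n::finite \<Rightarrow> (real ^ 'n \<Rightarrow> complex) \<Rightarrow> real ^ 'n \<Rightarrow> complex" where
  "partial j f x = vector_derivative (\<lambda>t. f (x + t *\<^sub>R axis j 1)) (at 0)"

text \<open>
  \<open>foldr partial js f\<close> is the iterated partial derivative of \<open>f\<close> along the list \<open>js\<close> of directions.
  Differentiability of all of these makes each of them continuous, so this is \<open>C\<close>-infinity.
\<close>

definition smooth :: "(real ^ 'n::finite \<Rightarrow> complex) \<Rightarrow> bool" where
  "smooth f \<longleftrightarrow> (\<forall>js. foldr partial js f differentiable_on UNIV)"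

definition smooth_torus :: "(real ^ 'n::finite \<Rightarrow> complex) set" where
  "smooth_torus = {f. smooth f \<and> periodic1 f}"

definition difference :: "'n::finite \<Rightarrow> (int ^ 'n \<Rightarrow> complex) \<Rightarrow> int ^ 'n \<Rightarrow> complex" where
  "difference j s \<xi> = s (\<xi> + axis j 1) - s \<xi>"


definition symbol_class ::
  "real \<Rightarrow> real \<Rightarrow> real \<Rightarrow> (real ^ 'n::finite \<Rightarrow> int ^ 'n \<Rightarrow> complex) set" where
  "symbol_class m \<rho> \<delta> = {\<sigma>.
     (\<forall>\<xi>. (\<lambda>x. \<sigma> x \<xi>) \<in> smooth_torus) \<and>
     (\<forall>\<alpha> \<beta>. \<exists>C. \<forall>x \<xi>.
        cmod (multi_power partial \<beta> (\<lambda>y. multi_power difference \<alpha> (\<sigma> y) \<xi>) x)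
        \<le> C * japanese_bracket \<xi> powr (m - \<rho> * real (order_of \<alpha>) + \<delta> * real (order_of \<beta>)))}"

definition fourier_torus :: "(real ^ 'n::finite \<Rightarrow> complex) \<Rightarrow> int ^ 'n \<Rightarrow> complex" where
  "fourier_torus f \<xi> =
     (LINT x:cbox 0 (\<Sum>i\<in>Basis. i)|lebesgue.
        exp (- \<i> * complex_of_real (2 * pi * (x \<bullet> real_vec \<xi>))) * f x)"

text \<open>
  For a symbol of the above class and smooth \<open>f\<close> the series converges absolutely, so that the
  unordered sum is the right one.
\<close>

definition toroidal_op ::
  "(real ^ 'n::finite \<Rightarrow> int ^ 'n \<Rightarrow> complex) \<Rightarrow> (real ^ 'n \<Rightarrow> complex) \<Rightarrow> real ^ 'n \<Rightarrow> complex" where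
  "toroidal_op \<sigma> f x =
     (\<Sum>\<^sub>\<infinity>\<xi>\<in>UNIV. exp (\<i> * complex_of_real (2 * pi * (x \<bullet> real_vec \<xi>))) * \<sigma> x \<xi> * fourier_torus f \<xi>)"


text \<open>
  Cubes of the torus are the projections of axis-parallel cubes of side length at most \<open>1\<close>. They
  are represented by their lifts containing a given representative \<open>x\<close> of the point; averages of
  periodic functions do not depend on the lift.
\<close>

definition cubes_at :: "real ^ 'n::finite \<Rightarrow> (real ^ 'n) set set" where
  "cubes_at x = {Q. x \<in> Q \<and>
     (\<exists>a l. 0 < l \<and> l \<le> 1 \<and> Q = cbox a (a + l *\<^sub>R (\<Sum>i\<in>Basis. i)))}"

text \<open>Real powers with positive exponent on the extended nonnegative reals.\<close>

definition ennreal_power :: "ennreal \<Rightarrow> real \<Rightarrow> ennreal" where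
  "ennreal_power t p = (if t = \<infinity> then \<infinity> else ennreal (enn2real t powr p))"

definition Lr_average :: "real \<Rightarrow> (real ^ 'n::finite) set \<Rightarrow> (real ^ 'n \<Rightarrow> complex) \<Rightarrow> ennreal" where
  "Lr_average r Q f = ennreal_power
     ((\<integral>\<^sup>+ y \<in> Q. ennreal (cmod (f y) powr r) \<partial>lebesgue) / emeasure lebesgue Q) (1 / r)"

definition maximal :: "real \<Rightarrow> (real ^ 'n::finite \<Rightarrow> complex) \<Rightarrow> real ^ 'n \<Rightarrow> ennreal" where
  "maximal r f x = (SUP Q\<in>cubes_at x. Lr_average r Q f)"

definition sharp_maximal :: "real \<Rightarrow> (real ^ 'n::finite \<Rightarrow> complex) \<Rightarrow> real ^ 'n \<Rightarrow> ennreal" where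
  "sharp_maximal r f x = (SUP Q\<in>cubes_at x. INF c. Lr_average r Q (\<lambda>y. f y - c))"

end

theory Submission
  imports Defs
begin

text \<open>
  The frequencies are cut into dyadic shells by smooth cutoffs, which writes the operator as a sum
  of pieces \<open>T k\<close> with about \<open>2^(k n)\<close> frequencies each, where \<open>n = CARD('n)\<close>. The symbol of \<open>T k\<close>
  varies in \<open>x\<close> at the scale \<open>s = 2 powr (- \<rho> k)\<close>, and the differences of the symbol show that
  \<open>T k\<close> essentially acts within distance \<open>s\<close>. Both facts are used at this scale only. The role of
  the function \<open>f\<close> is played by its weighted mass \<open>V c\<close>, which is \<open>s^(-n)\<close> times the integral of
  \<open>(|f| / weight) powr r\<close>; the weight grows like a power of the distance to \<open>c\<close>, measured in
  units of \<open>s\<close>. Two estimates hold for a single piece.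

    \<^item> On a cube of side \<open>s\<close> that contains \<open>c\<close>, the square of \<open>T k f\<close> has integral at most
      \<open>C 2^(- k n) V c powr (2 / r)\<close> (\<open>dyadic_piece_local_L2\<close>).

    \<^item> Near \<open>c\<close>, the gradient of \<open>T k f\<close> is at most \<open>C 2^k V c powr (1 / r)\<close>
      (\<open>dyadic_piece_gradient\<close>).

  They combine three ideas. First, the weight is a trigonometric polynomial. When \<open>f\<close> is written as
  the weight times \<open>f / weight\<close>, the polynomial can be moved to the multiplier, where it becomes a
  sum of differences; every difference gains a factor \<open>s\<close>, which pays for the size of the weight
  (\<open>weighted_reduction\<close>). Second, the Fourier coefficients of \<open>f / weight\<close> on a shell are
  controlled in mean square by the \<open>L^r\<close> norm. This is an elementary part of the
  Hausdorff-Young inequality for \<open>r \<le> 2\<close> (\<open>restricted_hausdorff_young\<close>), and together with the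
  hypothesis on \<open>m\<close> it makes the powers of \<open>2^k\<close> add up (\<open>exponent_bookkeeping\<close>). Third, on a cube
  of side \<open>s\<close> the dependence of the symbol on \<open>x\<close> is removed by a Sobolev inequality, one coordinate
  at a time, after which the waves are orthonormal (\<open>local_L2_bound\<close>).

  Now let \<open>Q\<close> be a cube of side \<open>l\<close> that contains \<open>x\<close>. The average of \<open>V\<close> over a cube of side
  between \<open>s\<close> and \<open>2\<close> that contains \<open>x\<close> is at most a constant times the \<open>r\<close>-th power of the maximal
  function at \<open>x\<close> (\<open>weighted_mass_average\<close>). Averaging the two estimates over \<open>c\<close> therefore gives the
  following. If \<open>2^k l \<le> 1\<close>, then \<open>T k f\<close> oscillates on \<open>Q\<close> by at most \<open>C 2^k l\<close> times the maximal
  function (\<open>dyadic_piece_oscillation\<close>). In general the mean of \<open>|T k f| powr r\<close> over \<open>Q\<close> is at most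
  \<open>C ((2^k l) powr (- n r / 2) + (2^k s) powr (- n r / 2))\<close> times the \<open>r\<close>-th power of the maximal
  function (\<open>dyadic_piece_Lr\<close>): if \<open>l \<le> s\<close>, then \<open>Q\<close> lies in a cube of side \<open>s\<close> and one loses the
  ratio of the volumes; otherwise \<open>Q\<close> is averaged over the cubes of side \<open>s\<close> that meet it. Choosing
  for the constant of \<open>Q\<close> the value at \<open>x\<close> of the pieces with \<open>2^k l \<le> 1\<close>, one is left with geometric
  series (\<open>sharp_estimate\<close>).
\<close>

section \<open>Waves and the unit cube\<close>

definition wave :: "int ^ 'n \<Rightarrow> real ^ 'n::finite \<Rightarrow> complex" where
  "wave \<xi> x = cis (2 * pi * (x \<bullet> real_vec \<xi>))"

lemma inner_real_vec: "x \<bullet> real_vec \<xi> = (\<Sum>j\<in>UNIV. x $ j * of_int (\<xi> $ j))"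
  by (simp add: inner_vec_def real_vec_def)

lemma real_vec_add: "real_vec (\<xi> + \<eta>) = real_vec \<xi> + real_vec \<eta>"
  by (simp add: real_vec_def vec_eq_iff)

lemma real_vec_minus: "real_vec (- \<xi>) = - real_vec \<xi>"
  by (simp add: real_vec_def vec_eq_iff)

lemma real_vec_axis: "real_vec (axis j 1 :: int ^ 'n::finite) = axis j 1"
  by (simp add: real_vec_def vec_eq_iff axis_def)

lemma cmod_wave [simp]: "cmod (wave \<xi> x) = 1"
  by (simp add: wave_def)

lemma wave_zero [simp]: "wave 0 x = 1"
  by (simp add: wave_def real_vec_def zero_vec_def[symmetric])

lemma wave_at_zero [simp]: "wave \<xi> 0 = 1"
  by (simp add: wave_def)

lemma wave_add_point: "wave \<xi> (x + y) = wave \<xi> x * wave \<xi> y"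
  by (simp add: wave_def cis_mult inner_add_left algebra_simps)

lemma wave_add_freq: "wave (\<xi> + \<eta>) x = wave \<xi> x * wave \<eta> x"
  by (simp add: wave_def cis_mult real_vec_add inner_add_right algebra_simps)

lemma wave_minus_freq: "wave (- \<xi>) x = cnj (wave \<xi> x)"
  by (simp add: wave_def real_vec_minus cis_cnj)

lemma wave_minus_point: "wave \<xi> (- x) = cnj (wave \<xi> x)"
  by (simp add: wave_def cis_cnj)

lemma wave_diff_freq: "wave (\<xi> - \<eta>) x = wave \<xi> x * cnj (wave \<eta> x)"
  using wave_add_freq[of \<xi> "- \<eta>" x] by (simp add: wave_minus_freq)

lemma wave_diff_point: "wave \<xi> (x - y) = wave \<xi> x * cnj (wave \<xi> y)"
  using wave_add_point[of \<xi> x "- y"] by (simp add: wave_minus_point)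

lemma wave_cnj_mult [simp]: "wave \<xi> x * cnj (wave \<xi> x) = 1" "cnj (wave \<xi> x) * wave \<xi> x = 1"
  by (simp_all flip: complex_norm_square add: mult.commute[of "cnj _"])

lemma wave_axis: "wave (axis j 1) x = cis (2 * pi * x $ j)"
  by (simp add: wave_def real_vec_axis inner_axis)

lemma wave_real_vec [simp]: "wave \<xi> (real_vec k) = 1"
proof -
  have "real_vec k \<bullet> real_vec \<xi> = of_int (\<Sum>j\<in>UNIV. k $ j * \<xi> $ j)"
    by (simp add: inner_real_vec) (simp add: real_vec_def)
  then show ?thesis
    unfolding wave_def by (metis cis_multiple_2pi Ints_of_int)
qed

lemma periodic1_wave: "periodic1 (wave \<xi>)"
  by (simp add: periodic1_def wave_add_point)

lemma continuous_on_wave [continuous_intros]: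
  "continuous_on S g \<Longrightarrow> continuous_on S (\<lambda>z. wave \<xi> (g z))"
  unfolding wave_def cis_conv_exp by (intro continuous_intros)

lemma wave_measurable [measurable]: "wave \<xi> \<in> borel_measurable borel"
  by (intro borel_measurable_continuous_onI continuous_intros)


abbreviation unit_cube :: "(real ^ 'n::finite) set" where
  "unit_cube \<equiv> cbox 0 One"


lemma sum_Basis_nth [simp]: "(\<Sum>b\<in>Basis. (b :: real ^ 'n::finite) $ j) = 1"
proof -
  have "(One :: real ^ 'n) \<bullet> axis j 1 = 1"
    by (simp add: inner_sum_left inner_Basis axis_in_Basis_iff)
  then show ?thesis
    by (simp add: inner_axis)
qed

abbreviation cube :: "real ^ 'n \<Rightarrow> real \<Rightarrow> (real ^ 'n::finite) set" where
  "cube a l \<equiv> cbox a (a + l *\<^sub>R One)"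

abbreviation Lr_mass :: "real \<Rightarrow> (real ^ 'n \<Rightarrow> complex) \<Rightarrow> (real ^ 'n::finite) set \<Rightarrow> ennreal" where
  "Lr_mass r g E \<equiv> (\<integral>\<^sup>+y\<in>E. ennreal (cmod (g y) powr r) \<partial>lborel)"

abbreviation L2_mass :: "(real ^ 'n \<Rightarrow> complex) \<Rightarrow> (real ^ 'n::finite) set \<Rightarrow> ennreal" where
  "L2_mass g E \<equiv> (\<integral>\<^sup>+y\<in>E. ennreal ((cmod (g y))\<^sup>2) \<partial>lborel)"

definition half_open_cube :: "real ^ 'n \<Rightarrow> (real ^ 'n::finite) set" where
  "half_open_cube a = {x. \<forall>j. a $ j \<le> x $ j \<and> x $ j < a $ j + 1}"

lemma half_open_cube_measurable [measurable]: "half_open_cube a \<in> sets borel"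
proof -
  have "half_open_cube a = (\<Inter>j\<in>UNIV. {x. a $ j \<le> x $ j} \<inter> {x. x $ j < a $ j + 1})"
    by (auto simp: half_open_cube_def)
  also have "\<dots> \<in> sets borel"
    by (intro sets.countable_INT'' sets.Int borel_closed borel_open
        closed_Collect_le open_Collect_less continuous_intros) (auto simp: countable_finite)
  finally show ?thesis .
qed

lemma nn_integral_translate:
  fixes a :: "real ^ 'n::finite"
  assumes [measurable]: "g \<in> borel_measurable borel"
  shows "(\<integral>\<^sup>+x. g (a + x) \<partial>lborel) = (\<integral>\<^sup>+x. g x \<partial>lborel)"
proof -
  have "(\<integral>\<^sup>+x. g x \<partial>lborel) = (\<integral>\<^sup>+x. g x \<partial>distr lborel borel ((+) a))"
    by (simp add: lborel_distr_plus)
  also have "\<dots> = (\<integral>\<^sup>+x. g (a + x) \<partial>lborel)"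
    by (subst nn_integral_distr) auto
  finally show ?thesis by simp
qed

lemma AE_cube_half_open:
  fixes a :: "real ^ 'n::finite"
  shows "AE x in lborel. x \<in> cbox a (a + One) \<longleftrightarrow> x \<in> half_open_cube a"
proof -
  have "emeasure lborel (cbox a (a + One) - box a (a + One)) = 0"
    by (subst emeasure_Diff)
       (auto simp: emeasure_lborel_box_eq emeasure_lborel_cbox_eq box_subset_cbox inner_add_left)
  then have "cbox a (a + One) - box a (a + One) \<in> null_sets lborel"
    by (simp add: null_sets_def)
  from AE_not_in[OF this] show ?thesis
  proof eventually_elim
    case (elim x)
    then show ?case
      by (auto simp: half_open_cube_def mem_box_cart less_imp_le)
  qed
qed

lemma in_half_open_cube_unique:
  fixes x a :: "real ^ 'n::finite"
  obtains k where "\<And>k'. x - real_vec k' \<in> half_open_cube a \<longleftrightarrow> k' = k"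
proof
  fix k' :: "int ^ 'n"
  show "x - real_vec k' \<in> half_open_cube a \<longleftrightarrow> k' = (\<chi> j. \<lfloor>x $ j - a $ j\<rfloor>)"
    unfolding half_open_cube_def vec_eq_iff mem_Collect_eq
    by (intro all_cong1) (simp add: real_vec_def, linarith)
qed

lemma nn_integral_cube_half_open:
  "(\<integral>\<^sup>+x\<in>cbox a (a + One). g x \<partial>lborel) = (\<integral>\<^sup>+x\<in>half_open_cube a. g x \<partial>lborel)"
  by (intro nn_integral_cong_AE, use AE_cube_half_open[of a] in eventually_elim)
     (auto simp: indicator_def)

text \<open>
  Both cubes are fundamental domains of the lattice: cut the first one into the pieces that lie
  in the translates of the second one, and move the pieces back.
\<close>
lemma nn_integral_periodic_cube:
  fixes g :: "real ^ 'n::finite \<Rightarrow> ennreal"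
  assumes [measurable]: "g \<in> borel_measurable borel"
    and per: "\<And>x (k :: int ^ 'n). g (x + real_vec k) = g x"
  shows "(\<integral>\<^sup>+x\<in>cbox a (a + One). g x \<partial>lborel) = (\<integral>\<^sup>+x\<in>cbox b (b + One). g x \<partial>lborel)"
proof -
  define A where "A = half_open_cube a"
  define B where "B = half_open_cube b"
  have [measurable]: "A \<in> sets borel" "B \<in> sets borel"
    by (auto simp: A_def B_def)
  have one: "(\<integral>\<^sup>+k. indicator C (x - real_vec k) \<partial>count_space UNIV) = (1::ennreal)"
    if C: "C = half_open_cube c" for C c and x :: "real ^ 'n"
  proof -
    obtain k where k: "\<And>k'. x - real_vec k' \<in> C \<longleftrightarrow> k' = k"
      unfolding C by (rule in_half_open_cube_unique[where x = x and a = c]) auto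
    have "(\<integral>\<^sup>+k'. indicator C (x - real_vec k') \<partial>count_space UNIV)
        = (\<integral>\<^sup>+k'. indicator {k} k' \<partial>count_space UNIV)"
      by (intro nn_integral_cong) (auto simp: indicator_def k)
    then show ?thesis by simp
  qed
  have one': "(\<integral>\<^sup>+k. indicator A (x + real_vec k) \<partial>count_space UNIV) = (1::ennreal)" for x
  proof -
    have "(\<integral>\<^sup>+k. indicator A (x + real_vec k) \<partial>count_space UNIV)
        = (\<integral>\<^sup>+k. indicator A (x - real_vec (- k)) \<partial>count_space UNIV)"
      by (simp add: real_vec_minus)
    also have "\<dots> = (\<integral>\<^sup>+k. indicator A (x - real_vec k) \<partial>count_space UNIV)"
      by (rule nn_integral_bij_count_space[where g = uminus])
         (auto intro!: bij_betwI[where g = uminus])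
    finally show ?thesis using one[OF A_def] by simp
  qed
  have "(\<integral>\<^sup>+x\<in>A. g x \<partial>lborel)
      = (\<integral>\<^sup>+x. (\<integral>\<^sup>+k. g x * indicator A x * indicator B (x - real_vec k) \<partial>count_space UNIV) \<partial>lborel)"
    by (simp add: nn_integral_cmult one[OF B_def])
  also have "\<dots> = (\<integral>\<^sup>+k. (\<integral>\<^sup>+x. g x * indicator A x * indicator B (x - real_vec k) \<partial>lborel) \<partial>count_space UNIV)"
    by (rule nn_integral_count_space_nn_integral) auto
  also have "\<dots> = (\<integral>\<^sup>+k. (\<integral>\<^sup>+x. g x * indicator A (x + real_vec k) * indicator B x \<partial>lborel) \<partial>count_space UNIV)"
  proof (rule nn_integral_cong)
    fix k :: "int ^ 'n"
    have "(\<integral>\<^sup>+x. g x * indicator A x * indicator B (x - real_vec k) \<partial>lborel)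
        = (\<integral>\<^sup>+x. g (real_vec k + x) * indicator A (real_vec k + x) * indicator B (real_vec k + x - real_vec k) \<partial>lborel)"
      by (subst nn_integral_translate[where a = "real_vec k", symmetric]) auto
    then show "(\<integral>\<^sup>+x. g x * indicator A x * indicator B (x - real_vec k) \<partial>lborel)
        = (\<integral>\<^sup>+x. g x * indicator A (x + real_vec k) * indicator B x \<partial>lborel)"
      by (simp add: add.commute[of "real_vec k"] per)
  qed
  also have "\<dots> = (\<integral>\<^sup>+x. (\<integral>\<^sup>+k. g x * indicator A (x + real_vec k) * indicator B x \<partial>count_space UNIV) \<partial>lborel)"
    by (rule nn_integral_count_space_nn_integral[symmetric]) auto
  also have "\<dots> = (\<integral>\<^sup>+x\<in>B. g x \<partial>lborel)"
  proof (intro nn_integral_cong)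
    fix x
    have "(\<integral>\<^sup>+k. g x * indicator A (x + real_vec k) * indicator B x \<partial>count_space UNIV)
       = (\<integral>\<^sup>+k. (g x * indicator B x) * indicator A (x + real_vec k) \<partial>count_space UNIV)"
      by (simp add: mult_ac)
    also have "\<dots> = g x * indicator B x"
      by (subst nn_integral_cmult) (auto simp: one')
    finally show "(\<integral>\<^sup>+k. g x * indicator A (x + real_vec k) * indicator B x \<partial>count_space UNIV)
       = g x * indicator B x" .
  qed
  finally show ?thesis
    by (simp add: nn_integral_cube_half_open A_def B_def)
qed

lemma continuous_set_integrable:
  fixes g :: "real ^ 'n::finite \<Rightarrow> 'b::{banach, second_countable_topology}"
  assumes "continuous_on UNIV g"
  shows "set_integrable lborel (cbox a b) g"
  unfolding set_integrable_def
  by (rule borel_integrable_compact) (auto intro: continuous_on_subset[OF assms])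

lemma continuous_borel_measurable:
  fixes g :: "'a::topological_space \<Rightarrow> 'b::topological_space"
  shows "continuous_on UNIV g \<Longrightarrow> g \<in> borel_measurable borel"
  by (rule borel_measurable_continuous_onI)

lemma integral_periodic_translate_real:
  fixes g :: "real ^ 'n::finite \<Rightarrow> real"
  assumes cont: "continuous_on UNIV g"
    and per: "\<And>x (k :: int ^ 'n). g (x + real_vec k) = g x"
  shows "(LINT x:unit_cube|lborel. g (x + v)) = (LINT x:unit_cube|lborel. g x)"
proof -
  have cont': "continuous_on UNIV (\<lambda>x. g (x + v))"
    by (rule continuous_on_compose2[OF cont]) (auto intro: continuous_intros)
  have *: "(\<integral>\<^sup>+x. ennreal (c * (indicator unit_cube x *\<^sub>R g (x + v))) \<partial>lborel)
     = (\<integral>\<^sup>+x. ennreal (c * (indicator unit_cube x *\<^sub>R g x)) \<partial>lborel)" for c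
  proof -
    have [measurable]: "g \<in> borel_measurable borel"
      by (rule continuous_borel_measurable[OF cont])
    have "(\<integral>\<^sup>+x. ennreal (c * (indicator unit_cube x *\<^sub>R g (x + v))) \<partial>lborel)
        = (\<integral>\<^sup>+x. ennreal (c * g (v + x)) * indicator (cbox v (v + One)) (v + x) \<partial>lborel)"
      by (intro nn_integral_cong) (auto simp: indicator_def add.commute mem_box_cart)
    also have "\<dots> = (\<integral>\<^sup>+x\<in>cbox v (v + One). ennreal (c * g x) \<partial>lborel)"
      by (rule nn_integral_translate) measurable
    also have "\<dots> = (\<integral>\<^sup>+x\<in>cbox 0 (0 + One). ennreal (c * g x) \<partial>lborel)"
      by (rule nn_integral_periodic_cube) (auto simp: per)
    also have "\<dots> = (\<integral>\<^sup>+x. ennreal (c * (indicator unit_cube x *\<^sub>R g x)) \<partial>lborel)"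
      by (intro nn_integral_cong) (auto simp: indicator_def)
    finally show ?thesis .
  qed
  show ?thesis
    unfolding set_lebesgue_integral_def
    using *[of 1] *[of "-1"]
      continuous_set_integrable[OF cont, of 0 One] continuous_set_integrable[OF cont', of 0 One]
    unfolding set_integrable_def
    by (simp add: real_lebesgue_integral_def)
qed

lemma set_integral_Re_Im:
  fixes g :: "'a \<Rightarrow> complex"
  assumes "set_integrable M A g"
  shows "(LINT x:A|M. g x) = Complex (LINT x:A|M. Re (g x)) (LINT x:A|M. Im (g x))"
  using assms unfolding set_integrable_def set_lebesgue_integral_def
  by (simp add: complex_eq_iff flip: integral_Re integral_Im)

lemma integral_periodic_translate:
  fixes g :: "real ^ 'n::finite \<Rightarrow> complex"
  assumes cont: "continuous_on UNIV g" and per: "periodic1 g"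
  shows "(LINT x:unit_cube|lborel. g (x + v)) = (LINT x:unit_cube|lborel. g x)"
proof -
  have cont': "continuous_on UNIV (\<lambda>x. g (x + v))"
    by (rule continuous_on_compose2[OF cont]) (auto intro: continuous_intros)
  show ?thesis
    using per
    by (simp add: set_integral_Re_Im[OF continuous_set_integrable[OF cont]]
        set_integral_Re_Im[OF continuous_set_integrable[OF cont']] periodic1_def
        integral_periodic_translate_real[where g = "\<lambda>x. Re (g x)"]
        integral_periodic_translate_real[where g = "\<lambda>x. Im (g x)"] cont continuous_intros)
qed

lemma integral_unit_cube_const: "(LINT x:(unit_cube :: (real ^ 'n::finite) set)|lborel. c) = (c::complex)"
proof -
  have "measure lborel (unit_cube :: (real ^ 'n) set) = 1"
    by (simp add: measure_lborel_cbox_eq)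
  moreover have "emeasure lborel (unit_cube :: (real ^ 'n) set) < \<infinity>"
    by (rule emeasure_lborel_cbox_finite)
  ultimately show ?thesis
    unfolding set_lebesgue_integral_def by simp
qed

text \<open>
  Translation by half a wave length along a coordinate in which the frequency does not vanish
  changes the sign of the integral.
\<close>
lemma integral_wave: "(LINT x:unit_cube|lborel. wave \<xi> x) = (if \<xi> = 0 then 1 else 0)"
proof (cases "\<xi> = 0")
  case True
  then show ?thesis by (simp add: integral_unit_cube_const)
next
  case False
  then obtain j where j: "\<xi> $ j \<noteq> 0" by (auto simp: vec_eq_iff)
  define v where "v = axis j (1 / (2 * real_of_int (\<xi> $ j)))"
  have "v \<bullet> real_vec \<xi> = 1 / 2"
    using j by (simp add: v_def inner_axis' real_vec_def)
  then have "2 * pi * (v \<bullet> real_vec \<xi>) = pi"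
    by simp
  then have v: "wave \<xi> v = - 1"
    by (simp only: wave_def cis_pi)
  have "(LINT x:unit_cube|lborel. wave \<xi> x) = (LINT x:unit_cube|lborel. wave \<xi> (x + v))"
    by (rule integral_periodic_translate[symmetric]) (auto intro: continuous_intros periodic1_wave)
  also have "\<dots> = - (LINT x:unit_cube|lborel. wave \<xi> x)"
    by (simp add: wave_add_point v set_lebesgue_integral_def)
  finally show ?thesis using False by simp
qed

text \<open>
  Expand the square; by the previous lemma only the diagonal survives the integration.
\<close>
lemma parseval_finite:
  assumes "finite S"
  shows "(LINT x:unit_cube|lborel. (cmod (\<Sum>\<xi>\<in>S. d \<xi> * wave \<xi> x))\<^sup>2) = (\<Sum>\<xi>\<in>S. (cmod (d \<xi>))\<^sup>2)"
proof -
  let ?g = "\<lambda>\<xi> \<eta> x. d \<xi> * cnj (d \<eta>) * wave (\<xi> - \<eta>) x"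
  have "complex_of_real (LINT x:unit_cube|lborel. (cmod (\<Sum>\<xi>\<in>S. d \<xi> * wave \<xi> x))\<^sup>2)
      = (LINT x:unit_cube|lborel. complex_of_real ((cmod (\<Sum>\<xi>\<in>S. d \<xi> * wave \<xi> x))\<^sup>2))"
    by (rule set_integral_complex_of_real[symmetric])
  also have "\<dots> = (LINT x:unit_cube|lborel. \<Sum>\<xi>\<in>S. \<Sum>\<eta>\<in>S. ?g \<xi> \<eta> x)"
    by (simp only: complex_norm_square cnj_sum sum_product wave_diff_freq complex_cnj_mult mult_ac)
  also have "\<dots> = (\<Sum>\<xi>\<in>S. \<Sum>\<eta>\<in>S. (LINT x:unit_cube|lborel. ?g \<xi> \<eta> x))"
  proof -
    have int: "set_integrable lborel unit_cube (?g \<xi> \<eta>)" for \<xi> \<eta>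
      by (intro continuous_set_integrable continuous_intros)
    show ?thesis
      using int unfolding set_lebesgue_integral_def set_integrable_def
      by (simp add: scaleR_sum_right Bochner_Integration.integral_sum Bochner_Integration.integrable_sum)
  qed
  also have "\<dots> = (\<Sum>\<xi>\<in>S. \<Sum>\<eta>\<in>S. if \<eta> = \<xi> then d \<xi> * cnj (d \<eta>) else 0)"
    by (intro sum.cong refl) (simp add: integral_wave)
  also have "\<dots> = (\<Sum>\<xi>\<in>S. d \<xi> * cnj (d \<xi>))"
    using assms by (simp add: sum.delta)
  also have "\<dots> = complex_of_real (\<Sum>\<xi>\<in>S. (cmod (d \<xi>))\<^sup>2)"
    by (simp only: complex_norm_square of_real_sum)
  finally show ?thesis
    using of_real_eq_iff by blast
qed


section \<open>A restricted Hausdorff-Young inequality\<close>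

lemma norm_set_integral_le:
  fixes g :: "real ^ 'n::finite \<Rightarrow> complex"
  assumes "continuous_on UNIV g"
  shows "cmod (LINT x:cbox a b|lborel. g x) \<le> (LINT x:cbox a b|lborel. cmod (g x))"
  unfolding set_lebesgue_integral_def
  by (rule order_trans[OF integral_norm_bound]) simp

lemma cube_integral_mono:
  fixes g h :: "real ^ 'n::finite \<Rightarrow> real"
  assumes "continuous_on UNIV g" "continuous_on UNIV h" "\<And>x. g x \<le> h x"
  shows "(LINT x:cbox a b|lborel. g x) \<le> (LINT x:cbox a b|lborel. h x)"
  using assms by (intro set_integral_mono continuous_set_integrable) auto

lemma cube_integral_add:
  fixes g h :: "real ^ 'n::finite \<Rightarrow> 'b::{banach, second_countable_topology}"
  assumes "continuous_on UNIV g" "continuous_on UNIV h"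
  shows "(LINT x:cbox a b|lborel. g x + h x) = (LINT x:cbox a b|lborel. g x) + (LINT x:cbox a b|lborel. h x)"
  using assms by (intro set_integral_add continuous_set_integrable) auto

lemma cube_integral_sum:
  fixes g :: "'i \<Rightarrow> real ^ 'n::finite \<Rightarrow> 'b::{banach, second_countable_topology}"
  assumes "\<And>i. i \<in> I \<Longrightarrow> continuous_on UNIV (g i)"
  shows "(LINT x:cbox a b|lborel. \<Sum>i\<in>I. g i x) = (\<Sum>i\<in>I. LINT x:cbox a b|lborel. g i x)"
  using continuous_set_integrable[OF assms, of _ a b]
  unfolding set_lebesgue_integral_def set_integrable_def
  by (simp add: scaleR_sum_right Bochner_Integration.integral_sum)

lemma nn_integral_cube_eq:
  fixes g :: "real ^ 'n::finite \<Rightarrow> real"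
  assumes "continuous_on UNIV g" "\<And>x. 0 \<le> g x"
  shows "(\<integral>\<^sup>+x\<in>cbox a b. ennreal (g x) \<partial>lborel) = ennreal (LINT x:cbox a b|lborel. g x)"
proof -
  have "(\<integral>\<^sup>+x\<in>cbox a b. ennreal (g x) \<partial>lborel) = (\<integral>\<^sup>+x. ennreal (indicator (cbox a b) x *\<^sub>R g x) \<partial>lborel)"
    by (intro nn_integral_cong) (auto simp: indicator_def)
  also have "\<dots> = ennreal (LINT x:cbox a b|lborel. g x)"
    unfolding set_lebesgue_integral_def
    using continuous_set_integrable[OF assms(1), of a b] assms(2)
    by (intro nn_integral_eq_integral) (auto simp: set_integrable_def)
  finally show ?thesis .
qed

lemma continuous_on_cmod_powr:
  fixes f :: "'a::topological_space \<Rightarrow> complex"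
  shows "continuous_on S f \<Longrightarrow> 0 < r \<Longrightarrow> continuous_on S (\<lambda>x. cmod (f x) powr r)"
  by (intro continuous_on_powr' continuous_intros) auto

lemma fourier_torus_eq:
  assumes "continuous_on UNIV f"
  shows "fourier_torus f \<xi> = (LINT x:unit_cube|lborel. cnj (wave \<xi> x) * f x)"
proof -
  have "(\<lambda>x. indicator unit_cube x *\<^sub>R (cnj (wave \<xi> x) * f x)) \<in> borel_measurable lborel"
    using assms by (intro borel_measurable_integrable[OF borel_integrable_compact])
      (auto intro!: continuous_intros intro: continuous_on_subset)
  note int = integral_completion[OF this]
  have "exp (- \<i> * complex_of_real t) = cnj (cis t)" for t
    unfolding cis_cnj unfolding cis_conv_exp by simp
  then show ?thesis
    using int unfolding fourier_torus_def set_lebesgue_integral_def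
    by (simp only: wave_def)
qed

text \<open>
  A substitute for Young's inequality that exploits the bound \<open>L\<close>. If \<open>t \<le> u / 2\<close>, the first term
  suffices. Otherwise \<open>t powr (1 - r) \<le> (u / 2) powr (1 - r)\<close>, because the exponent is negative.
\<close>
lemma mult_le_half_square:
  assumes "0 \<le> (t::real)" "0 \<le> u" "u \<le> L" "1 < r" "r \<le> 2"
  shows "t * u \<le> u\<^sup>2 / 2 + 2 powr (r - 1) * L powr (2 - r) * t powr r"
proof (cases "t \<le> u / 2")
  case True
  then have "t * u \<le> u / 2 * u" using assms by (intro mult_right_mono) auto
  also have "\<dots> \<le> u\<^sup>2 / 2 + 2 powr (r - 1) * L powr (2 - r) * t powr r"
    by (simp add: power2_eq_square)
  finally show ?thesis .
next
  case False
  show ?thesis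
  proof (cases "u = 0")
    case True
    then show ?thesis by simp
  next
    case u: False
    with assms False have t: "u / 2 < t" "0 < u" "0 < t" by auto
    have "t * u = t powr r * (t powr (1 - r) * u)"
      using t by (simp add: mult.assoc[symmetric] powr_add[symmetric])
    also have "\<dots> \<le> t powr r * ((u / 2) powr (1 - r) * u)"
      using t assms by (intro mult_left_mono mult_right_mono powr_mono2') auto
    also have "(u / 2) powr (1 - r) * u = 2 powr (r - 1) * u powr (2 - r)"
    proof -
      have "(u / 2) powr (1 - r) = u powr (1 - r) * 2 powr (r - 1)"
        using t powr_minus_divide[of 2 "1 - r"] by (simp add: powr_divide)
      then have "(u / 2) powr (1 - r) * u = 2 powr (r - 1) * (u powr (1 - r) * u powr 1)"
        using t by simp
      moreover have "u powr (1 - r) * u powr 1 = u powr (2 - r)"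
        by (simp only: powr_add[symmetric]) simp
      ultimately show ?thesis by simp
    qed
    also have "t powr r * (2 powr (r - 1) * u powr (2 - r)) \<le> t powr r * (2 powr (r - 1) * L powr (2 - r))"
      using t assms by (intro mult_left_mono powr_mono2) auto
    finally have "t * u \<le> t powr r * (2 powr (r - 1) * L powr (2 - r))" .
    moreover have "0 \<le> u\<^sup>2 / 2" by simp
    ultimately show ?thesis by (simp only: mult_ac)
  qed
qed

text \<open>
  The finite sum \<open>A2\<close> on the left is the pairing of \<open>h\<close> with the trigonometric polynomial \<open>F\<close>
  whose coefficients are those of \<open>h\<close>. By orthonormality \<open>F\<close> has mean square \<open>A2\<close>, and by the
  Cauchy-Schwarz inequality it is bounded by \<open>sqrt (card S * A2)\<close>. The previous lemma bounds the
  pairing in terms of these two quantities.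
\<close>
lemma restricted_hausdorff_young:
  fixes h :: "real ^ 'n::finite \<Rightarrow> complex"
  assumes cont: "continuous_on UNIV h" and S: "finite S" and r: "1 < r" "r \<le> 2"
  shows "(\<Sum>\<xi>\<in>S. (cmod (fourier_torus h \<xi>))\<^sup>2)
    \<le> 4 * real (card S) powr (2 / r - 1) * (LINT x:unit_cube|lborel. cmod (h x) powr r) powr (2 / r)"
proof -
  define c where "c = fourier_torus h"
  define A2 where "A2 = (\<Sum>\<xi>\<in>S. (cmod (c \<xi>))\<^sup>2)"
  define F where "F x = (\<Sum>\<xi>\<in>S. c \<xi> * wave \<xi> x)" for x
  define H where "H = (LINT x:unit_cube|lborel. cmod (h x) powr r)"
  define L where "L = sqrt (real (card S) * A2)"
  have A2: "0 \<le> A2" by (simp add: A2_def sum_nonneg)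
  have H: "0 \<le> H"
    unfolding H_def set_lebesgue_integral_def by (intro integral_nonneg_AE) auto
  have contF: "continuous_on UNIV F"
    unfolding F_def by (intro continuous_intros)
  have FL: "cmod (F x) \<le> L" for x
  proof -
    have "cmod (F x) \<le> (\<Sum>\<xi>\<in>S. cmod (c \<xi>) * 1)"
      unfolding F_def by (rule order_trans[OF norm_sum]) (simp add: norm_mult)
    also have "\<dots> \<le> sqrt ((\<Sum>\<xi>\<in>S. (cmod (c \<xi>))\<^sup>2) * (\<Sum>\<xi>\<in>S. 1\<^sup>2))"
      by (rule real_le_rsqrt[OF Cauchy_Schwarz_ineq_sum])
    finally show ?thesis by (simp add: L_def A2_def mult.commute)
  qed
  have "complex_of_real A2 = (\<Sum>\<xi>\<in>S. cnj (c \<xi>) * c \<xi>)"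
    by (simp only: A2_def of_real_sum complex_norm_square mult.commute)
  also have "\<dots> = (\<Sum>\<xi>\<in>S. LINT x:unit_cube|lborel. cnj (c \<xi>) * (cnj (wave \<xi> x) * h x))"
    by (simp add: c_def fourier_torus_eq[OF cont])
  also have "\<dots> = (LINT x:unit_cube|lborel. \<Sum>\<xi>\<in>S. cnj (c \<xi>) * (cnj (wave \<xi> x) * h x))"
    by (intro cube_integral_sum[symmetric] continuous_intros cont)
  also have "\<dots> = (LINT x:unit_cube|lborel. h x * cnj (F x))"
    by (simp add: F_def sum_distrib_left mult_ac)
  finally have "A2 = cmod (LINT x:unit_cube|lborel. h x * cnj (F x))"
    using A2 by (metis norm_of_real abs_of_nonneg)
  also have "\<dots> \<le> (LINT x:unit_cube|lborel. cmod (h x * cnj (F x)))"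
    by (intro norm_set_integral_le continuous_intros cont contF)
  also have "\<dots> \<le> (LINT x:unit_cube|lborel. (cmod (F x))\<^sup>2 / 2
      + 2 powr (r - 1) * L powr (2 - r) * cmod (h x) powr r)"
    using r FL
    by (intro cube_integral_mono continuous_intros cont contF continuous_on_cmod_powr)
       (auto simp: norm_mult intro!: mult_le_half_square)
  also have "\<dots> = (LINT x:unit_cube|lborel. (cmod (F x))\<^sup>2) / 2 + 2 powr (r - 1) * L powr (2 - r) * H"
    using r by (subst cube_integral_add)
      (auto intro!: continuous_intros cont contF continuous_on_cmod_powr simp: H_def)
  also have "(LINT x:unit_cube|lborel. (cmod (F x))\<^sup>2) = A2"
    using parseval_finite[OF S, of c] by (simp add: F_def A2_def)
  finally have "A2 \<le> 2 * (2 powr (r - 1) * L powr (2 - r) * H)"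
    by simp
  also have "\<dots> = 2 powr r * (L powr (2 - r) * H)"
    by (simp add: powr_diff)
  finally have main: "A2 \<le> 2 powr r * (L powr (2 - r) * H)" .
  show ?thesis
  proof (cases "A2 = 0")
    case True
    then show ?thesis by (simp add: A2_def c_def)
  next
    case False
    with A2 have pos: "0 < A2" by simp
    \<comment> \<open>\<open>L\<close> contains \<open>A2\<close>, so the inequality has to be solved for \<open>A2\<close>.\<close>
    let ?N = "real (card S)"
    have L: "L powr (2 - r) = ?N powr (1 - r / 2) * A2 powr (1 - r / 2)"
      using A2 by (simp add: L_def powr_half_sqrt[symmetric] powr_powr powr_mult diff_divide_distrib)
    have "A2 powr (r / 2) * A2 powr (1 - r / 2) = A2"
      using pos by (simp add: powr_add[symmetric])
    then have "A2 powr (r / 2) * A2 powr (1 - r / 2) \<le> 2 powr r * (?N powr (1 - r / 2) * H) * A2 powr (1 - r / 2)"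
      using main unfolding L by (simp add: mult_ac)
    then have "A2 powr (r / 2) \<le> 2 powr r * (?N powr (1 - r / 2) * H)"
      using pos by (simp add: mult_le_cancel_right)
    then have "(A2 powr (r / 2)) powr (2 / r) \<le> (2 powr r * (?N powr (1 - r / 2) * H)) powr (2 / r)"
      using r by (intro powr_mono2) auto
    also have "(A2 powr (r / 2)) powr (2 / r) = A2"
      using pos r by (simp add: powr_powr)
    also have "(2 powr r * (?N powr (1 - r / 2) * H)) powr (2 / r) = 4 * ?N powr (2 / r - 1) * H powr (2 / r)"
    proof -
      have "(1 - r / 2) * (2 / r) = 2 / r - 1" using r by (simp add: field_simps)
      moreover have "(2::real) powr 2 = 4" by simp
      ultimately show ?thesis
        using H r by (simp add: powr_mult powr_powr del: powr_numeral)
    qed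
    finally show ?thesis by (simp add: A2_def c_def H_def)
  qed
qed


section \<open>Difference calculus and dyadic cutoffs\<close>

lemma pascal_sum:
  fixes g :: "nat \<Rightarrow> 'a::comm_semiring_1"
  shows "(\<Sum>l\<le>i. of_nat (i choose l) * (g (Suc l) + g l)) = (\<Sum>l\<le>Suc i. of_nat (Suc i choose l) * g l)"
proof -
  have "(\<Sum>l\<le>Suc i. of_nat (Suc i choose l) * g l)
      = g 0 + (\<Sum>l\<le>i. of_nat ((i choose l) + (i choose Suc l)) * g (Suc l))"
    by (subst sum.atMost_Suc_shift) (simp only: binomial_Suc_Suc binomial_n_0 of_nat_1 mult_1_left)
  also have "\<dots> = (\<Sum>l\<le>i. of_nat (i choose l) * g (Suc l)) + (g 0 + (\<Sum>l\<le>i. of_nat (i choose Suc l) * g (Suc l)))"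
    by (simp add: sum.distrib distrib_right add_ac)
  also have "g 0 + (\<Sum>l\<le>i. of_nat (i choose Suc l) * g (Suc l)) = (\<Sum>l\<le>Suc i. of_nat (i choose l) * g l)"
    by (subst sum.atMost_Suc_shift) simp
  finally show ?thesis
    by (simp add: sum.distrib distrib_left binomial_eq_0)
qed

lemma funpow_difference_Suc:
  "(difference j ^^ Suc i) u \<xi> = (difference j ^^ i) u (\<xi> + axis j 1) - (difference j ^^ i) u \<xi>"
  by (simp add: difference_def)

lemma axis_0 [simp]: "axis j 0 = 0"
  by (simp add: vec_eq_iff axis_def)

lemma axis_int_0: "\<xi> + axis j (int 0) = \<xi>"
  by (simp add: vec_eq_iff axis_def)

lemma axis_int_Suc: "\<xi> + axis j 1 + axis j (int l) = \<xi> + axis j (int (Suc l))"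
  by (simp add: vec_eq_iff axis_def)

text \<open>
  The Leibniz rule for differences. The shifts are all put on the first factor, which will be a
  cutoff, so that the second one, the symbol, is evaluated in the support only.
\<close>
lemma difference_funpow_mult:
  "(difference j ^^ i) (\<lambda>\<eta>. u \<eta> * v \<eta>) \<xi> =
    (\<Sum>l\<le>i. of_nat (i choose l) * ((difference j ^^ (i - l)) u (\<xi> + axis j (int l)) * (difference j ^^ l) v \<xi>))"
proof (induction i arbitrary: \<xi>)
  case 0
  show ?case by simp
next
  case (Suc i)
  define U where "U k = (difference j ^^ k) u" for k
  define V where "V k = (difference j ^^ k) v" for k
  define g where "g l = U (Suc i - l) (\<xi> + axis j (int l)) * V l \<xi>" for l
  have Usuc: "U (Suc k) \<eta> = U k (\<eta> + axis j 1) - U k \<eta>" for k \<eta>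
    unfolding U_def by (rule funpow_difference_Suc)
  have Vsuc: "V (Suc k) \<eta> = V k (\<eta> + axis j 1) - V k \<eta>" for k \<eta>
    unfolding V_def by (rule funpow_difference_Suc)
  have "(difference j ^^ Suc i) (\<lambda>\<eta>. u \<eta> * v \<eta>) \<xi>
     = (\<Sum>l\<le>i. of_nat (i choose l) * (U (i - l) (\<xi> + axis j (int (Suc l))) * V l (\<xi> + axis j 1)
          - U (i - l) (\<xi> + axis j (int l)) * V l \<xi>))"
    by (simp only: funpow_difference_Suc Suc.IH U_def[symmetric] V_def[symmetric]
        sum_subtractf[symmetric] right_diff_distrib axis_int_Suc)
  also have "\<dots> = (\<Sum>l\<le>i. of_nat (i choose l) * (g (Suc l) + g l))"
  proof (intro sum.cong refl arg_cong2[where f = "(*)"])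
    fix l assume "l \<in> {..i}"
    then have l: "Suc i - l = Suc (i - l)" by simp
    have "\<xi> + axis j (int l) + axis j 1 = \<xi> + axis j (int (Suc l))"
      by (simp add: vec_eq_iff axis_def)
    then show "U (i - l) (\<xi> + axis j (int (Suc l))) * V l (\<xi> + axis j 1)
          - U (i - l) (\<xi> + axis j (int l)) * V l \<xi> = g (Suc l) + g l"
      unfolding g_def l Usuc Vsuc by (simp add: algebra_simps)
  qed
  also have "\<dots> = (\<Sum>l\<le>Suc i. of_nat (Suc i choose l) * g l)"
    by (rule pascal_sum)
  finally show ?case by (simp only: g_def U_def V_def)
qed

lemma difference_funpow_mult_coordinate:
  "(difference j ^^ i) (\<lambda>\<eta>. u \<eta> * of_int (\<eta> $ j')) \<xi> =
    (difference j ^^ i) u \<xi> * of_int (\<xi> $ j')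
    + (if j = j' then of_nat i * (difference j ^^ (i - 1)) u (\<xi> + axis j 1) else 0)"
proof (induction i arbitrary: \<xi>)
  case (Suc i)
  show ?case
  proof (cases i)
    case 0
    then show ?thesis by (simp add: difference_def axis_def algebra_simps)
  next
    case (Suc i')
    then show ?thesis
      unfolding funpow_difference_Suc Suc.IH
      by (simp add: funpow_difference_Suc[of i'] axis_def algebra_simps
          del: funpow.simps)
  qed
qed simp


text \<open>
  Iterated averages of an indicator function serve as smooth cutoffs: a difference of an average
  over \<open>L\<close> points is a difference quotient over the distance \<open>L\<close>, so that each average pays for
  one difference.
\<close>
definition moving_average :: "nat \<Rightarrow> (int \<Rightarrow> real) \<Rightarrow> int \<Rightarrow> real" where
  "moving_average L g t = (\<Sum>i<L. g (t + int i)) / real L"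

definition forward_step :: "(int \<Rightarrow> real) \<Rightarrow> int \<Rightarrow> real" where
  "forward_step g t = g (t + 1) - g t"

lemma forward_step_moving_average: "forward_step (moving_average L g) t = (g (t + int L) - g t) / real L"
proof -
  have "(\<Sum>i<L. g (t + 1 + int i)) - (\<Sum>i<L. g (t + int i)) = g (t + int L) - g t"
    using sum_lessThan_telescope[of "\<lambda>i. g (t + int i)" L]
    by (simp add: sum_subtractf add_ac)
  then show ?thesis
    by (simp add: forward_step_def moving_average_def flip: diff_divide_distrib)
qed

lemma funpow_moving_average_Suc:
  "(moving_average L ^^ Suc N) g t = (\<Sum>i<L. (moving_average L ^^ N) g (t + int i)) / real L"
  by (simp only: funpow.simps comp_apply) (rule moving_average_def)

lemma funpow_step_shift_diff:
  "(forward_step ^^ i) (\<lambda>t. (g (t + a) - g t) / c) t = ((forward_step ^^ i) g (t + a) - (forward_step ^^ i) g t) / c"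
  by (induction i arbitrary: t) (simp_all add: forward_step_def diff_divide_distrib add_ac)

lemma moving_average_range:
  assumes "0 < L" "\<And>t. 0 \<le> g t \<and> g t \<le> 1"
  shows "0 \<le> moving_average L g t \<and> moving_average L g t \<le> 1"
proof -
  have "(\<Sum>i<L. g (t + int i)) \<le> (\<Sum>i<L. 1)"
    by (rule sum_mono) (use assms in auto)
  moreover have "0 \<le> (\<Sum>i<L. g (t + int i))"
    by (rule sum_nonneg) (use assms in auto)
  ultimately show ?thesis using assms(1) by (simp add: moving_average_def)
qed

lemma funpow_moving_average_range:
  assumes "0 < L" "\<And>t. 0 \<le> g t \<and> g t \<le> 1"
  shows "0 \<le> (moving_average L ^^ N) g t \<and> (moving_average L ^^ N) g t \<le> 1"
  by (induction N arbitrary: t) (use assms moving_average_range[OF assms(1)] in auto)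

lemma funpow_step_moving_average_bound:
  assumes L: "0 < L" and g: "\<And>t. 0 \<le> g t \<and> g t \<le> 1" and "i \<le> N"
  shows "\<bar>(forward_step ^^ i) ((moving_average L ^^ N) g) t\<bar> \<le> (2 / real L) ^ i"
  using \<open>i \<le> N\<close>
proof (induction i arbitrary: N t)
  case 0
  then show ?case using funpow_moving_average_range[of L g N t, OF L g] by (simp add: abs_if)
next
  case (Suc i)
  then obtain M where M: "N = Suc M" "i \<le> M" by (cases N) auto
  let ?a = "(moving_average L ^^ M) g"
  have "(forward_step ^^ Suc i) ((moving_average L ^^ N) g) = (forward_step ^^ i) (forward_step (moving_average L ?a))"
    by (simp add: M funpow_swap1)
  also have "forward_step (moving_average L ?a) = (\<lambda>t. (?a (t + int L) - ?a t) / real L)"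
    by (rule ext) (rule forward_step_moving_average)
  finally have "\<bar>(forward_step ^^ Suc i) ((moving_average L ^^ N) g) t\<bar>
     = \<bar>(forward_step ^^ i) ?a (t + int L) - (forward_step ^^ i) ?a t\<bar> / real L"
    by (simp add: funpow_step_shift_diff abs_divide)
  also have "\<dots> \<le> ((2 / real L) ^ i + (2 / real L) ^ i) / real L"
    using Suc.IH[OF M(2), where t = "t + int L"] Suc.IH[OF M(2), where t = t]
    by (intro divide_right_mono) auto
  also have "\<dots> = (2 / real L) ^ Suc i" by simp
  finally show ?case .
qed

lemma funpow_moving_average_one:
  assumes "0 < L" "\<And>t. a \<le> t \<Longrightarrow> t \<le> b \<Longrightarrow> g t = 1"
  shows "a \<le> t \<Longrightarrow> t \<le> b - int N * int L \<Longrightarrow> (moving_average L ^^ N) g t = 1"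
proof (induction N arbitrary: t)
  case (Suc N)
  have "(moving_average L ^^ N) g (t + int i) = 1" if "i < L" for i
    using Suc.prems that by (intro Suc.IH) (auto simp: algebra_simps)
  then show ?case using assms(1) by (simp add: funpow_moving_average_Suc del: funpow.simps)
qed (use assms in auto)

lemma funpow_moving_average_zero:
  assumes "0 < L" "\<And>t. t < a \<or> b < t \<Longrightarrow> g t = 0"
  shows "t < a - int N * int L \<or> b < t \<Longrightarrow> (moving_average L ^^ N) g t = 0"
proof (induction N arbitrary: t)
  case (Suc N)
  have "(moving_average L ^^ N) g (t + int i) = 0" if "i < L" for i
    using Suc.prems that by (intro Suc.IH) (auto simp: algebra_simps)
  then show ?case using assms(1) by (simp add: funpow_moving_average_Suc del: funpow.simps)
qed (use assms in auto)

text \<open>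
  The averages look to the right, so the window extends \<open>N * 2 ^ k\<close> further in this direction;
  this keeps the value \<open>1\<close> on \<open>{- (2 ^ k)..2 ^ k}\<close>.
\<close>
definition plateau :: "nat \<Rightarrow> nat \<Rightarrow> int \<Rightarrow> real" where
  "plateau N k = (moving_average (2 ^ k) ^^ N) (indicator {- (2 ^ k) .. (int N + 1) * 2 ^ k})"

lemma plateau_range: "0 \<le> plateau N k t" "plateau N k t \<le> 1"
  using funpow_moving_average_range[of "2 ^ k" "indicator {- (2 ^ k) .. (int N + 1) * 2 ^ k}" N t]
  by (auto simp: plateau_def indicator_def)

lemma plateau_step: "i \<le> N \<Longrightarrow> \<bar>(forward_step ^^ i) (plateau N k) t\<bar> \<le> (2 / 2 ^ k) ^ i"
  using funpow_step_moving_average_bound[of "2 ^ k" "indicator {- (2 ^ k) .. (int N + 1) * 2 ^ k}" i N t]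
  by (auto simp: plateau_def indicator_def)

lemma plateau_one: "\<bar>t\<bar> \<le> 2 ^ k \<Longrightarrow> plateau N k t = 1"
  unfolding plateau_def
  by (rule funpow_moving_average_one[where a = "- (2 ^ k)" and b = "(int N + 1) * 2 ^ k"])
     (auto simp: algebra_simps)

lemma plateau_zero: "(int N + 1) * 2 ^ k < \<bar>t\<bar> \<Longrightarrow> plateau N k t = 0"
  unfolding plateau_def
  by (rule funpow_moving_average_zero[where a = "- (2 ^ k)" and b = "(int N + 1) * 2 ^ k"])
     (auto simp: algebra_simps abs_if split: if_splits)

definition ball_cutoff :: "nat \<Rightarrow> nat \<Rightarrow> int ^ 'n::finite \<Rightarrow> complex" where
  "ball_cutoff N k \<xi> = complex_of_real (\<Prod>j\<in>UNIV. plateau N k (\<xi> $ j))"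

lemma difference_funpow_ball_cutoff:
  "(difference j ^^ i) (ball_cutoff N k) \<xi>
    = complex_of_real ((forward_step ^^ i) (plateau N k) (\<xi> $ j) * (\<Prod>j'\<in>UNIV - {j}. plateau N k (\<xi> $ j')))"
proof (induction i arbitrary: \<xi>)
  case 0
  show ?case by (simp add: ball_cutoff_def prod.remove[of UNIV j])
next
  case (Suc i)
  have "(\<Prod>j'\<in>UNIV - {j}. plateau N k ((\<xi> + axis j 1) $ j')) = (\<Prod>j'\<in>UNIV - {j}. plateau N k (\<xi> $ j'))"
    by (rule prod.cong) (auto simp: axis_def)
  then show ?case
    unfolding funpow_difference_Suc Suc.IH
    by (simp add: forward_step_def[of "(forward_step ^^ i) (plateau N k)"] algebra_simps)
qed

lemma ball_cutoff_difference_bound: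
  assumes "i \<le> N"
  shows "cmod ((difference j ^^ i) (ball_cutoff N k) \<xi>) \<le> (2 / 2 ^ k) ^ i"
proof -
  have "\<bar>\<Prod>j'\<in>UNIV - {j}. plateau N k (\<xi> $ j')\<bar> \<le> 1"
    by (simp add: abs_prod plateau_range prod_le_1)
  then have "\<bar>(forward_step ^^ i) (plateau N k) (\<xi> $ j)\<bar> * \<bar>\<Prod>j'\<in>UNIV - {j}. plateau N k (\<xi> $ j')\<bar>
      \<le> (2 / 2 ^ k) ^ i * 1"
    by (intro mult_mono plateau_step assms) auto
  then show ?thesis
    by (simp only: difference_funpow_ball_cutoff norm_of_real abs_mult)
qed

lemma ball_cutoff_one: "(\<And>j. \<bar>\<xi> $ j\<bar> \<le> 2 ^ k) \<Longrightarrow> ball_cutoff N k \<xi> = 1"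
  by (simp add: ball_cutoff_def plateau_one)

lemma ball_cutoff_zero: "(int N + 1) * 2 ^ k < \<bar>\<xi> $ j\<bar> \<Longrightarrow> ball_cutoff N k \<xi> = 0"
  using plateau_zero[of N k "\<xi> $ j"] by (auto simp: ball_cutoff_def)

lemma cmod_ball_cutoff: "cmod (ball_cutoff N k \<xi>) \<le> 1"
  using ball_cutoff_difference_bound[of 0 N undefined k \<xi>] by simp

definition shell_cutoff :: "nat \<Rightarrow> nat \<Rightarrow> int ^ 'n::finite \<Rightarrow> complex" where
  "shell_cutoff N k \<xi> = (if k = 0 then ball_cutoff N 0 \<xi> else ball_cutoff N k \<xi> - ball_cutoff N (k - 1) \<xi>)"

lemma sum_shell_cutoff: "(\<Sum>k\<le>K. shell_cutoff N k \<xi>) = ball_cutoff N K \<xi>"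
  by (induction K) (simp_all add: shell_cutoff_def)

lemma difference_funpow_diff:
  "(difference j ^^ i) (\<lambda>\<eta>. u \<eta> - v \<eta>) \<xi> = (difference j ^^ i) u \<xi> - (difference j ^^ i) v \<xi>"
  by (induction i arbitrary: \<xi>) (simp_all add: difference_def)

lemma shell_cutoff_difference_bound:
  assumes "i \<le> N"
  shows "cmod ((difference j ^^ i) (shell_cutoff N k) \<xi>) \<le> 2 * (4 / 2 ^ k) ^ i"
proof (cases k)
  case 0
  then have "shell_cutoff N k = (ball_cutoff N 0 :: int ^ 'a \<Rightarrow> complex)"
    by (simp add: fun_eq_iff shell_cutoff_def)
  then have "cmod ((difference j ^^ i) (shell_cutoff N k) \<xi>) \<le> 2 ^ i"
    using ball_cutoff_difference_bound[OF assms, of j 0 \<xi>] by simp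
  also have "\<dots> \<le> 4 ^ i" by (rule power_mono) auto
  also have "\<dots> \<le> 2 * (4::real) ^ i" by simp
  finally show ?thesis using 0 by simp
next
  case (Suc k')
  then have "shell_cutoff N k = (\<lambda>\<xi> :: int ^ 'a. ball_cutoff N k \<xi> - ball_cutoff N k' \<xi>)"
    by (simp add: fun_eq_iff shell_cutoff_def)
  then have "cmod ((difference j ^^ i) (shell_cutoff N k) \<xi>)
      \<le> cmod ((difference j ^^ i) (ball_cutoff N k) \<xi>) + cmod ((difference j ^^ i) (ball_cutoff N k') \<xi>)"
    by (simp add: difference_funpow_diff norm_triangle_ineq4)
  also have "\<dots> \<le> (2 / 2 ^ k) ^ i + (2 / 2 ^ k') ^ i"
    by (intro add_mono ball_cutoff_difference_bound assms)
  also have "\<dots> \<le> (4 / 2 ^ k) ^ i + (4 / 2 ^ k) ^ i"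
    by (intro add_mono power_mono) (auto simp: Suc field_simps)
  finally show ?thesis by simp
qed

text \<open>
  Contains all points from which at most \<open>N\<close> unit steps in one direction lead into the support of
  the cutoff, and hence all points at which a difference of the cutoff of order at most \<open>N\<close> can
  be nonzero.
\<close>
definition shell :: "nat \<Rightarrow> nat \<Rightarrow> (int ^ 'n::finite) set" where
  "shell N k = {\<xi>. (\<forall>j. \<bar>\<xi> $ j\<bar> \<le> (2 * int N + 1) * 2 ^ k) \<and> (k = 0 \<or> (\<exists>j. 2 ^ k \<le> 2 * (\<bar>\<xi> $ j\<bar> + int N)))}"

lemma shell_cutoff_support:
  assumes "shell_cutoff N k (\<xi> + axis j (int a)) \<noteq> 0" "a \<le> N"
  shows "\<xi> \<in> shell N k"
proof -
  define \<eta> where "\<eta> = \<xi> + axis j (int a)"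
  have ax: "\<bar>\<xi> $ j'\<bar> \<le> \<bar>\<eta> $ j'\<bar> + int N" "\<bar>\<eta> $ j'\<bar> \<le> \<bar>\<xi> $ j'\<bar> + int N" for j'
    using assms(2) by (auto simp: axis_def \<eta>_def)
  have eta: "\<bar>\<eta> $ j'\<bar> \<le> (int N + 1) * 2 ^ k" for j'
  proof (rule ccontr)
    assume neg: "\<not> \<bar>\<eta> $ j'\<bar> \<le> (int N + 1) * 2 ^ k"
    have "(int N + 1) * 2 ^ (k - 1) \<le> (int N + 1) * 2 ^ k"
      by (intro mult_left_mono power_increasing) auto
    with neg have "(int N + 1) * 2 ^ k < \<bar>\<eta> $ j'\<bar>" "(int N + 1) * 2 ^ (k - 1) < \<bar>\<eta> $ j'\<bar>"
      by linarith+
    then have "ball_cutoff N k \<eta> = 0" "ball_cutoff N (k - 1) \<eta> = 0"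
      by (auto intro!: ball_cutoff_zero[where j = j'] simp del: vector_add_component)
    then show False using assms(1)[folded \<eta>_def] by (auto simp: shell_cutoff_def split: if_splits)
  qed
  have up1: "\<bar>\<xi> $ j'\<bar> \<le> (int N + 1) * 2 ^ k + int N * 1" for j'
    using eta[of j'] ax(1)[of j'] by linarith
  have "int N * 1 \<le> int N * 2 ^ k"
    by (intro mult_left_mono) auto
  moreover have "(2 * int N + 1) * 2 ^ k = (int N + 1) * 2 ^ k + int N * 2 ^ k"
    by (simp add: algebra_simps)
  ultimately have up: "\<bar>\<xi> $ j'\<bar> \<le> (2 * int N + 1) * 2 ^ k" for j'
    using up1[of j'] by linarith
  have "\<exists>j'. 2 ^ k \<le> 2 * (\<bar>\<xi> $ j'\<bar> + int N)" if "k \<noteq> 0"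
  proof (rule ccontr)
    assume neg: "\<not> ?thesis"
    define h :: int where "h = 2 ^ (k - 1)"
    have half: "2 ^ k = 2 * h" "0 \<le> h" using that by (cases k; simp add: h_def)+
    have low: "\<bar>\<eta> $ j'\<bar> \<le> h" for j'
    proof -
      have "2 * \<bar>\<eta> $ j'\<bar> \<le> 2 * (\<bar>\<xi> $ j'\<bar> + int N)"
        using ax(2)[of j'] by (rule mult_left_mono) simp
      also have "\<dots> < 2 ^ k" using neg by (simp add: not_le)
      finally show ?thesis using half(1) by simp
    qed
    moreover have "\<bar>\<eta> $ j'\<bar> \<le> 2 ^ k" for j'
      using low[of j'] half by linarith
    ultimately have "ball_cutoff N k \<eta> = 1" "ball_cutoff N (k - 1) \<eta> = 1"
      by (auto intro!: ball_cutoff_one simp: h_def)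
    then show False using assms(1)[folded \<eta>_def] that by (simp add: shell_cutoff_def)
  qed
  then show ?thesis using up by (auto simp: shell_def)
qed

lemma lattice_box:
  assumes "finite T"
  shows "finite {\<xi> :: 'a ^ 'n::finite. \<forall>j. \<xi> $ j \<in> T}" "card {\<xi> :: 'a ^ 'n. \<forall>j. \<xi> $ j \<in> T} = card T ^ CARD('n)"
proof -
  have bij: "bij_betw vec_nth {\<xi> :: 'a ^ 'n. \<forall>j. \<xi> $ j \<in> T} (PiE UNIV (\<lambda>_. T))"
    by (rule bij_betwI[where g = vec_lambda]) (auto simp: PiE_UNIV_domain)
  show "finite {\<xi> :: 'a ^ 'n. \<forall>j. \<xi> $ j \<in> T}"
    using bij_betw_finite[OF bij] assms by (simp add: finite_PiE)
  show "card {\<xi> :: 'a ^ 'n. \<forall>j. \<xi> $ j \<in> T} = card T ^ CARD('n)"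
    using bij_betw_same_card[OF bij] by (simp add: card_PiE)
qed

lemma shell_subset_box:
  "shell N k \<subseteq> {\<xi>. \<forall>j. \<xi> $ j \<in> {- ((2 * int N + 1) * 2 ^ k) .. (2 * int N + 1) * 2 ^ k}}"
proof (clarify)
  fix \<xi> :: "int ^ 'n" and j
  assume "\<xi> \<in> shell N k"
  then have "\<bar>\<xi> $ j\<bar> \<le> (2 * int N + 1) * 2 ^ k" by (simp add: shell_def)
  then show "\<xi> $ j \<in> {- ((2 * int N + 1) * 2 ^ k) .. (2 * int N + 1) * 2 ^ k}" by auto
qed

lemma finite_shell [simp]: "finite (shell N k)"
  by (rule finite_subset[OF shell_subset_box lattice_box(1)]) simp

lemma card_shell_le:
  "real (card (shell N k :: (int ^ 'n::finite) set)) \<le> ((4 * real N + 3) * 2 ^ k) ^ CARD('n)"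
proof -
  let ?R = "(2 * int N + 1) * 2 ^ k"
  have "card (shell N k :: (int ^ 'n) set) \<le> card {\<xi> :: int ^ 'n. \<forall>j. \<xi> $ j \<in> {- ?R .. ?R}}"
    by (intro card_mono lattice_box shell_subset_box) simp
  also have "\<dots> = nat (2 * ?R + 1) ^ CARD('n)"
    by (subst lattice_box(2)) (simp_all add: mult_ac)
  finally have "real (card (shell N k :: (int ^ 'n) set)) \<le> real (nat (2 * ?R + 1)) ^ CARD('n)"
    by (metis of_nat_le_iff of_nat_power)
  also have "\<dots> \<le> ((4 * real N + 3) * 2 ^ k) ^ CARD('n)"
  proof (rule power_mono)
    have "real (nat (2 * ?R + 1)) = 2 * ((2 * real N + 1) * 2 ^ k) + 1"
      by simp
    also have "\<dots> \<le> 2 * ((2 * real N + 1) * 2 ^ k) + 2 ^ k" by simp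
    also have "\<dots> = (4 * real N + 3) * 2 ^ k" by (simp add: algebra_simps)
    finally show "real (nat (2 * ?R + 1)) \<le> (4 * real N + 3) * 2 ^ k" .
  qed simp
  finally show ?thesis .
qed

text \<open>
  The shells with small \<open>k\<close> contain points close to the origin, where the bracket is only bounded
  below by \<open>1\<close>; there \<open>2 ^ k\<close> is at most about \<open>2 * N\<close>, and the constant absorbs it.
\<close>
lemma japanese_bracket_shell:
  fixes \<xi> :: "int ^ 'n::finite"
  assumes "\<xi> \<in> shell N k"
  defines "D \<equiv> (2 * real N + 2) * (real CARD('n) + 1)"
  shows "2 ^ k \<le> D * japanese_bracket \<xi>" "japanese_bracket \<xi> \<le> D * 2 ^ k"
proof -
  have jb1: "1 \<le> japanese_bracket \<xi>"
    by (simp add: japanese_bracket_def)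
  have jbj: "\<bar>real_of_int (\<xi> $ j)\<bar> \<le> japanese_bracket \<xi>" for j
  proof -
    have "\<bar>real_of_int (\<xi> $ j)\<bar> \<le> norm (real_vec \<xi>)"
      using component_le_norm_cart[of "real_vec \<xi>" j] by (simp add: real_vec_def)
    also have "\<dots> \<le> japanese_bracket \<xi>"
      by (simp add: japanese_bracket_def real_le_rsqrt)
    finally show ?thesis .
  qed
  have "2 ^ k \<le> (2 * real N + 2) * japanese_bracket \<xi>"
  proof (cases "k = 0")
    case True
    have "1 * 1 \<le> (2 * real N + 2) * japanese_bracket \<xi>"
      using jb1 by (intro mult_mono) auto
    then show ?thesis using True by simp
  next
    case False
    then obtain j where "2 ^ k \<le> 2 * (\<bar>\<xi> $ j\<bar> + int N)"
      using assms(1) by (auto simp: shell_def)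
    then have "real_of_int (2 ^ k) \<le> real_of_int (2 * (\<bar>\<xi> $ j\<bar> + int N))"
      by (simp only: of_int_le_iff)
    then have "2 ^ k \<le> 2 * (\<bar>real_of_int (\<xi> $ j)\<bar> + real N)" by simp
    also have "\<dots> \<le> 2 * (japanese_bracket \<xi> + real N * japanese_bracket \<xi>)"
      using jbj[of j] jb1 by (intro mult_left_mono add_mono) (auto simp: mult_le_cancel_left1)
    also have "\<dots> = (2 * real N + 2) * japanese_bracket \<xi>" by (simp add: algebra_simps)
    finally show ?thesis .
  qed
  also have "\<dots> \<le> D * japanese_bracket \<xi>"
    unfolding D_def using jb1 by (intro mult_right_mono) (auto simp: mult_le_cancel_left1)
  finally show "2 ^ k \<le> D * japanese_bracket \<xi>" .
  have "japanese_bracket \<xi> \<le> 1 + norm (real_vec \<xi>)"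
    unfolding japanese_bracket_def by (rule real_le_lsqrt) (auto simp: power2_eq_square algebra_simps)
  also have "norm (real_vec \<xi>) \<le> (\<Sum>j\<in>UNIV. \<bar>real_vec \<xi> $ j\<bar>)"
    by (rule norm_le_l1_cart)
  also have "\<dots> \<le> (\<Sum>j\<in>(UNIV :: 'n set). (2 * real N + 1) * 2 ^ k)"
  proof (rule sum_mono)
    fix j
    have "\<bar>\<xi> $ j\<bar> \<le> (2 * int N + 1) * 2 ^ k" using assms(1) by (auto simp: shell_def)
    then have "real_of_int \<bar>\<xi> $ j\<bar> \<le> real_of_int ((2 * int N + 1) * 2 ^ k)"
      by (simp only: of_int_le_iff)
    then show "\<bar>real_vec \<xi> $ j\<bar> \<le> (2 * real N + 1) * 2 ^ k" by (simp add: real_vec_def)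
  qed
  also have "1 + (\<Sum>j\<in>(UNIV :: 'n set). (2 * real N + 1) * 2 ^ k) \<le> 2 ^ k + real CARD('n) * ((2 * real N + 1) * 2 ^ k)"
    by simp
  also have "\<dots> = (1 + real CARD('n) * (2 * real N + 1)) * 2 ^ k"
    by (simp add: algebra_simps)
  also have "\<dots> \<le> D * 2 ^ k"
    unfolding D_def by (intro mult_right_mono) (auto simp: algebra_simps)
  finally show "japanese_bracket \<xi> \<le> D * 2 ^ k" by simp
qed

lemma japanese_bracket_powr_shell:
  fixes \<xi> :: "int ^ 'n::finite"
  assumes "\<xi> \<in> shell N k"
  shows "japanese_bracket \<xi> powr e \<le> ((2 * real N + 2) * (real CARD('n) + 1)) powr \<bar>e\<bar> * (2 ^ k) powr e"
proof -
  define D where "D = (2 * real N + 2) * (real CARD('n) + 1)"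
  have D: "0 < D" unfolding D_def by (intro mult_pos_pos) auto
  note b = japanese_bracket_shell[OF assms, folded D_def]
  have jb: "0 < japanese_bracket \<xi>" 
    by (simp add: japanese_bracket_def add_pos_nonneg)
  show ?thesis
  proof (cases "0 \<le> e")
    case True
    then have "japanese_bracket \<xi> powr e \<le> (D * 2 ^ k) powr e"
      using b jb by (intro powr_mono2) auto
    then show ?thesis using True D by (simp add: powr_mult D_def)
  next
    case False
    have "japanese_bracket \<xi> powr e \<le> (2 ^ k / D) powr e"
      using False b D jb by (intro powr_mono2') (auto simp: field_simps)
    also have "\<dots> = D powr \<bar>e\<bar> * (2 ^ k) powr e"
      using False D by (simp add: powr_divide powr_minus field_simps)
    finally show ?thesis by (simp add: D_def)
  qed
qed

lemma difference_funpow_local: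
  assumes "\<And>a. a \<le> i \<Longrightarrow> u (\<xi> + axis j (int a)) = 0"
  shows "(difference j ^^ i) u \<xi> = 0"
  using assms
proof (induction i arbitrary: \<xi>)
  case 0
  then show ?case using 0[of 0] by (simp only: axis_int_0) simp
next
  case (Suc i)
  have "u (\<xi> + axis j 1 + axis j (int a)) = 0" if "a \<le> i" for a
    using Suc.prems[of "Suc a"] that by (simp only: axis_int_Suc)
  then show ?case
    unfolding funpow_difference_Suc by (simp add: Suc)
qed

lemma shell_cutoff_coordinate_difference_bound:
  fixes \<xi> :: "int ^ 'n::finite"
  assumes i: "i \<le> N"
  shows "cmod ((difference j ^^ i) (\<lambda>\<eta>. shell_cutoff N k \<eta> * of_int (\<eta> $ j')) \<xi>)
    \<le> (2 * (4 * real N + 1) * 4 ^ N * 2 ^ k) * (1 / 2 ^ k) ^ i"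
proof (cases "\<xi> \<in> shell N k")
  case False
  then have "shell_cutoff N k (\<xi> + axis j (int a)) = 0" if "a \<le> i" for a
    using shell_cutoff_support[of N k \<xi> j a] that i by auto
  then have "(difference j ^^ i) (\<lambda>\<eta>. shell_cutoff N k \<eta> * of_int (\<eta> $ j')) \<xi> = 0"
    by (intro difference_funpow_local) auto
  then show ?thesis by (simp add: norm_zero)
next
  case True
  let ?u = "shell_cutoff N k :: int ^ 'n \<Rightarrow> complex"
  have p4: "(4::real) ^ a \<le> 4 ^ N" if "a \<le> N" for a using that by (intro power_increasing) auto
  have 1: "cmod ((difference j ^^ i) ?u \<xi> * of_int (\<xi> $ j')) \<le> (2 * (4 ^ N * (1 / 2 ^ k) ^ i)) * ((2 * real N + 1) * 2 ^ k)"
    unfolding norm_mult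
  proof (rule mult_mono)
    have "cmod ((difference j ^^ i) ?u \<xi>) \<le> 2 * (4 / 2 ^ k) ^ i"
      by (rule shell_cutoff_difference_bound[OF i])
    also have "\<dots> = 2 * (4 ^ i * (1 / 2 ^ k) ^ i)" by (simp add: power_divide)
    also have "\<dots> \<le> 2 * (4 ^ N * (1 / 2 ^ k) ^ i)"
      using p4[OF i] by (intro mult_left_mono mult_right_mono) auto
    finally show "cmod ((difference j ^^ i) ?u \<xi>) \<le> 2 * (4 ^ N * (1 / 2 ^ k) ^ i)" .
    have "\<bar>\<xi> $ j'\<bar> \<le> (2 * int N + 1) * 2 ^ k" using True by (auto simp: shell_def)
    then have "real_of_int \<bar>\<xi> $ j'\<bar> \<le> real_of_int ((2 * int N + 1) * 2 ^ k)"
      by (simp only: of_int_le_iff)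
    then show "cmod (of_int (\<xi> $ j')) \<le> (2 * real N + 1) * 2 ^ k" by simp
  qed auto
  have 2: "cmod (of_nat i * (difference j ^^ (i - 1)) ?u (\<xi> + axis j 1)) \<le> real N * (2 * (4 ^ N * ((1 / 2 ^ k) ^ i * 2 ^ k)))"
  proof (cases i)
    case (Suc a)
    have "cmod ((difference j ^^ a) ?u (\<xi> + axis j 1)) \<le> 2 * (4 / 2 ^ k) ^ a"
      by (rule shell_cutoff_difference_bound) (use i Suc in auto)
    also have "\<dots> = 2 * (4 ^ a * (1 / 2 ^ k) ^ a)" by (simp add: power_divide)
    also have "\<dots> \<le> 2 * (4 ^ N * (1 / 2 ^ k) ^ a)"
      using p4[of a] i Suc by (intro mult_left_mono mult_right_mono) auto
    also have "(1 / 2 ^ k) ^ a = (1 / 2 ^ k) ^ i * (2::real) ^ k" by (simp add: Suc)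
    finally have "cmod ((difference j ^^ (i - 1)) ?u (\<xi> + axis j 1)) \<le> 2 * (4 ^ N * ((1 / 2 ^ k) ^ i * 2 ^ k))"
      by (simp add: Suc)
    then show ?thesis
      unfolding norm_mult norm_of_nat using i by (intro mult_mono) auto
  qed auto
  have "cmod ((difference j ^^ i) (\<lambda>\<eta>. ?u \<eta> * of_int (\<eta> $ j')) \<xi>)
     \<le> (2 * (4 ^ N * (1 / 2 ^ k) ^ i)) * ((2 * real N + 1) * 2 ^ k) + real N * (2 * (4 ^ N * ((1 / 2 ^ k) ^ i * 2 ^ k)))"
    unfolding difference_funpow_mult_coordinate
    by (rule order_trans[OF norm_triangle_ineq add_mono[OF 1]]) (use 2 in auto)
  also have "\<dots> \<le> (2 * (4 * real N + 1) * 4 ^ N * 2 ^ k) * (1 / 2 ^ k) ^ i"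
    by (simp add: algebra_simps)
  finally show ?thesis .
qed


section \<open>Trading weights for differences\<close>

text \<open>
  The weight measures the distance to \<open>c\<close> modulo the lattice. It is built from powers of waves
  because multiplication by a wave acts on Fourier coefficients as a shift.
\<close>
definition weight :: "nat \<Rightarrow> real \<Rightarrow> real ^ 'n \<Rightarrow> real ^ 'n::finite \<Rightarrow> real" where
  "weight N s c y = 1 + (\<Sum>j\<in>UNIV. (cmod (wave (axis j 1) (y - c) - 1) / s) ^ N)"

lemma weight_ge_1: "0 < s \<Longrightarrow> 1 \<le> weight N s c y"
  by (simp add: weight_def sum_nonneg)

lemma continuous_on_weight [continuous_intros]:
  "continuous_on S f \<Longrightarrow> continuous_on S g \<Longrightarrow> continuous_on S (\<lambda>y. weight N s (f y) (g y))"
  unfolding weight_def divide_inverse by (intro continuous_intros)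

lemma cmod_wave_axis_minus_1:
  "cmod (wave (axis j 1) y - 1) = 2 * \<bar>sin (pi * y $ j)\<bar>"
  using dist_exp_i_1[of "2 * pi * y $ j"]
  by (simp add: wave_axis cis_conv_exp mult.commute mult.left_commute)

lemma cmod_wave_axis_minus_1_le: "cmod (wave (axis j 1) y - 1) \<le> 2 * pi * \<bar>y $ j\<bar>"
  using abs_sin_x_le_abs_x[of "pi * y $ j"] by (simp add: cmod_wave_axis_minus_1 abs_mult)

text \<open>
  For even \<open>M\<close> the summands of the weight are trigonometric polynomials, since \<open>(cmod (w - 1))\<^sup>2
  = - (w - 1)\<^sup>2 * cnj w\<close> if \<open>w\<close> has modulus one.
\<close>
lemma cmod_wave_minus_1_power:
  assumes "even M"
  shows "complex_of_real (cmod (wave \<xi> y - 1) ^ (2 * M)) = (wave \<xi> y - 1) ^ (2 * M) * cnj (wave \<xi> y) ^ M"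
proof -
  let ?w = "wave \<xi> y"
  have "complex_of_real ((cmod (?w - 1))\<^sup>2) = - ((?w - 1)\<^sup>2 * cnj ?w)"
  proof -
    have "(?w - 1) * cnj ?w = 1 - cnj ?w" by (simp add: left_diff_distrib)
    then have 1: "(?w - 1)\<^sup>2 * cnj ?w = (?w - 1) * (1 - cnj ?w)"
      by (simp only: power2_eq_square mult.assoc)
    have "complex_of_real ((cmod (?w - 1))\<^sup>2) = (?w - 1) * cnj (?w - 1)"
      by (rule complex_norm_square)
    also have "\<dots> = - ((?w - 1) * (1 - cnj ?w))"
      by (simp add: right_diff_distrib)
    finally show ?thesis by (simp only: 1)
  qed
  then have "complex_of_real (cmod (?w - 1) ^ (2 * M)) = (- ((?w - 1)\<^sup>2 * cnj ?w)) ^ M"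
    by (simp only: power_mult of_real_power)
  also have "\<dots> = (?w - 1) ^ (2 * M) * cnj ?w ^ M"
    using assms by (simp add: power_mult_distrib power_mult)
  finally show ?thesis .
qed

lemma fourier_torus_add:
  assumes "continuous_on UNIV f" "continuous_on UNIV g"
  shows "fourier_torus (\<lambda>x. f x + g x) \<xi> = fourier_torus f \<xi> + fourier_torus g \<xi>"
proof -
  have "fourier_torus (\<lambda>x. f x + g x) \<xi>
      = (LINT x:unit_cube|lborel. cnj (wave \<xi> x) * f x + cnj (wave \<xi> x) * g x)"
    using assms by (subst fourier_torus_eq) (auto intro: continuous_intros simp: distrib_left)
  also have "\<dots> = (LINT x:unit_cube|lborel. cnj (wave \<xi> x) * f x) + (LINT x:unit_cube|lborel. cnj (wave \<xi> x) * g x)"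
    by (intro cube_integral_add continuous_intros assms)
  finally show ?thesis using assms by (simp only: fourier_torus_eq)
qed

lemma fourier_torus_cmult:
  assumes "continuous_on UNIV f"
  shows "fourier_torus (\<lambda>x. c * f x) \<xi> = c * fourier_torus f \<xi>"
proof -
  have "fourier_torus (\<lambda>x. c * f x) \<xi> = (LINT x:unit_cube|lborel. c * (cnj (wave \<xi> x) * f x))"
    using assms by (subst fourier_torus_eq) (auto intro: continuous_intros simp: mult_ac)
  then show ?thesis using assms by (simp add: fourier_torus_eq)
qed

lemma fourier_torus_sum:
  assumes "\<And>i. i \<in> I \<Longrightarrow> continuous_on UNIV (f i)"
  shows "fourier_torus (\<lambda>x. \<Sum>i\<in>I. f i x) \<xi> = (\<Sum>i\<in>I. fourier_torus (f i) \<xi>)"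
proof -
  have "fourier_torus (\<lambda>x. \<Sum>i\<in>I. f i x) \<xi> = (LINT x:unit_cube|lborel. \<Sum>i\<in>I. cnj (wave \<xi> x) * f i x)"
    using assms by (subst fourier_torus_eq) (auto intro: continuous_intros simp: sum_distrib_left)
  also have "\<dots> = (\<Sum>i\<in>I. LINT x:unit_cube|lborel. cnj (wave \<xi> x) * f i x)"
    by (intro cube_integral_sum continuous_intros assms)
  finally show ?thesis using assms by (simp add: fourier_torus_eq)
qed

lemma fourier_torus_modulate:
  assumes "continuous_on UNIV f"
  shows "fourier_torus (\<lambda>y. wave \<eta> (y - c) * f y) \<xi> = cnj (wave \<eta> c) * fourier_torus f (\<xi> - \<eta>)"
proof -
  have "fourier_torus (\<lambda>y. wave \<eta> (y - c) * f y) \<xi>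
      = (LINT y:unit_cube|lborel. cnj (wave \<eta> c) * (cnj (wave (\<xi> - \<eta>) y) * f y))"
    using assms by (subst fourier_torus_eq)
      (auto intro!: continuous_intros simp: wave_diff_point wave_diff_freq mult_ac)
  then show ?thesis using assms by (simp add: fourier_torus_eq)
qed

definition multiplier_op :: "(int ^ 'n::finite \<Rightarrow> complex) \<Rightarrow> (real ^ 'n \<Rightarrow> complex) \<Rightarrow> real ^ 'n \<Rightarrow> complex" where
  "multiplier_op a g x = (\<Sum>\<xi> | a \<xi> \<noteq> 0. a \<xi> * wave \<xi> x * fourier_torus g \<xi>)"

lemma multiplier_op_superset:
  assumes "finite F" "\<And>\<xi>. a \<xi> \<noteq> 0 \<Longrightarrow> \<xi> \<in> F"
  shows "multiplier_op a g x = (\<Sum>\<xi>\<in>F. a \<xi> * wave \<xi> x * fourier_torus g \<xi>)"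
  unfolding multiplier_op_def
  by (rule sum.mono_neutral_left) (use assms in auto)

text \<open>
  The effect on a multiplier of multiplying the function by \<open>wave (axis j 1) (y - c) - 1\<close>, with
  \<open>\<theta> = wave (axis j 1) (x - c)\<close> at the point \<open>x\<close> of evaluation; see \<open>multiplier_op_twist\<close>.
\<close>
definition twisted_difference :: "complex \<Rightarrow> 'n::finite \<Rightarrow> (int ^ 'n \<Rightarrow> complex) \<Rightarrow> int ^ 'n \<Rightarrow> complex" where
  "twisted_difference \<theta> j a \<xi> = \<theta> * a (\<xi> + axis j 1) - a \<xi>"

lemma finite_support_twisted:
  fixes a :: "int ^ 'n::finite \<Rightarrow> complex"
  assumes "finite {\<xi>. a \<xi> \<noteq> 0}"
  shows "finite {\<xi>. twisted_difference \<theta> j a \<xi> \<noteq> 0}"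
proof (rule finite_subset)
  show "{\<xi>. twisted_difference \<theta> j a \<xi> \<noteq> 0} \<subseteq> {\<xi>. a \<xi> \<noteq> 0} \<union> (\<lambda>\<xi>. \<xi> - axis j 1) ` {\<xi>. a \<xi> \<noteq> 0}"
    by (force simp: twisted_difference_def image_iff)
qed (use assms in auto)

text \<open>
  Multiplying the function by \<open>wave (axis j 1)\<close> shifts its Fourier coefficients, and this shift
  can be moved to the multiplier.
\<close>
lemma multiplier_op_twist:
  fixes a :: "int ^ 'n::finite \<Rightarrow> complex"
  assumes fin: "finite {\<xi>. a \<xi> \<noteq> 0}" and cont: "continuous_on UNIV g"
  shows "multiplier_op a (\<lambda>y. (wave (axis j 1) (y - c) - 1) * g y) x
    = multiplier_op (twisted_difference (wave (axis j 1) (x - c)) j a) g x"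
proof -
  let ?e = "axis j 1 :: int ^ 'n"
  let ?F = "{\<xi>. a \<xi> \<noteq> 0}"
  let ?sh = "\<lambda>\<xi>. \<xi> - ?e"
  let ?G = "?F \<union> ?sh ` ?F"
  have G: "finite ?G" using fin by auto
  have co: "fourier_torus (\<lambda>y. (wave ?e (y - c) - 1) * g y) \<xi>
      = cnj (wave ?e c) * fourier_torus g (\<xi> - ?e) - fourier_torus g \<xi>" for \<xi>
  proof -
    have "fourier_torus (\<lambda>y. (wave ?e (y - c) - 1) * g y) \<xi>
        = fourier_torus (\<lambda>y. wave ?e (y - c) * g y + (- 1) * g y) \<xi>"
      by (simp add: algebra_simps)
    also have "\<dots> = fourier_torus (\<lambda>y. wave ?e (y - c) * g y) \<xi> + fourier_torus (\<lambda>y. (- 1) * g y) \<xi>"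
      by (intro fourier_torus_add continuous_intros cont)
    finally show ?thesis
      unfolding fourier_torus_modulate[OF cont] fourier_torus_cmult[OF cont] by simp
  qed
  have "(\<Sum>\<xi>\<in>?F. a \<xi> * wave \<xi> x * (cnj (wave ?e c) * fourier_torus g (\<xi> - ?e)))
      = (\<Sum>\<eta>\<in>?sh ` ?F. a (\<eta> + ?e) * wave (\<eta> + ?e) x * (cnj (wave ?e c) * fourier_torus g \<eta>))"
    by (subst sum.reindex) (auto simp: inj_on_def)
  also have "\<dots> = (\<Sum>\<eta>\<in>?G. a (\<eta> + ?e) * wave (\<eta> + ?e) x * (cnj (wave ?e c) * fourier_torus g \<eta>))"
    by (rule sum.mono_neutral_left[OF G]) (auto simp: image_iff algebra_simps)
  finally have 1: "(\<Sum>\<xi>\<in>?F. a \<xi> * wave \<xi> x * (cnj (wave ?e c) * fourier_torus g (\<xi> - ?e)))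
      = (\<Sum>\<eta>\<in>?G. (wave ?e (x - c) * a (\<eta> + ?e)) * wave \<eta> x * fourier_torus g \<eta>)"
    by (simp add: wave_add_freq wave_diff_point mult_ac)
  have 2: "(\<Sum>\<xi>\<in>?F. a \<xi> * wave \<xi> x * fourier_torus g \<xi>) = (\<Sum>\<xi>\<in>?G. a \<xi> * wave \<xi> x * fourier_torus g \<xi>)"
    by (rule sum.mono_neutral_left[OF G]) auto
  have "multiplier_op a (\<lambda>y. (wave ?e (y - c) - 1) * g y) x
     = (\<Sum>\<xi>\<in>?F. a \<xi> * wave \<xi> x * (cnj (wave ?e c) * fourier_torus g (\<xi> - ?e)))
       - (\<Sum>\<xi>\<in>?F. a \<xi> * wave \<xi> x * fourier_torus g \<xi>)"
    unfolding multiplier_op_def co by (simp add: right_diff_distrib sum_subtractf)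
  also have "\<dots> = (\<Sum>\<eta>\<in>?G. twisted_difference (wave ?e (x - c)) j a \<eta> * wave \<eta> x * fourier_torus g \<eta>)"
    unfolding 1 2 twisted_difference_def by (simp add: sum_subtractf left_diff_distrib)
  also have "\<dots> = multiplier_op (twisted_difference (wave ?e (x - c)) j a) g x"
    by (rule multiplier_op_superset[symmetric, OF G]) (force simp: twisted_difference_def image_iff)
  finally show ?thesis .
qed

lemma multiplier_op_twist_funpow:
  fixes a :: "int ^ 'n::finite \<Rightarrow> complex"
  assumes "finite {\<xi>. a \<xi> \<noteq> 0}" and cont: "continuous_on UNIV g"
  shows "multiplier_op a (\<lambda>y. (wave (axis j 1) (y - c) - 1) ^ N * g y) x
    = multiplier_op ((twisted_difference (wave (axis j 1) (x - c)) j ^^ N) a) g x"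
  using assms(1)
proof (induction N arbitrary: a)
  case (Suc N)
  have "multiplier_op a (\<lambda>y. (wave (axis j 1) (y - c) - 1) ^ Suc N * g y) x
    = multiplier_op a (\<lambda>y. (wave (axis j 1) (y - c) - 1) * ((wave (axis j 1) (y - c) - 1) ^ N * g y)) x"
    by (simp add: mult.assoc)
  also have "\<dots> = multiplier_op (twisted_difference (wave (axis j 1) (x - c)) j a)
      (\<lambda>y. (wave (axis j 1) (y - c) - 1) ^ N * g y) x"
    by (intro multiplier_op_twist Suc.prems continuous_intros cont)
  also have "\<dots> = multiplier_op ((twisted_difference (wave (axis j 1) (x - c)) j ^^ Suc N) a) g x"
    by (subst Suc.IH[OF finite_support_twisted[OF Suc.prems]]) (simp add: funpow_swap1)
  finally show ?case .
qed simp

text \<open>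
  The binomial theorem for \<open>(\<theta> - 1) + \<theta> \<Delta>\<close>, where \<open>\<Delta>\<close> is the difference operator.
\<close>
lemma twisted_difference_funpow:
  "(twisted_difference \<theta> j ^^ N) a \<xi>
    = (\<Sum>i\<le>N. of_nat (N choose i) * ((\<theta> - 1) ^ (N - i) * \<theta> ^ i * (difference j ^^ i) a \<xi>))"
proof (induction N arbitrary: \<xi>)
  case (Suc N)
  define g where "g i = (\<theta> - 1) ^ (Suc N - i) * \<theta> ^ i * (difference j ^^ i) a \<xi>" for i
  have "(twisted_difference \<theta> j ^^ Suc N) a \<xi>
     = \<theta> * (twisted_difference \<theta> j ^^ N) a (\<xi> + axis j 1) - (twisted_difference \<theta> j ^^ N) a \<xi>"
    by (simp add: twisted_difference_def[of _ _ "(twisted_difference _ _ ^^ _) _"])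
  also have "\<dots> = (\<Sum>i\<le>N. of_nat (N choose i) * (\<theta> * ((\<theta> - 1) ^ (N - i) * \<theta> ^ i * (difference j ^^ i) a (\<xi> + axis j 1))
       - (\<theta> - 1) ^ (N - i) * \<theta> ^ i * (difference j ^^ i) a \<xi>))"
    unfolding Suc.IH by (simp add: sum_distrib_left sum_subtractf[symmetric] right_diff_distrib mult.left_commute[of \<theta>])
  also have "\<dots> = (\<Sum>i\<le>N. of_nat (N choose i) * (g (Suc i) + g i))"
  proof (intro sum.cong refl arg_cong2[where f = "(*)"])
    fix i assume "i \<in> {..N}"
    then have i: "Suc N - i = Suc (N - i)" by simp
    have D: "(difference j ^^ i) a (\<xi> + axis j 1) = (difference j ^^ Suc i) a \<xi> + (difference j ^^ i) a \<xi>"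
      unfolding funpow_difference_Suc by simp
    show "\<theta> * ((\<theta> - 1) ^ (N - i) * \<theta> ^ i * (difference j ^^ i) a (\<xi> + axis j 1))
       - (\<theta> - 1) ^ (N - i) * \<theta> ^ i * (difference j ^^ i) a \<xi> = g (Suc i) + g i"
      unfolding g_def D i by (simp add: algebra_simps del: funpow.simps)
  qed
  also have "\<dots> = (\<Sum>i\<le>Suc N. of_nat (Suc N choose i) * g i)"
    by (rule pascal_sum)
  finally show ?case by (simp only: g_def)
qed simp

definition weighted_part :: "nat \<Rightarrow> real \<Rightarrow> real ^ 'n \<Rightarrow> (real ^ 'n \<Rightarrow> complex) \<Rightarrow> real ^ 'n::finite \<Rightarrow> complex" where
  "weighted_part N s c f y = f y / complex_of_real (weight N s c y)"

text \<open>
  The factor in front of the weighted part, of modulus one, is what \<open>cmod_wave_minus_1_power\<close>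
  leaves over beside the power of \<open>wave (axis j 1) (y - c) - 1\<close>.
\<close>
definition modulated_part :: "nat \<Rightarrow> real \<Rightarrow> real ^ 'n \<Rightarrow> (real ^ 'n \<Rightarrow> complex) \<Rightarrow> 'n \<Rightarrow> real ^ 'n::finite \<Rightarrow> complex" where
  "modulated_part M s c f j y = cnj (wave (axis j 1) (y - c)) ^ M * weighted_part (2 * M) s c f y"

lemma continuous_weighted_part:
  assumes "0 < s" "continuous_on UNIV f"
  shows "continuous_on UNIV (weighted_part N s c f)"
proof -
  have "weight N s c y \<noteq> 0" for y using weight_ge_1[OF assms(1), of N c y] by auto
  then show ?thesis
    unfolding weighted_part_def by (intro continuous_intros assms) auto
qed

lemma continuous_modulated_part:
  assumes "0 < s" "continuous_on UNIV f"
  shows "continuous_on UNIV (modulated_part M s c f j)"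
  unfolding modulated_part_def
  by (intro continuous_intros continuous_weighted_part assms)

lemma cmod_modulated_part: "cmod (modulated_part M s c f j y) = cmod (weighted_part (2 * M) s c f y)"
  by (simp add: modulated_part_def norm_mult norm_power)

text \<open>
  Write \<open>f\<close> as the weight times the weighted part and expand the weight.
\<close>
lemma multiplier_op_weighted:
  fixes a :: "int ^ 'n::finite \<Rightarrow> complex"
  assumes fin: "finite {\<xi>. a \<xi> \<noteq> 0}" and cont: "continuous_on UNIV f" and s: "0 < s" and M: "even M"
  shows "multiplier_op a f x = multiplier_op a (weighted_part (2 * M) s c f) x
    + (\<Sum>j\<in>UNIV. complex_of_real ((1 / s) ^ (2 * M)) *
        multiplier_op ((twisted_difference (wave (axis j 1) (x - c)) j ^^ (2 * M)) a) (modulated_part M s c f j) x)"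
proof -
  let ?N = "2 * M"
  let ?h = "weighted_part ?N s c f"
  let ?e = "\<lambda>j y. wave (axis j 1) (y - c)"
  let ?t = "\<lambda>j y. (?e j y - 1) ^ ?N * modulated_part M s c f j y"
  have ch: "continuous_on UNIV ?h" by (intro continuous_weighted_part s cont)
  have ct: "continuous_on UNIV (?t j)" for j
    by (intro continuous_intros continuous_modulated_part s cont)
  have f: "f y = ?h y + (\<Sum>j\<in>UNIV. complex_of_real ((1 / s) ^ ?N) * ?t j y)" for y
  proof -
    have "weight ?N s c y \<noteq> 0" using weight_ge_1[OF s, of ?N c y] by auto
    then have "f y = complex_of_real (weight ?N s c y) * ?h y"
      by (simp add: weighted_part_def)
    also have "complex_of_real (weight ?N s c y)
       = 1 + (\<Sum>j\<in>UNIV. complex_of_real ((1 / s) ^ ?N) * ((?e j y - 1) ^ ?N * cnj (?e j y) ^ M))"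
      by (simp only: weight_def of_real_add of_real_1 of_real_sum divide_inverse power_mult_distrib
          of_real_mult cmod_wave_minus_1_power[OF M]) (simp add: mult_ac)
    finally show ?thesis
      by (simp add: modulated_part_def distrib_left distrib_right sum_distrib_left sum_distrib_right mult_ac)
  qed
  have "fourier_torus f \<xi> = fourier_torus ?h \<xi> + (\<Sum>j\<in>UNIV. complex_of_real ((1 / s) ^ ?N) * fourier_torus (?t j) \<xi>)" for \<xi>
  proof -
    have "fourier_torus f \<xi> = fourier_torus (\<lambda>y. ?h y + (\<Sum>j\<in>UNIV. complex_of_real ((1 / s) ^ ?N) * ?t j y)) \<xi>"
      by (rule arg_cong[where f = "\<lambda>F. fourier_torus F \<xi>"]) (rule ext, rule f)
    also have "\<dots> = fourier_torus ?h \<xi> + fourier_torus (\<lambda>y. \<Sum>j\<in>UNIV. complex_of_real ((1 / s) ^ ?N) * ?t j y) \<xi>"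
      by (intro fourier_torus_add ch continuous_intros ct)
    also have "fourier_torus (\<lambda>y. \<Sum>j\<in>UNIV. complex_of_real ((1 / s) ^ ?N) * ?t j y) \<xi>
       = (\<Sum>j\<in>UNIV. fourier_torus (\<lambda>y. complex_of_real ((1 / s) ^ ?N) * ?t j y) \<xi>)"
      by (intro fourier_torus_sum continuous_intros ct)
    finally show ?thesis by (simp only: fourier_torus_cmult[OF ct])
  qed
  then have "multiplier_op a f x = (\<Sum>\<xi> | a \<xi> \<noteq> 0. a \<xi> * wave \<xi> x *
      (fourier_torus ?h \<xi> + (\<Sum>j\<in>UNIV. complex_of_real ((1 / s) ^ ?N) * fourier_torus (?t j) \<xi>)))"
    by (simp only: multiplier_op_def)
  also have "\<dots> = multiplier_op a ?h x
     + (\<Sum>\<xi> | a \<xi> \<noteq> 0. \<Sum>j\<in>UNIV. complex_of_real ((1 / s) ^ ?N) * (a \<xi> * wave \<xi> x * fourier_torus (?t j) \<xi>))"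
    by (simp add: distrib_left sum.distrib multiplier_op_def sum_distrib_left mult_ac)
  also have "(\<Sum>\<xi> | a \<xi> \<noteq> 0. \<Sum>j\<in>UNIV. complex_of_real ((1 / s) ^ ?N) * (a \<xi> * wave \<xi> x * fourier_torus (?t j) \<xi>))
     = (\<Sum>j\<in>UNIV. complex_of_real ((1 / s) ^ ?N) * multiplier_op a (?t j) x)"
    by (subst sum.swap) (simp only: multiplier_op_def sum_distrib_left)
  also have "\<dots> = (\<Sum>j\<in>UNIV. complex_of_real ((1 / s) ^ ?N) *
        multiplier_op ((twisted_difference (?e j x) j ^^ ?N) a) (modulated_part M s c f j) x)"
    by (simp only: multiplier_op_twist_funpow[OF fin continuous_modulated_part[OF s cont]])
  finally show ?thesis .
qed

text \<open>
  Near \<open>c\<close> the factors \<open>\<theta> - 1\<close> of the twisted differences are of size \<open>s\<close>. Hence a term with a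
  difference of order \<open>i\<close> retains only the power \<open>(1 / s) ^ i\<close> of the large factor in front.
\<close>
lemma twisted_multiplier_bound:
  fixes u v :: "int ^ 'n::finite \<Rightarrow> complex"
  assumes S: "finite S" and supp: "\<And>\<xi> a. a \<le> N \<Longrightarrow> u (\<xi> + axis j (int a)) \<noteq> 0 \<Longrightarrow> \<xi> \<in> S"
    and s: "0 < s" and near: "\<bar>x $ j - c $ j\<bar> \<le> s"
  shows "(1 / s) ^ N * cmod (multiplier_op ((twisted_difference (wave (axis j 1) (x - c)) j ^^ N) (\<lambda>\<xi>. u \<xi> * v \<xi>)) g x)
    \<le> (\<Sum>i\<le>N. \<Sum>l\<le>i. (8 * pi) ^ N * ((1 / s) ^ i * cmod (\<Sum>\<xi>\<in>S. (difference j ^^ (i - l)) u (\<xi> + axis j (int l)) * fourier_torus g \<xi>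
          * wave \<xi> x * (difference j ^^ l) v \<xi>)))"
proof -
  define \<theta> where "\<theta> = wave (axis j 1) (x - c)"
  let ?uv = "\<lambda>\<xi>. u \<xi> * v \<xi>"
  define X where "X i = (\<Sum>\<xi>\<in>S. (difference j ^^ i) ?uv \<xi> * wave \<xi> x * fourier_torus g \<xi>)" for i
  define Y where "Y i l = (\<Sum>\<xi>\<in>S. (difference j ^^ (i - l)) u (\<xi> + axis j (int l)) * fourier_torus g \<xi>
          * wave \<xi> x * (difference j ^^ l) v \<xi>)" for i l
  have zero: "(difference j ^^ i) ?uv \<xi> = 0" if "i \<le> N" "\<xi> \<notin> S" for i \<xi>
  proof (rule difference_funpow_local)
    fix a assume "a \<le> i"
    then show "u (\<xi> + axis j (int a)) * v (\<xi> + axis j (int a)) = 0"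
      using supp[of a \<xi>] that by auto
  qed
  have "multiplier_op ((twisted_difference \<theta> j ^^ N) ?uv) g x
     = (\<Sum>\<xi>\<in>S. (twisted_difference \<theta> j ^^ N) ?uv \<xi> * wave \<xi> x * fourier_torus g \<xi>)"
  proof (rule multiplier_op_superset[OF S])
    fix \<xi> assume nz: "(twisted_difference \<theta> j ^^ N) ?uv \<xi> \<noteq> 0"
    show "\<xi> \<in> S"
    proof (rule ccontr)
      assume "\<xi> \<notin> S"
      then have "(twisted_difference \<theta> j ^^ N) ?uv \<xi> = 0"
        unfolding twisted_difference_funpow by (intro sum.neutral) (simp add: zero)
      with nz show False by simp
    qed
  qed
  also have "\<dots> = (\<Sum>i\<le>N. of_nat (N choose i) * (\<theta> - 1) ^ (N - i) * \<theta> ^ i * X i)"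
    unfolding twisted_difference_funpow X_def
    by (simp add: sum_distrib_left sum_distrib_right mult_ac) (rule sum.swap)
  finally have eq: "multiplier_op ((twisted_difference \<theta> j ^^ N) ?uv) g x
     = (\<Sum>i\<le>N. of_nat (N choose i) * (\<theta> - 1) ^ (N - i) * \<theta> ^ i * X i)" .
  have th: "cmod (\<theta> - 1) \<le> 2 * pi * s"
    unfolding \<theta>_def
    by (rule order_trans[OF cmod_wave_axis_minus_1_le]) (use near in auto)
  have X: "cmod (X i) \<le> (\<Sum>l\<le>i. 2 ^ N * cmod (Y i l))" if "i \<le> N" for i
  proof -
    have "X i = (\<Sum>l\<le>i. of_nat (i choose l) * Y i l)"
      unfolding difference_funpow_mult X_def Y_def
      by (simp add: sum_distrib_left sum_distrib_right mult_ac) (rule sum.swap)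
    then have "cmod (X i) \<le> (\<Sum>l\<le>i. real (i choose l) * cmod (Y i l))"
      by (simp add: norm_mult order_trans[OF norm_sum])
    also have "\<dots> \<le> (\<Sum>l\<le>i. 2 ^ N * cmod (Y i l))"
    proof (intro sum_mono mult_right_mono)
      fix l
      have "real (i choose l) \<le> real (2 ^ i)"
        by (simp only: of_nat_le_iff binomial_le_pow2)
      also have "\<dots> \<le> 2 ^ N" using that by (simp add: power_increasing)
      finally show "real (i choose l) \<le> 2 ^ N" .
    qed auto
    finally show ?thesis .
  qed
  have "(1 / s) ^ N * cmod (multiplier_op ((twisted_difference \<theta> j ^^ N) ?uv) g x)
      \<le> (1 / s) ^ N * (\<Sum>i\<le>N. cmod (of_nat (N choose i) * (\<theta> - 1) ^ (N - i) * \<theta> ^ i * X i))"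
    unfolding eq using s by (intro mult_left_mono norm_sum) auto
  also have "\<dots> = (\<Sum>i\<le>N. (1 / s) ^ N * (real (N choose i) * cmod (\<theta> - 1) ^ (N - i) * cmod (X i)))"
    by (subst sum_distrib_left) (simp add: norm_mult norm_power \<theta>_def)
  finally have main: "(1 / s) ^ N * cmod (multiplier_op ((twisted_difference \<theta> j ^^ N) ?uv) g x)
      \<le> (\<Sum>i\<le>N. (1 / s) ^ N * (real (N choose i) * cmod (\<theta> - 1) ^ (N - i) * cmod (X i)))" .
  have terms: "(1 / s) ^ N * (real (N choose i) * cmod (\<theta> - 1) ^ (N - i) * cmod (X i))
       \<le> (\<Sum>l\<le>i. (8 * pi) ^ N * ((1 / s) ^ i * cmod (Y i l)))" if "i \<in> {..N}" for i
  proof -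
    from that have i: "i \<le> N" by simp
    have "(1 / s) ^ N * (real (N choose i) * cmod (\<theta> - 1) ^ (N - i)) \<le> (1 / s) ^ N * (2 ^ N * (2 * pi * s) ^ (N - i))"
    proof (intro mult_left_mono mult_mono power_mono th)
      have "real (N choose i) \<le> real (2 ^ N)"
        by (simp only: of_nat_le_iff binomial_le_pow2)
      then show "real (N choose i) \<le> 2 ^ N" by simp
    qed (use s in auto)
    also have "\<dots> = 2 ^ N * (2 * pi) ^ (N - i) * (1 / s) ^ i"
    proof -
      have key: "(1 / s) ^ N * s ^ (N - i) = (1 / s) ^ i"
      proof -
        have "(1 / s) ^ N = (1 / s) ^ (N - i) * (1 / s) ^ i" using i by (simp add: power_add[symmetric])
        moreover have "(1 / s) ^ (N - i) * s ^ (N - i) = 1" using s by (simp add: power_mult_distrib[symmetric])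
        ultimately show ?thesis by (simp add: mult_ac)
      qed
      have "(1 / s) ^ N * (2 ^ N * (2 * pi * s) ^ (N - i)) = 2 ^ N * (2 * pi) ^ (N - i) * ((1 / s) ^ N * s ^ (N - i))"
        by (simp only: power_mult_distrib mult_ac)
      then show ?thesis by (simp only: key)
    qed
    also have "\<dots> \<le> 2 ^ N * (2 * pi) ^ N * (1 / s) ^ i"
      using s pi_ge_two by (intro mult_right_mono mult_left_mono power_increasing) auto
    finally have "((1 / s) ^ N * (real (N choose i) * cmod (\<theta> - 1) ^ (N - i))) * cmod (X i)
       \<le> (2 ^ N * (2 * pi) ^ N * (1 / s) ^ i) * (\<Sum>l\<le>i. 2 ^ N * cmod (Y i l))"
      by (rule mult_mono[OF _ X[OF i]]) (use s in auto)
    then have "(1 / s) ^ N * (real (N choose i) * cmod (\<theta> - 1) ^ (N - i) * cmod (X i))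
       \<le> (2 ^ N * (2 * pi) ^ N * (1 / s) ^ i) * (\<Sum>l\<le>i. 2 ^ N * cmod (Y i l))"
      by (simp only: mult.assoc)
    moreover have "(2 ^ N * (2 * pi) ^ N * (1 / s) ^ i) * (2 ^ N * y) = (8 * pi) ^ N * ((1 / s) ^ i * y)" for y
    proof -
      have "(8 * pi) ^ N = 2 ^ N * (2 * pi) ^ N * 2 ^ N"
        by (simp only: power_mult_distrib[symmetric]) simp
      then show ?thesis by (simp only: mult_ac)
    qed
    ultimately show ?thesis by (simp only: sum_distrib_left)
  qed
  show ?thesis
    by (rule order_trans[OF main[unfolded \<theta>_def] sum_mono[OF terms, unfolded \<theta>_def Y_def]])
qed

text \<open>
  The weight is traded for differences of order \<open>i\<close>, distributed over the cutoff \<open>u\<close> and the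
  symbol \<open>v\<close>, at the price \<open>(1 / s) ^ i\<close>. Since \<open>i\<close> differences gain \<open>s ^ i\<close> in the applications,
  the price is a constant.
\<close>
lemma weighted_reduction:
  fixes u v :: "int ^ 'n::finite \<Rightarrow> complex"
  assumes S: "finite S" and supp: "\<And>\<xi> j a. a \<le> 2 * M \<Longrightarrow> u (\<xi> + axis j (int a)) \<noteq> 0 \<Longrightarrow> \<xi> \<in> S"
    and s: "0 < s" and near: "\<And>j. \<bar>x $ j - c $ j\<bar> \<le> s"
    and cont: "continuous_on UNIV f" and M: "even M"
  shows "cmod (\<Sum>\<xi>\<in>S. u \<xi> * fourier_torus f \<xi> * wave \<xi> x * v \<xi>)
    \<le> cmod (\<Sum>\<xi>\<in>S. u \<xi> * fourier_torus (weighted_part (2 * M) s c f) \<xi> * wave \<xi> x * v \<xi>)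
      + (\<Sum>j\<in>UNIV. \<Sum>i\<le>2 * M. \<Sum>l\<le>i. (8 * pi) ^ (2 * M) * ((1 / s) ^ i *
          cmod (\<Sum>\<xi>\<in>S. (difference j ^^ (i - l)) u (\<xi> + axis j (int l)) * fourier_torus (modulated_part M s c f j) \<xi>
            * wave \<xi> x * (difference j ^^ l) v \<xi>)))"
proof -
  let ?a = "\<lambda>\<xi>. u \<xi> * v \<xi>"
  have uS: "\<xi> \<in> S" if "?a \<xi> \<noteq> 0" for \<xi>
    using supp[of 0 \<xi> undefined] that by (simp add: axis_int_0[simplified])
  have fin: "finite {\<xi>. ?a \<xi> \<noteq> 0}"
    by (rule finite_subset[OF _ S]) (use uS in auto)
  have op: "multiplier_op ?a g x = (\<Sum>\<xi>\<in>S. u \<xi> * fourier_torus g \<xi> * wave \<xi> x * v \<xi>)" for g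
    by (subst multiplier_op_superset[OF S uS]) (auto simp: mult_ac)
  have "cmod (multiplier_op ?a f x) \<le> cmod (multiplier_op ?a (weighted_part (2 * M) s c f) x)
     + (\<Sum>j\<in>UNIV. cmod (complex_of_real ((1 / s) ^ (2 * M)) *
        multiplier_op ((twisted_difference (wave (axis j 1) (x - c)) j ^^ (2 * M)) ?a) (modulated_part M s c f j) x))"
    unfolding multiplier_op_weighted[OF fin cont s M, of x c]
    by (rule norm_triangle_mono[OF order_refl norm_sum])
  also have "\<dots> = cmod (multiplier_op ?a (weighted_part (2 * M) s c f) x)
     + (\<Sum>j\<in>UNIV. (1 / s) ^ (2 * M) * cmod (
        multiplier_op ((twisted_difference (wave (axis j 1) (x - c)) j ^^ (2 * M)) ?a) (modulated_part M s c f j) x))"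
    using s by (simp add: norm_mult norm_power norm_divide)
  also have "\<dots> \<le> cmod (multiplier_op ?a (weighted_part (2 * M) s c f) x)
     + (\<Sum>j\<in>UNIV. \<Sum>i\<le>2 * M. \<Sum>l\<le>i. (8 * pi) ^ (2 * M) * ((1 / s) ^ i *
          cmod (\<Sum>\<xi>\<in>S. (difference j ^^ (i - l)) u (\<xi> + axis j (int l)) * fourier_torus (modulated_part M s c f j) \<xi>
            * wave \<xi> x * (difference j ^^ l) v \<xi>)))"
    by (intro add_left_mono sum_mono twisted_multiplier_bound S supp s near)
  finally show ?thesis unfolding op .
qed


section \<open>A local mean square bound\<close>

text \<open>
  The integral of the square of \<open>g\<close> minus its mean is nonnegative.
\<close>
lemma square_integral_le:
  fixes g :: "real \<Rightarrow> real"
  assumes cont: "continuous_on {a..a + s} g" and s: "0 < s"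
  shows "(integral {a..a + s} g)\<^sup>2 \<le> s * integral {a..a + s} (\<lambda>t. (g t)\<^sup>2)"
proof -
  let ?I = "{a..a + s}"
  define m where "m = integral ?I g / s"
  have int: "g integrable_on ?I" "(\<lambda>t. (g t)\<^sup>2) integrable_on ?I"
    by (auto intro!: integrable_continuous_real continuous_intros cont)
  have "0 \<le> integral ?I (\<lambda>t. (g t - m)\<^sup>2)"
    by (intro integral_nonneg integrable_continuous_real continuous_intros cont) auto
  also have "integral ?I (\<lambda>t. (g t - m)\<^sup>2) = integral ?I (\<lambda>t. ((g t)\<^sup>2 - (2 * m) * g t) + m\<^sup>2)"
    by (simp add: power2_eq_square algebra_simps)
  also have "\<dots> = integral ?I (\<lambda>t. (g t)\<^sup>2 - (2 * m) * g t) + integral ?I (\<lambda>t. m\<^sup>2)"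
    by (intro integral_add integrable_diff int integrable_on_mult_right) auto
  also have "integral ?I (\<lambda>t. (g t)\<^sup>2 - (2 * m) * g t) = integral ?I (\<lambda>t. (g t)\<^sup>2) - integral ?I (\<lambda>t. (2 * m) * g t)"
    by (intro integral_diff int integrable_on_mult_right)
  also have "integral ?I (\<lambda>t. (2 * m) * g t) = (2 * m) * integral ?I g"
    by simp
  also have "integral ?I (\<lambda>t. m\<^sup>2) = s * m\<^sup>2"
    using s by simp
  finally have "0 \<le> integral ?I (\<lambda>t. (g t)\<^sup>2) - 2 * m * integral ?I g + s * m\<^sup>2" .
  moreover have "integral ?I g = s * m" using s by (simp add: m_def)
  ultimately show ?thesis
    using s by (simp add: power2_eq_square mult_left_mono algebra_simps)
qed

text \<open>
  Compare \<open>u x\<close> with \<open>u t\<close> by the fundamental theorem of calculus, and average over \<open>t\<close>.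
\<close>
lemma sobolev_interval:
  fixes u :: "real \<Rightarrow> complex"
  assumes der: "\<And>t. (u has_vector_derivative u' t) (at t)" and cont: "continuous_on UNIV u'"
    and s: "0 < s" and x: "x \<in> {a..a + s}"
  shows "ennreal (s * (cmod (u x))\<^sup>2)
    \<le> (\<integral>\<^sup>+t\<in>{a..a + s}. ennreal (2 * (cmod (u t))\<^sup>2 + 2 * s\<^sup>2 * (cmod (u' t))\<^sup>2) \<partial>lborel)"
proof -
  let ?I = "{a..a + s}"
  have cu: "continuous_on UNIV u"
    by (intro continuous_at_imp_continuous_on ballI has_vector_derivative_continuous[OF der])
  have cI: "continuous_on A u" "continuous_on A u'" for A
    using cu cont by (auto intro: continuous_on_subset)
  define G where "G = integral ?I (\<lambda>t. cmod (u' t))"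
  define G2 where "G2 = integral ?I (\<lambda>t. (cmod (u' t))\<^sup>2)"
  have inc: "cmod (u q - u p) \<le> G" if "p \<le> q" "p \<in> ?I" "q \<in> ?I" for p q
  proof -
    have "(u' has_integral (u q - u p)) {p..q}"
      using der that by (intro fundamental_theorem_of_calculus)
        (auto intro: has_vector_derivative_at_within)
    then have "u q - u p = integral {p..q} u'" by (simp add: integral_unique)
    also have "cmod \<dots> \<le> integral {p..q} (\<lambda>t. cmod (u' t))"
      by (intro integral_norm_bound_integral integrable_continuous_real cI continuous_intros) auto
    also have "\<dots> \<le> G"
      unfolding G_def using that
      by (intro integral_subset_le integrable_continuous_real cI continuous_intros) auto
    finally show ?thesis .
  qed
  have G2: "G\<^sup>2 \<le> s * G2"
    unfolding G_def G2_def by (intro square_integral_le continuous_intros cI s)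
  have pt: "(cmod (u x))\<^sup>2 \<le> 2 * (cmod (u t))\<^sup>2 + 2 * (s * G2)" if "t \<in> ?I" for t
  proof -
    have "cmod (u x - u t) \<le> G"
      using inc[of x t] inc[of t x] x that by (cases "x \<le> t") (auto simp: norm_minus_commute)
    then have "cmod (u x) \<le> cmod (u t) + G"
      using norm_triangle_ineq2[of "u x" "u t"] by simp
    then have "(cmod (u x))\<^sup>2 \<le> (cmod (u t) + G)\<^sup>2" by (intro power_mono) auto
    also have "\<dots> \<le> 2 * (cmod (u t))\<^sup>2 + 2 * G\<^sup>2"
      using sum_squares_bound[of "cmod (u t)" G] by (simp add: power2_sum)
    finally show ?thesis using G2 by simp
  qed
  let ?R = "\<lambda>t. 2 * (cmod (u t))\<^sup>2 + 2 * s\<^sup>2 * (cmod (u' t))\<^sup>2"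
  have "s * (cmod (u x))\<^sup>2 = integral ?I (\<lambda>t. (cmod (u x))\<^sup>2)"
    using s by simp
  also have "\<dots> \<le> integral ?I (\<lambda>t. 2 * (cmod (u t))\<^sup>2 + 2 * (s * G2))"
    by (intro integral_le integrable_continuous_real cI continuous_intros pt)
  also have "\<dots> = integral ?I (\<lambda>t. 2 * (cmod (u t))\<^sup>2) + integral ?I (\<lambda>t. 2 * (s * G2))"
    by (intro integral_add integrable_continuous_real cI continuous_intros)
  also have "integral ?I (\<lambda>t. 2 * (s * G2)) = integral ?I (\<lambda>t. 2 * s\<^sup>2 * (cmod (u' t))\<^sup>2)"
    using s by (simp add: G2_def power2_eq_square)
  also have "integral ?I (\<lambda>t. 2 * (cmod (u t))\<^sup>2) + integral ?I (\<lambda>t. 2 * s\<^sup>2 * (cmod (u' t))\<^sup>2) = integral ?I ?R"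
    by (intro integral_add[symmetric] integrable_continuous_real cI continuous_intros)
  also have "\<dots> = (LINT t:?I|lborel. ?R t)"
    by (intro set_borel_integral_eq_integral(2)[symmetric] borel_integrable_atLeastAtMost' cI continuous_intros)
  finally have "ennreal (s * (cmod (u x))\<^sup>2) \<le> ennreal (LINT t:?I|lborel. ?R t)"
    by (rule ennreal_leI)
  also have "\<dots> = (\<integral>\<^sup>+t. ennreal (indicator ?I t *\<^sub>R ?R t) \<partial>lborel)"
    unfolding set_lebesgue_integral_def
  proof (intro nn_integral_eq_integral[symmetric])
    have "set_integrable lborel ?I ?R"
      by (intro borel_integrable_atLeastAtMost' cI continuous_intros)
    then show "integrable lborel (\<lambda>t. indicator ?I t *\<^sub>R ?R t)"
      by (simp only: set_integrable_def)
  qed auto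
  also have "\<dots> = (\<integral>\<^sup>+t\<in>?I. ennreal (?R t) \<partial>lborel)"
    by (intro nn_integral_cong) (auto simp: indicator_def)
  finally show ?thesis .
qed

lemma partial_has_vector_derivative:
  fixes g :: "real ^ 'n::finite \<Rightarrow> complex"
  assumes "g differentiable_on UNIV"
  shows "((\<lambda>t. g (y + t *\<^sub>R axis j 1)) has_vector_derivative partial j g (y + t *\<^sub>R axis j 1)) (at t)"
proof -
  let ?y = "y + t *\<^sub>R axis j 1"
  have "g differentiable (at ?y)" using assms by (simp add: differentiable_on_def)
  then have d0: "(\<lambda>h. g (?y + h *\<^sub>R axis j 1)) differentiable (at 0)"
    by (intro differentiable_compose[of g "\<lambda>h. ?y + h *\<^sub>R axis j 1", unfolded o_def]) (auto intro!: derivative_intros)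
  then have "((\<lambda>h. g (?y + h *\<^sub>R axis j 1)) has_vector_derivative partial j g ?y) (at 0)"
    unfolding partial_def by (simp add: vector_derivative_works)
  moreover have "((\<lambda>t'. t' - t) has_vector_derivative 1) (at t)"
    by (auto intro!: derivative_eq_intros)
  ultimately have "((\<lambda>h. g (?y + h *\<^sub>R axis j 1)) \<circ> (\<lambda>t'. t' - t) has_vector_derivative 1 *\<^sub>R partial j g ?y) (at t)"
    by (intro vector_diff_chain_at) auto
  then show ?thesis by (simp add: o_def algebra_simps)
qed

lemma smooth_foldr_differentiable: "smooth f \<Longrightarrow> foldr partial js f differentiable_on UNIV"
  by (simp add: smooth_def)

lemma smooth_foldr_continuous: "smooth f \<Longrightarrow> continuous_on UNIV (foldr partial js f)"
  by (intro differentiable_imp_continuous_on smooth_foldr_differentiable)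

lemma smooth_continuous: "smooth f \<Longrightarrow> continuous_on UNIV f"
  using smooth_foldr_continuous[of f "[]"] by simp

definition freeze :: "'n set \<Rightarrow> real ^ 'n \<Rightarrow> real ^ 'n \<Rightarrow> real ^ 'n::finite" where
  "freeze I z x = (\<chi> i. if i \<in> I then z $ i else x $ i)"

lemma nn_integral_wave_sum_cube:
  fixes b :: "real ^ 'n::finite"
  assumes "finite S"
  shows "(\<integral>\<^sup>+x\<in>cbox b (b + One). ennreal ((cmod (\<Sum>\<xi>\<in>S. d \<xi> * wave \<xi> x))\<^sup>2) \<partial>lborel)
    = ennreal (\<Sum>\<xi>\<in>S. (cmod (d \<xi>))\<^sup>2)"
proof -
  let ?g = "\<lambda>x. ennreal ((cmod (\<Sum>\<xi>\<in>S. d \<xi> * wave \<xi> x))\<^sup>2)"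
  have "(\<integral>\<^sup>+x\<in>cbox b (b + One). ?g x \<partial>lborel) = (\<integral>\<^sup>+x\<in>cbox 0 (0 + One). ?g x \<partial>lborel)"
  proof (rule nn_integral_periodic_cube)
    fix x :: "real ^ 'n" and k :: "int ^ 'n"
    show "?g (x + real_vec k) = ?g x" by (simp add: wave_add_point)
  qed measurable
  also have "\<dots> = ennreal (LINT x:unit_cube|lborel. (cmod (\<Sum>\<xi>\<in>S. d \<xi> * wave \<xi> x))\<^sup>2)"
    unfolding add_0 by (rule nn_integral_cube_eq) (auto intro!: continuous_intros)
  finally show ?thesis by (simp only: parseval_finite[OF assms])
qed

lemma lborel_Fubini:
  fixes f :: "'a::euclidean_space \<Rightarrow> 'b::euclidean_space \<Rightarrow> ennreal"
  assumes "case_prod f \<in> borel_measurable borel"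
  shows "(\<integral>\<^sup>+y. (\<integral>\<^sup>+x. f x y \<partial>lborel) \<partial>lborel) = (\<integral>\<^sup>+x. (\<integral>\<^sup>+y. f x y \<partial>lborel) \<partial>lborel)"
  by (rule pair_sigma_finite.Fubini')
     (use assms in \<open>auto simp: pair_sigma_finite_def lborel.sigma_finite_measure_axioms lborel_prod\<close>)

text \<open>
  The point at which the symbol is evaluated is decoupled from the point of evaluation of the
  waves, one coordinate at a time, by the Sobolev inequality on an interval of length \<open>s\<close>. Once
  all coordinates are decoupled, the waves are orthonormal. The last coordinate of the list is
  treated first, so that the derivatives are applied in the order of \<open>coord_list\<close>, as in the
  symbol class.
\<close>
lemma local_L2_bound_frozen:
  fixes \<tau> :: "int ^ 'n::finite \<Rightarrow> real ^ 'n \<Rightarrow> complex" and b :: "real ^ 'n"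
  assumes smooth: "\<And>\<xi>. smooth (\<tau> \<xi>)" and S: "finite S" and s: "0 < s" "s \<le> 1" and A: "0 \<le> A"
    and bound: "\<And>J \<xi> x. \<xi> \<in> S \<Longrightarrow>
      cmod (foldr partial (filter (\<lambda>i. i \<in> J) coord_list) (\<tau> \<xi>) x) \<le> A / s ^ card J"
    and split: "coord_list = pre @ post" and J: "J \<subseteq> set post"
  shows "(\<integral>\<^sup>+x\<in>cube b s. ennreal ((cmod (\<Sum>\<xi>\<in>S. d \<xi> * wave \<xi> x *
       foldr partial (filter (\<lambda>i. i \<in> J) post) (\<tau> \<xi>) (freeze (set post) z x)))\<^sup>2) \<partial>lborel)
    \<le> ennreal (4 ^ length pre * A\<^sup>2 * (\<Sum>\<xi>\<in>S. (cmod (d \<xi>))\<^sup>2) / s ^ (2 * card J))"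
  using split J
proof (induction pre arbitrary: post J z rule: rev_induct)
  case Nil
  then have post: "coord_list = post" by simp
  have "set post = UNIV" using coord_list(2) post by metis
  then have freeze: "freeze (set post) z x = z" for x
    by (simp add: freeze_def vec_eq_iff)
  let ?c = "\<lambda>\<xi>. d \<xi> * foldr partial (filter (\<lambda>i. i \<in> J) post) (\<tau> \<xi>) z"
  have "(\<integral>\<^sup>+x\<in>cube b s. ennreal ((cmod (\<Sum>\<xi>\<in>S. d \<xi> * wave \<xi> x *
       foldr partial (filter (\<lambda>i. i \<in> J) post) (\<tau> \<xi>) (freeze (set post) z x)))\<^sup>2) \<partial>lborel)
     \<le> (\<integral>\<^sup>+x\<in>cbox b (b + One). ennreal ((cmod (\<Sum>\<xi>\<in>S. ?c \<xi> * wave \<xi> x))\<^sup>2) \<partial>lborel)"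
  proof (rule nn_integral_mono)
    fix x
    have "cube b s \<subseteq> cbox b (b + One)"
      using s by (intro subset_box_imp) (auto simp: inner_add_left)
    then show "ennreal ((cmod (\<Sum>\<xi>\<in>S. d \<xi> * wave \<xi> x *
       foldr partial (filter (\<lambda>i. i \<in> J) post) (\<tau> \<xi>) (freeze (set post) z x)))\<^sup>2) * indicator (cube b s) x
       \<le> ennreal ((cmod (\<Sum>\<xi>\<in>S. ?c \<xi> * wave \<xi> x))\<^sup>2) * indicator (cbox b (b + One)) x"
      by (auto simp: freeze indicator_def mult_ac)
  qed
  also have "\<dots> = ennreal (\<Sum>\<xi>\<in>S. (cmod (?c \<xi>))\<^sup>2)"
    by (rule nn_integral_wave_sum_cube[OF S])
  also have "\<dots> \<le> ennreal (4 ^ length [] * A\<^sup>2 * (\<Sum>\<xi>\<in>S. (cmod (d \<xi>))\<^sup>2) / s ^ (2 * card J))"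
  proof (rule ennreal_leI)
    have "(\<Sum>\<xi>\<in>S. (cmod (?c \<xi>))\<^sup>2) \<le> (\<Sum>\<xi>\<in>S. (cmod (d \<xi>))\<^sup>2 * (A / s ^ card J)\<^sup>2)"
      using bound unfolding norm_mult power_mult_distrib post
      by (intro sum_mono mult_left_mono power_mono) auto
    also have "\<dots> = 4 ^ length [] * A\<^sup>2 * (\<Sum>\<xi>\<in>S. (cmod (d \<xi>))\<^sup>2) / s ^ (2 * card J)"
      by (simp add: power_divide sum_distrib_left sum_divide_distrib power_mult[symmetric] mult_ac)
    finally show "(\<Sum>\<xi>\<in>S. (cmod (?c \<xi>))\<^sup>2) \<le> 4 ^ length [] * A\<^sup>2 * (\<Sum>\<xi>\<in>S. (cmod (d \<xi>))\<^sup>2) / s ^ (2 * card J)" .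
  qed
  finally show ?case .
next
  case (snoc j pre)
  let ?B = "cube b s" and ?I = "{b $ j..b $ j + s}"
  define D where "D = 4 ^ length pre * A\<^sup>2 * (\<Sum>\<xi>\<in>S. (cmod (d \<xi>))\<^sup>2)"
  have D: "0 \<le> D" by (simp add: D_def sum_nonneg)
  define g where "g \<xi> = foldr partial (filter (\<lambda>i. i \<in> J) post) (\<tau> \<xi>)" for \<xi>
  \<comment> \<open>The frozen point, with its coordinate \<open>j\<close> varying.\<close>
  define zz where "zz t = (\<chi> i. if i = j then t else z $ i)" for t :: real
  define P where "P x t = freeze (set (j # post)) (zz t) x" for x t
  define u where "u x t = (\<Sum>\<xi>\<in>S. d \<xi> * wave \<xi> x * g \<xi> (P x t))" for x t
  define u' where "u' x t = (\<Sum>\<xi>\<in>S. d \<xi> * wave \<xi> x * partial j (g \<xi>) (P x t))" for x t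
  have split: "coord_list = pre @ (j # post)" using snoc.prems by simp
  have "distinct (pre @ (j # post))" using coord_list(1) split by metis
  then have j: "j \<notin> set post" "j \<notin> J" using snoc.prems(2) by auto
  have gd: "g \<xi> differentiable_on UNIV" and gd': "partial j (g \<xi>) differentiable_on UNIV" for \<xi>
    using smooth_foldr_differentiable[OF smooth, of "filter (\<lambda>i. i \<in> J) post" \<xi>]
      smooth_foldr_differentiable[OF smooth, of "j # filter (\<lambda>i. i \<in> J) post" \<xi>]
    by (simp_all add: g_def)
  have gc: "continuous_on A (g \<xi>)" and gc': "continuous_on A (partial j (g \<xi>))" for \<xi> A
    by (rule continuous_on_subset[OF differentiable_imp_continuous_on[OF gd] subset_UNIV])
       (rule continuous_on_subset[OF differentiable_imp_continuous_on[OF gd'] subset_UNIV])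
  have Pc: "continuous_on A (\<lambda>p. P (f p) (h p))" if "continuous_on A f" "continuous_on A h" for f h and A :: "'z::topological_space set"
  proof -
    have "continuous_on A (\<lambda>p. if i \<in> set (j # post) then (if i = j then h p else z $ i) else f p $ i)" for i
      by (cases "i \<in> set (j # post)"; cases "i = j") (auto intro!: continuous_intros that)
    then show ?thesis
      unfolding P_def freeze_def zz_def by (intro continuous_on_vec_lambda) (simp cong: if_cong)
  qed
  have uc: "continuous_on A (\<lambda>p. u (f p) (h p))" "continuous_on A (\<lambda>p. u' (f p) (h p))"
    if "continuous_on A f" "continuous_on A h" for f h and A :: "'z::topological_space set"
  proof -
    have gg: "continuous_on A (\<lambda>p. g \<xi> (P (f p) (h p)))" "continuous_on A (\<lambda>p. partial j (g \<xi>) (P (f p) (h p)))" for \<xi>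
      by (rule continuous_on_compose2[OF gc[of UNIV] Pc[OF that]] continuous_on_compose2[OF gc'[of UNIV] Pc[OF that]]; simp)+
    show "continuous_on A (\<lambda>p. u (f p) (h p))" "continuous_on A (\<lambda>p. u' (f p) (h p))"
      unfolding u_def u'_def by (intro continuous_intros that gg)+
  qed
  have Pline: "P x t = P x 0 + t *\<^sub>R axis j 1" for x t
    by (auto simp: P_def freeze_def zz_def vec_eq_iff axis_def)
  have der: "(u x has_vector_derivative u' x t) (at t)" for x t
  proof -
    define y where "y = P x 0"
    have "P x t = y + t *\<^sub>R axis j 1" for t unfolding y_def by (rule Pline)
    then show ?thesis
      unfolding u_def[abs_def] u'_def
      by (simp only:) (intro has_vector_derivative_sum has_vector_derivative_mult_right partial_has_vector_derivative gd)
  qed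
  \<comment> \<open>At \<open>t = x $ j\<close> the coordinate \<open>j\<close> is coupled again.\<close>
  have at_point: "u x (x $ j) = (\<Sum>\<xi>\<in>S. d \<xi> * wave \<xi> x * g \<xi> (freeze (set post) z x))" for x
  proof -
    have "P x (x $ j) = freeze (set post) z x"
      using j by (auto simp: P_def freeze_def zz_def vec_eq_iff)
    then show ?thesis by (simp add: u_def)
  qed
  let ?K = "\<lambda>x t. ennreal (2 * (cmod (u x t))\<^sup>2 + 2 * s\<^sup>2 * (cmod (u' x t))\<^sup>2)"
  have inner: "(\<integral>\<^sup>+x\<in>?B. ?K x t \<partial>lborel) \<le> ennreal (4 * D / s ^ (2 * card J))" for t
  proof -
    have "(\<integral>\<^sup>+x\<in>?B. ennreal ((cmod (u x t))\<^sup>2) \<partial>lborel) \<le> ennreal (D / s ^ (2 * card J))"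
      using snoc.IH[OF split, of J "zz t"] snoc.prems(2) j
      by (auto simp: u_def P_def g_def D_def)
    moreover have "(\<integral>\<^sup>+x\<in>?B. ennreal ((cmod (u' x t))\<^sup>2) \<partial>lborel) \<le> ennreal (D / s ^ (2 * card J + 2))"
    proof -
      have "filter (\<lambda>i. i \<in> insert j J) (j # post) = j # filter (\<lambda>i. i \<in> J) post"
        using j by (auto intro!: filter_cong)
      moreover have "card (insert j J) = Suc (card J)"
        using j snoc.prems(2) by (simp add: finite_subset)
      ultimately show ?thesis
        using snoc.IH[OF split, of "insert j J" "zz t"] snoc.prems(2)
        by (auto simp: u'_def P_def g_def D_def)
    qed
    moreover have comb: "2 * ennreal p + ennreal q * ennreal r = ennreal (2 * p + q * r)"
      if "0 \<le> p" "0 \<le> q" "0 \<le> r" for p q r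
      using that by (simp add: ennreal_mult ennreal_plus)
    ultimately have "2 * (\<integral>\<^sup>+x\<in>?B. ennreal ((cmod (u x t))\<^sup>2) \<partial>lborel)
        + ennreal (2 * s\<^sup>2) * (\<integral>\<^sup>+x\<in>?B. ennreal ((cmod (u' x t))\<^sup>2) \<partial>lborel)
        \<le> 2 * ennreal (D / s ^ (2 * card J)) + ennreal (2 * s\<^sup>2) * ennreal (D / s ^ (2 * card J + 2))"
      by (intro add_mono mult_left_mono) auto
    also have "\<dots> = ennreal (2 * (D / s ^ (2 * card J)) + 2 * s\<^sup>2 * (D / s ^ (2 * card J + 2)))"
      by (rule comb) (use D s in auto)
    also have "2 * (D / s ^ (2 * card J)) + 2 * s\<^sup>2 * (D / s ^ (2 * card J + 2)) = 4 * D / s ^ (2 * card J)"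
      using s by (simp add: field_simps power2_eq_square)
    also have "2 * (\<integral>\<^sup>+x\<in>?B. ennreal ((cmod (u x t))\<^sup>2) \<partial>lborel)
        + ennreal (2 * s\<^sup>2) * (\<integral>\<^sup>+x\<in>?B. ennreal ((cmod (u' x t))\<^sup>2) \<partial>lborel) = (\<integral>\<^sup>+x\<in>?B. ?K x t \<partial>lborel)"
    proof -
      have [measurable]: "(\<lambda>x. u x t) \<in> borel_measurable borel" "(\<lambda>x. u' x t) \<in> borel_measurable borel"
        by (intro continuous_borel_measurable uc continuous_intros)+
      have "(\<integral>\<^sup>+x\<in>?B. ?K x t \<partial>lborel) = (\<integral>\<^sup>+x. 2 * (ennreal ((cmod (u x t))\<^sup>2) * indicator ?B x)
           + ennreal (2 * s\<^sup>2) * (ennreal ((cmod (u' x t))\<^sup>2) * indicator ?B x) \<partial>lborel)"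
        using s by (intro nn_integral_cong) (auto simp: indicator_def ennreal_mult ennreal_plus)
      also have "\<dots> = 2 * (\<integral>\<^sup>+x\<in>?B. ennreal ((cmod (u x t))\<^sup>2) \<partial>lborel)
        + ennreal (2 * s\<^sup>2) * (\<integral>\<^sup>+x\<in>?B. ennreal ((cmod (u' x t))\<^sup>2) \<partial>lborel)"
        by (subst nn_integral_add) (auto simp: nn_integral_cmult)
      finally show ?thesis by simp
    qed
    finally show ?thesis .
  qed
  have meas: "(\<lambda>(x, t). ?K x t * indicator ?I t * indicator ?B x) \<in> borel_measurable borel"
  proof -
    have [measurable]: "(\<lambda>p. u (fst p) (snd p)) \<in> borel_measurable (borel :: ((real ^ 'n) \<times> real) measure)"
      "(\<lambda>p. u' (fst p) (snd p)) \<in> borel_measurable (borel :: ((real ^ 'n) \<times> real) measure)"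
      by (intro continuous_borel_measurable uc continuous_intros)+
    have [measurable]: "(\<lambda>p. indicator ?I (snd p) :: ennreal) \<in> borel_measurable (borel :: ((real ^ 'n) \<times> real) measure)"
      "(\<lambda>p. indicator ?B (fst p) :: ennreal) \<in> borel_measurable (borel :: ((real ^ 'n) \<times> real) measure)"
      by (auto simp flip: borel_prod intro!: measurable_compose[OF measurable_snd] measurable_compose[OF measurable_fst])
    show ?thesis unfolding split_beta by measurable
  qed
  have um: "(\<lambda>x. u x (x $ j)) \<in> borel_measurable borel"
    by (intro continuous_borel_measurable uc continuous_intros)
  have "ennreal s * (\<integral>\<^sup>+x\<in>?B. ennreal ((cmod (u x (x $ j)))\<^sup>2) \<partial>lborel)
     = (\<integral>\<^sup>+x. ennreal s * (ennreal ((cmod (u x (x $ j)))\<^sup>2) * indicator ?B x) \<partial>lborel)"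
  proof (intro nn_integral_cmult[symmetric])
    have [measurable]: "?B \<in> sets borel" by simp
    show "(\<lambda>x. ennreal ((cmod (u x (x $ j)))\<^sup>2) * indicator ?B x) \<in> borel_measurable lborel"
      using um by simp
  qed
  also have "\<dots> \<le> (\<integral>\<^sup>+x. (\<integral>\<^sup>+t. ?K x t * indicator ?I t * indicator ?B x \<partial>lborel) \<partial>lborel)"
  proof (rule nn_integral_mono)
    fix x
    have cu': "continuous_on UNIV (u' x)"
      using uc(2)[of UNIV "\<lambda>_. x" "\<lambda>t. t"] by (simp add: continuous_on_const continuous_on_id)
    show "ennreal s * (ennreal ((cmod (u x (x $ j)))\<^sup>2) * indicator ?B x)
       \<le> (\<integral>\<^sup>+t. ?K x t * indicator ?I t * indicator ?B x \<partial>lborel)"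
    proof (cases "x \<in> ?B")
      case True
      then have "x $ j \<in> ?I" by (auto simp: mem_box_cart)
      from sobolev_interval[OF der cu' s(1) this] show ?thesis
        using True s by (simp add: ennreal_mult)
    qed simp
  qed
  also have "\<dots> = (\<integral>\<^sup>+t. (\<integral>\<^sup>+x. ?K x t * indicator ?I t * indicator ?B x \<partial>lborel) \<partial>lborel)"
    by (rule lborel_Fubini[symmetric, OF meas])
  also have "\<dots> \<le> (\<integral>\<^sup>+t. ennreal (4 * D / s ^ (2 * card J)) * indicator ?I t \<partial>lborel)"
  proof (rule nn_integral_mono)
    fix t
    show "(\<integral>\<^sup>+x. ?K x t * indicator ?I t * indicator ?B x \<partial>lborel) \<le> ennreal (4 * D / s ^ (2 * card J)) * indicator ?I t"
      using inner[of t] by (cases "t \<in> ?I") (auto)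
  qed
  also have "\<dots> = ennreal s * ennreal (4 * D / s ^ (2 * card J))"
    using s by (subst nn_integral_cmult_indicator) (simp_all add: mult.commute)
  finally have "(\<integral>\<^sup>+x\<in>?B. ennreal ((cmod (u x (x $ j)))\<^sup>2) \<partial>lborel) \<le> ennreal (4 * D / s ^ (2 * card J))"
    using s by (simp add: ennreal_mult_le_mult_iff)
  then show ?case
    by (simp add: at_point g_def D_def mult_ac)
qed

lemma local_L2_bound:
  fixes \<tau> :: "int ^ 'n::finite \<Rightarrow> real ^ 'n \<Rightarrow> complex" and b :: "real ^ 'n"
  assumes "\<And>\<xi>. smooth (\<tau> \<xi>)" "finite S" "0 < s" "s \<le> 1" "0 \<le> A"
    and "\<And>J \<xi> x. \<xi> \<in> S \<Longrightarrow>
      cmod (foldr partial (filter (\<lambda>i. i \<in> J) coord_list) (\<tau> \<xi>) x) \<le> A / s ^ card J"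
  shows "(\<integral>\<^sup>+x\<in>cube b s. ennreal ((cmod (\<Sum>\<xi>\<in>S. d \<xi> * wave \<xi> x * \<tau> \<xi> x))\<^sup>2) \<partial>lborel)
    \<le> ennreal (4 ^ CARD('n) * A\<^sup>2 * (\<Sum>\<xi>\<in>S. (cmod (d \<xi>))\<^sup>2))"
proof -
  have "length (coord_list :: 'n list) = CARD('n)"
    using coord_list distinct_card by metis
  moreover have "freeze {} z x = x" for z x :: "real ^ 'n"
    by (simp add: freeze_def vec_eq_iff)
  ultimately show ?thesis
    using local_L2_bound_frozen[where pre = coord_list and post = "[]" and J = "{}", OF assms] by simp
qed


section \<open>Averages of the weighted mass\<close>

text \<open>
  Write \<open>sin y = 2 sin (y / 2) cos (y / 2)\<close>. On \<open>[0, pi / 4]\<close> the cosine is at least \<open>sqrt 2 /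
  2\<close>, which bounds the second factor, and by the mean value theorem also the first one.
\<close>
lemma half_le_sin:
  assumes "0 \<le> y" "y \<le> pi / 2"
  shows "y / 2 \<le> sin y"
proof (cases "y = 0")
  case False
  define w where "w = y / 2"
  have w: "0 < w" "w \<le> pi / 4" using assms False by (auto simp: w_def)
  obtain z where z: "0 < z" "z < w" "sin w - sin 0 = (w - 0) * cos z"
    using MVT2[OF w(1), of sin cos] by auto
  have cz: "sqrt 2 / 2 \<le> cos z"
    using cos_monotone_0_pi_le[of z "pi / 4"] z w by (simp add: cos_45)
  have cw: "sqrt 2 / 2 \<le> cos w"
    using cos_monotone_0_pi_le[of w "pi / 4"] w by (simp add: cos_45)
  have "w = w * ((sqrt 2 * sqrt 2) / 2)" by simp
  also have "\<dots> = 2 * (w * (sqrt 2 / 2)) * (sqrt 2 / 2)" by (simp add: field_simps)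
  also have "\<dots> \<le> 2 * (w * cos z) * cos w"
    using w cz cw by (intro mult_mono mult_left_mono) (auto intro!: mult_nonneg_nonneg order_trans[OF _ cz])
  also have "\<dots> = sin y"
    using z sin_double[of w] by (simp add: w_def)
  finally show ?thesis by (simp add: w_def)
qed simp

lemma abs_le_cmod_wave_axis:
  assumes "\<bar>y $ j\<bar> \<le> 1 / 2"
  shows "\<bar>y $ j\<bar> \<le> cmod (wave (axis j 1) y - 1)"
proof -
  have "pi * \<bar>y $ j\<bar> / 2 \<le> sin (pi * \<bar>y $ j\<bar>)"
    using assms by (intro half_le_sin) auto
  also have "\<dots> \<le> \<bar>sin (pi * y $ j)\<bar>" by (cases "0 \<le> y $ j") auto
  finally have "pi * \<bar>y $ j\<bar> \<le> cmod (wave (axis j 1) y - 1)"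
    by (simp add: cmod_wave_axis_minus_1)
  moreover have "1 * \<bar>y $ j\<bar> \<le> pi * \<bar>y $ j\<bar>"
    using pi_ge_two by (intro mult_right_mono) auto
  ultimately show ?thesis by simp
qed

text \<open>
  This is the reason for the power \<open>4 * n\<close> in the weight: one factor allows for the growth of
  cubes, and the other one leaves an integrable kernel.
\<close>
lemma polynomial_growth:
  fixes X :: real
  assumes "0 \<le> X"
  shows "(1 + 2 * X) ^ n * (1 + X\<^sup>2) ^ n \<le> 16 ^ n * (1 + X ^ (4 * n))"
proof -
  define Z where "Z = max 1 X"
  have Z: "1 \<le> Z" "X \<le> Z" by (auto simp: Z_def)
  have "1 + X\<^sup>2 \<le> 4 * Z\<^sup>2"
  proof -
    have "X\<^sup>2 \<le> Z\<^sup>2" "1\<^sup>2 \<le> Z\<^sup>2" using Z assms by (auto intro!: power_mono)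
    then show ?thesis by simp
  qed
  then have "(1 + 2 * X) * (1 + X\<^sup>2) \<le> (4 * Z) * (4 * Z\<^sup>2)"
    using Z assms by (intro mult_mono) auto
  also have "\<dots> = 16 * Z ^ 3" by (simp add: power2_eq_square power3_eq_cube)
  finally have "((1 + 2 * X) * (1 + X\<^sup>2)) ^ n \<le> (16 * Z ^ 3) ^ n"
    using assms by (intro power_mono) auto
  also have "\<dots> = 16 ^ n * Z ^ (3 * n)" by (simp add: power_mult_distrib power_mult)
  also have "\<dots> \<le> 16 ^ n * Z ^ (4 * n)"
    using Z by (intro mult_left_mono power_increasing) auto
  also have "\<dots> \<le> 16 ^ n * (1 + X ^ (4 * n))"
    using assms by (intro mult_left_mono) (auto simp: Z_def max_def)
  finally show ?thesis by (simp add: power_mult_distrib)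
qed

definition max_abs :: "real ^ 'n \<Rightarrow> real" where
  "max_abs v = Max (range (\<lambda>j. \<bar>v $ j\<bar>))"

lemma abs_le_max_abs: "\<bar>v $ j\<bar> \<le> max_abs (v :: real ^ 'n::finite)"
  unfolding max_abs_def by (rule Max_ge) auto

lemma max_abs_attained: obtains j where "max_abs (v :: real ^ 'n::finite) = \<bar>v $ j\<bar>"
proof -
  have "max_abs v \<in> range (\<lambda>j. \<bar>v $ j\<bar>)"
    unfolding max_abs_def by (rule Max_in) auto
  then show ?thesis using that by auto
qed

lemma max_abs_nonneg: "0 \<le> max_abs (v :: real ^ 'n::finite)"
  using max_abs_attained[of v] by (metis abs_ge_zero)

lemma weight_dominates:
  fixes v :: "real ^ 'n::finite"
  assumes s: "0 < s" and v: "\<And>j. \<bar>v $ j\<bar> \<le> 1 / 2"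
  shows "(1 + 2 * (max_abs v / s)) ^ CARD('n) * (\<Prod>j\<in>UNIV. 1 + (v $ j / s)\<^sup>2)
    \<le> 16 ^ CARD('n) * weight (4 * CARD('n)) s 0 v"
proof -
  let ?n = "CARD('n)" and ?X = "max_abs v / s"
  have X: "0 \<le> ?X" using s max_abs_nonneg[of v] by simp
  have "(\<Prod>j\<in>UNIV. 1 + (v $ j / s)\<^sup>2) \<le> (\<Prod>j\<in>(UNIV :: 'n set). 1 + ?X\<^sup>2)"
  proof (rule prod_mono)
    fix j
    have "\<bar>v $ j / s\<bar> \<le> ?X" using abs_le_max_abs[of v j] s by (simp add: divide_right_mono)
    then have "(v $ j / s)\<^sup>2 \<le> ?X\<^sup>2" by (metis abs_ge_zero power2_abs power_mono)
    then show "0 \<le> 1 + (v $ j / s)\<^sup>2 \<and> 1 + (v $ j / s)\<^sup>2 \<le> 1 + ?X\<^sup>2"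
      by simp
  qed
  then have "(1 + 2 * ?X) ^ ?n * (\<Prod>j\<in>UNIV. 1 + (v $ j / s)\<^sup>2) \<le> (1 + 2 * ?X) ^ ?n * (1 + ?X\<^sup>2) ^ ?n"
    using X by (intro mult_left_mono) auto
  also have "\<dots> \<le> 16 ^ ?n * (1 + ?X ^ (4 * ?n))"
    by (rule polynomial_growth[OF X])
  also have "\<dots> \<le> 16 ^ ?n * weight (4 * ?n) s 0 v"
  proof (intro mult_left_mono)
    obtain j where j: "max_abs v = \<bar>v $ j\<bar>" by (rule max_abs_attained)
    have "?X ^ (4 * ?n) \<le> (cmod (wave (axis j 1) (v - 0) - 1) / s) ^ (4 * ?n)"
      using abs_le_cmod_wave_axis[OF v, of j] s unfolding j
      by (intro power_mono divide_right_mono) auto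
    also have "\<dots> \<le> (\<Sum>j\<in>UNIV. (cmod (wave (axis j 1) (v - 0) - 1) / s) ^ (4 * ?n))"
      using s by (intro member_le_sum) auto
    finally show "1 + ?X ^ (4 * ?n) \<le> weight (4 * ?n) s 0 v"
      by (simp add: weight_def)
  qed auto
  finally show ?thesis .
qed

lemma prod_Basis_vec:
  fixes v :: "real ^ 'n::finite"
  shows "(\<Prod>b\<in>Basis. g (v \<bullet> b)) = (\<Prod>j\<in>UNIV. g (v $ j))"
proof -
  have "bij_betw (\<lambda>j. axis j 1 :: real ^ 'n) UNIV Basis"
    by (auto simp: bij_betw_def inj_on_def axis_eq_axis Basis_vec_def)
  then have "(\<Prod>j\<in>UNIV. g (v \<bullet> axis j 1)) = (\<Prod>b\<in>Basis. g (v \<bullet> b))"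
    by (rule prod.reindex_bij_betw)
  then show ?thesis by (simp add: inner_axis)
qed

lemma nn_integral_cauchy_kernel:
  assumes s: "0 < s"
  shows "(\<integral>\<^sup>+t. ennreal (1 / (1 + (t / s)\<^sup>2)) * indicator {-1/2..1/2} t \<partial>lborel) \<le> ennreal (pi * s)"
proof -
  have "(\<integral>\<^sup>+t. ennreal (1 / (1 + (t / s)\<^sup>2)) * indicator {-1/2..1/2} t \<partial>lborel)
      = ennreal (s * arctan (1 / 2 / s) - s * arctan ((-1 / 2) / s))"
  proof (rule nn_integral_FTC_Icc)
    fix t :: real
    show "DERIV (\<lambda>t. s * arctan (t / s)) t :> 1 / (1 + (t / s)\<^sup>2)"
      using s by (auto intro!: derivative_eq_intros simp: inverse_eq_divide)
  qed auto
  also have "\<dots> \<le> ennreal (pi * s)"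
  proof (rule ennreal_leI)
    have "arctan (1 / 2 / s) \<le> pi / 2" using arctan_ubound[of "1 / 2 / s"] by simp
    moreover have "- (pi / 2) \<le> arctan ((-1 / 2) / s)" by (rule less_imp_le) (use arctan_lbound in auto)
    ultimately have "s * (arctan (1 / 2 / s) - arctan ((-1 / 2) / s)) \<le> s * pi"
      using s by (intro mult_left_mono) auto
    then show "s * arctan (1 / 2 / s) - s * arctan ((-1 / 2) / s) \<le> pi * s"
      by (simp add: algebra_simps)
  qed
  finally show ?thesis .
qed

abbreviation centred_cube :: "(real ^ 'n::finite) set" where
  "centred_cube \<equiv> cbox (- ((1/2) *\<^sub>R One)) ((1/2) *\<^sub>R One)"

lemma nn_integral_product_kernel:
  assumes s: "0 < s"
  shows "(\<integral>\<^sup>+v\<in>(centred_cube :: (real ^ 'n::finite) set). ennreal (1 / (\<Prod>j\<in>UNIV. 1 + (v $ j / s)\<^sup>2)) \<partial>lborel)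
    \<le> ennreal ((pi * s) ^ CARD('n))"
proof -
  let ?f = "\<lambda>t. ennreal (1 / (1 + (t / s)\<^sup>2)) * indicator {-1/2..1/2} t"
  have "(\<integral>\<^sup>+v\<in>(centred_cube :: (real ^ 'n) set). ennreal (1 / (\<Prod>j\<in>UNIV. 1 + (v $ j / s)\<^sup>2)) \<partial>lborel)
      = (\<integral>\<^sup>+v. (\<Prod>b\<in>Basis. ?f (v \<bullet> b)) \<partial>(lborel :: (real ^ 'n) measure))"
  proof (rule nn_integral_cong)
    fix v :: "real ^ 'n"
    have "(\<Prod>j\<in>UNIV. ?f (v $ j)) = (\<Prod>j\<in>UNIV. ennreal (1 / (1 + (v $ j / s)\<^sup>2))) * (\<Prod>j\<in>UNIV. indicator {-1/2..1/2} (v $ j))"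
      by (rule prod.distrib)
    also have "(\<Prod>j\<in>UNIV. ennreal (1 / (1 + (v $ j / s)\<^sup>2))) = ennreal (1 / (\<Prod>j\<in>UNIV. 1 + (v $ j / s)\<^sup>2))"
      by (subst prod_ennreal) (auto simp: prod_dividef)
    also have "(\<Prod>j\<in>UNIV. indicator {-1/2..1/2} (v $ j)) = (indicator centred_cube v :: ennreal)"
      by (auto simp: indicator_def mem_box_cart prod_eq_1_iff not_le)
    finally show "ennreal (1 / (\<Prod>j\<in>UNIV. 1 + (v $ j / s)\<^sup>2)) * indicator centred_cube v = (\<Prod>b\<in>Basis. ?f (v \<bullet> b))"
      by (simp only: prod_Basis_vec[of "\<lambda>t. ennreal (1 / (1 + (t / s)\<^sup>2)) * indicator {-1/2..1/2} t"])
  qed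
  also have "\<dots> = (\<Prod>b\<in>(Basis :: (real ^ 'n) set). (\<integral>\<^sup>+t. ?f t \<partial>lborel))"
    by (rule nn_integral_lborel_prod) auto
  also have "\<dots> \<le> (\<Prod>b\<in>(Basis :: (real ^ 'n) set). ennreal (pi * s))"
    by (intro prod_mono_ennreal nn_integral_cauchy_kernel s)
  also have "\<dots> = ennreal ((pi * s) ^ CARD('n))"
    using s by (simp add: ennreal_power)
  finally show ?thesis .
qed

definition weighted_mass :: "nat \<Rightarrow> real \<Rightarrow> real \<Rightarrow> (real ^ 'n::finite \<Rightarrow> complex) \<Rightarrow> real ^ 'n \<Rightarrow> ennreal" where
  "weighted_mass N s r f c = (\<integral>\<^sup>+y\<in>unit_cube. ennreal (cmod (weighted_part N s c f y) powr r) \<partial>lborel)"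

lemma cmod_weighted_part:
  "0 < s \<Longrightarrow> cmod (weighted_part N s c f y) = cmod (f y) / weight N s c y"
  using weight_ge_1[of s N c y] by (simp add: weighted_part_def norm_divide)

text \<open>
  The integrand is periodic in \<open>y\<close>, so the unit cube can be moved to the one centred at \<open>c\<close>.
\<close>
lemma weighted_mass_centred:
  fixes f :: "real ^ 'n::finite \<Rightarrow> complex"
  assumes cont: "continuous_on UNIV f" and per: "periodic1 f" and s: "0 < s" and r: "0 < r"
  shows "weighted_mass N s r f c
    = (\<integral>\<^sup>+v\<in>centred_cube. ennreal (cmod (f (c + v)) powr r / weight N s 0 v powr r) \<partial>lborel)"
proof -
  let ?g = "\<lambda>y. ennreal (cmod (weighted_part N s c f y) powr r)"
  let ?b = "c + - ((1/2) *\<^sub>R One)"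
  have [measurable]: "?g \<in> borel_measurable borel"
    using continuous_borel_measurable[OF continuous_weighted_part[OF s cont]] by measurable
  have "weighted_mass N s r f c = (\<integral>\<^sup>+y\<in>cbox 0 (0 + One). ?g y \<partial>lborel)"
    by (simp add: weighted_mass_def)
  also have "\<dots> = (\<integral>\<^sup>+y\<in>cbox ?b (?b + One). ?g y \<partial>lborel)"
  proof (rule nn_integral_periodic_cube)
    fix x :: "real ^ 'n" and k :: "int ^ 'n"
    have "x + real_vec k - c = (x - c) + real_vec k" by simp
    then have "weight N s c (x + real_vec k) = weight N s c x"
      unfolding weight_def by (simp only: wave_add_point wave_real_vec mult_1_right)
    moreover have "f (x + real_vec k) = f x" using per by (simp add: periodic1_def)
    ultimately show "?g (x + real_vec k) = ?g x" by (simp add: weighted_part_def)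
  qed measurable
  also have "\<dots> = (\<integral>\<^sup>+v. ?g (c + v) * indicator (cbox ?b (?b + One)) (c + v) \<partial>lborel)"
    by (rule nn_integral_translate[symmetric]) measurable
  also have "\<dots> = (\<integral>\<^sup>+v\<in>centred_cube. ennreal (cmod (f (c + v)) powr r / weight N s 0 v powr r) \<partial>lborel)"
  proof (rule nn_integral_cong)
    fix v :: "real ^ 'n"
    have "weight N s c (c + v) = weight N s 0 v" by (simp add: weight_def)
    moreover have "c + v \<in> cbox ?b (?b + One) \<longleftrightarrow> v \<in> centred_cube"
      by (auto simp: mem_box_cart)
    ultimately show "?g (c + v) * indicator (cbox ?b (?b + One)) (c + v)
        = ennreal (cmod (f (c + v)) powr r / weight N s 0 v powr r) * indicator centred_cube v"
      using weight_ge_1[OF s, of N 0 v] 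
      by (simp add: cmod_weighted_part[OF s] powr_divide indicator_def)
  qed
  finally show ?thesis .
qed

text \<open>
  The hypothesis only concerns cubes of side at most \<open>1\<close>. A larger cube is covered by translates
  of a unit cube under the lattice, and each of them carries the same mass as a unit cube that
  contains \<open>x\<close>.
\<close>
lemma large_cube_bound:
  fixes g :: "real ^ 'n::finite \<Rightarrow> ennreal"
  assumes [measurable]: "g \<in> borel_measurable borel"
    and per: "\<And>x (k :: int ^ 'n). g (x + real_vec k) = g x"
    and avg: "\<And>a L. 0 < L \<Longrightarrow> L \<le> 1 \<Longrightarrow> x \<in> cube a L \<Longrightarrow>
      (\<integral>\<^sup>+y\<in>cube a L. g y \<partial>lborel) \<le> ennreal (L ^ CARD('n) * m)"
    and m: "0 \<le> m" and L: "0 < L" "L \<le> 3" and x: "x \<in> cube a L"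
  shows "(\<integral>\<^sup>+y\<in>cube a L. g y \<partial>lborel) \<le> ennreal (3 ^ CARD('n) * L ^ CARD('n) * m)"
proof (cases "L \<le> 1")
  case True
  have "(\<integral>\<^sup>+y\<in>cube a L. g y \<partial>lborel) \<le> ennreal (L ^ CARD('n) * m)"
    using avg[OF L(1) True x] .
  also have "\<dots> \<le> ennreal (3 ^ CARD('n) * L ^ CARD('n) * m)"
    using L m by (intro ennreal_leI mult_right_mono) (auto simp: mult_le_cancel_right1)
  finally show ?thesis .
next
  case False
  define K where "K = {k :: int ^ 'n. \<forall>j. k $ j \<in> {0..2}}"
  have K: "finite K" "card K = 3 ^ CARD('n)"
    unfolding K_def by (simp_all add: lattice_box del: atLeastAtMost_iff)
  let ?C = "\<lambda>k. cbox (a + real_vec k) (a + real_vec k + One)"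
  have piece: "(\<integral>\<^sup>+y\<in>?C k. g y \<partial>lborel) \<le> ennreal m" for k
  proof -
    have "(\<integral>\<^sup>+y\<in>?C k. g y \<partial>lborel) = (\<integral>\<^sup>+y\<in>cbox x (x + One). g y \<partial>lborel)"
      by (rule nn_integral_periodic_cube) (auto simp: per)
    also have "\<dots> \<le> ennreal m"
      using avg[of 1 x] by (simp add: mem_box_cart)
    finally show ?thesis .
  qed
  have "(\<integral>\<^sup>+y\<in>cube a L. g y \<partial>lborel) \<le> (\<integral>\<^sup>+y. (\<Sum>k\<in>K. g y * indicator (?C k) y) \<partial>lborel)"
  proof (rule nn_integral_mono)
    fix y
    show "g y * indicator (cube a L) y \<le> (\<Sum>k\<in>K. g y * indicator (?C k) y)"
    proof (cases "y \<in> cube a L")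
      case True
      \<comment> \<open>The minimum puts the right end points into the last translate.\<close>
      define k :: "int ^ 'n" where "k = (\<chi> j. min 2 \<lfloor>y $ j - a $ j\<rfloor>)"
      have j: "a $ j \<le> y $ j" "y $ j \<le> a $ j + 3" for j
        using True L(2) by (auto simp: mem_box_cart intro: order_trans)
      have "k \<in> K"
        using j by (auto simp: K_def k_def)
      moreover have "y \<in> ?C k"
        unfolding mem_box_cart
      proof
        fix j'
        show "(a + real_vec k) $ j' \<le> y $ j' \<and> y $ j' \<le> (a + real_vec k + One) $ j'"
          using j[of j'] by (simp add: k_def real_vec_def min_def) linarith
      qed
      ultimately have "g y * indicator (?C k) y \<le> (\<Sum>k\<in>K. g y * indicator (?C k) y)"
        using K by (intro member_le_sum) auto
      then show ?thesis using True \<open>y \<in> ?C k\<close> by simp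
    qed auto
  qed
  also have "\<dots> = (\<Sum>k\<in>K. (\<integral>\<^sup>+y\<in>?C k. g y \<partial>lborel))"
    by (rule nn_integral_sum) auto
  also have "\<dots> \<le> (\<Sum>k\<in>K. ennreal m)"
    by (intro sum_mono piece)
  also have "\<dots> = ennreal (3 ^ CARD('n) * 1 * m)"
    using m K by (subst sum_ennreal) simp_all
  also have "\<dots> \<le> ennreal (3 ^ CARD('n) * L ^ CARD('n) * m)"
    using False m by (intro ennreal_leI mult_right_mono mult_left_mono) auto
  finally show ?thesis .
qed

text \<open>
  This says that \<open>M\<close> bounds the \<open>r\<close>-th power of the maximal function at \<open>x\<close>.
\<close>
definition cube_means_le :: "real \<Rightarrow> (real ^ 'n::finite \<Rightarrow> complex) \<Rightarrow> real ^ 'n \<Rightarrow> real \<Rightarrow> bool" where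
  "cube_means_le r f x M \<longleftrightarrow> (\<forall>a L. 0 < L \<longrightarrow> L \<le> 1 \<longrightarrow> x \<in> cube a L \<longrightarrow>
    Lr_mass r f (cube a L) \<le> ennreal (L ^ CARD('n) * M))"

lemma cube_means_leD:
  "cube_means_le r f x M \<Longrightarrow> 0 < L \<Longrightarrow> L \<le> 1 \<Longrightarrow> x \<in> cube a L \<Longrightarrow>
    Lr_mass r f (cube a L) \<le> ennreal (L ^ CARD('n) * M)"
  for f :: "real ^ 'n::finite \<Rightarrow> complex"
  unfolding cube_means_le_def by blast

text \<open>
  By Fubini's theorem it suffices to consider a fixed offset \<open>v = y - c\<close>. The translate of the
  given cube by \<open>v\<close> lies in a cube that contains \<open>x\<close> and is larger by \<open>2 * max_abs v\<close>; the growth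
  of its volume with \<open>v\<close> is absorbed by the weight.
\<close>
lemma weighted_mass_average:
  fixes f :: "real ^ 'n::finite \<Rightarrow> complex"
  assumes cont: "continuous_on UNIV f" and per: "periodic1 f" and s: "0 < s" "s \<le> l" "l \<le> 2" and r: "1 < r"
    and avg: "cube_means_le r f x m"
    and m: "0 \<le> m" and x: "x \<in> cube q l"
  shows "(\<integral>\<^sup>+c\<in>cube q l. weighted_mass (4 * CARD('n)) s r f c \<partial>lborel)
    \<le> ennreal ((48 * pi) ^ CARD('n) * (s ^ CARD('n) * l ^ CARD('n) * m))"
proof -
  let ?n = "CARD('n)"
  let ?N = "4 * ?n"
  let ?Q = "cube q l" and ?H = "centred_cube :: (real ^ 'n) set"
  let ?F = "\<lambda>c v. ennreal (cmod (f (c + v)) powr r / weight ?N s 0 v powr r) * indicator ?H v * indicator ?Q c"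
  have fm [measurable]: "(\<lambda>y. cmod (f y) powr r) \<in> borel_measurable borel"
    using continuous_borel_measurable[OF cont] by measurable
  have meas: "case_prod ?F \<in> borel_measurable borel"
  proof -
    have c: "continuous_on UNIV (\<lambda>p :: (real ^ 'n) \<times> (real ^ 'n). f (fst p + snd p))"
      by (rule continuous_on_compose2[OF cont]) (auto intro!: continuous_intros)
    have [measurable]: "(\<lambda>p. f (fst p + snd p)) \<in> borel_measurable (borel :: ((real ^ 'n) \<times> (real ^ 'n)) measure)"
      "(\<lambda>p. weight ?N s 0 (snd p)) \<in> borel_measurable (borel :: ((real ^ 'n) \<times> (real ^ 'n)) measure)"
      by (rule continuous_borel_measurable[OF c]) (intro continuous_borel_measurable continuous_intros)
    have [measurable]: "(\<lambda>p. indicator ?H (snd p) :: ennreal) \<in> borel_measurable (borel :: ((real ^ 'n) \<times> (real ^ 'n)) measure)"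
      "(\<lambda>p. indicator ?Q (fst p) :: ennreal) \<in> borel_measurable (borel :: ((real ^ 'n) \<times> (real ^ 'n)) measure)"
      by (auto simp flip: borel_prod intro!: measurable_compose[OF measurable_snd] measurable_compose[OF measurable_fst])
    show ?thesis unfolding split_beta by measurable
  qed
  have shifted: "(\<integral>\<^sup>+c\<in>?Q. ennreal (cmod (f (c + v)) powr r) \<partial>lborel) \<le> ennreal (3 ^ ?n * (l + 2 * max_abs v) ^ ?n * m)"
    if v: "v \<in> ?H" for v
  proof -
    let ?w = "max_abs v"
    let ?a = "q - ?w *\<^sub>R One"
    have w: "0 \<le> ?w" by (rule max_abs_nonneg)
    have w2: "?w \<le> 1 / 2"
    proof -
      obtain j where j: "?w = \<bar>v $ j\<bar>" by (rule max_abs_attained)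
      have "- (1 / 2) \<le> v $ j \<and> v $ j \<le> 1 / 2" using v by (simp add: mem_box_cart)
      then show ?thesis unfolding j by auto
    qed
    have vj: "- ?w \<le> v $ j" "v $ j \<le> ?w" for j
      using abs_le_max_abs[of v j] by auto
    have "(\<integral>\<^sup>+c\<in>?Q. ennreal (cmod (f (c + v)) powr r) \<partial>lborel)
        \<le> (\<integral>\<^sup>+c. ennreal (cmod (f (v + c)) powr r) * indicator (cube ?a (l + 2 * ?w)) (v + c) \<partial>lborel)"
    proof (rule nn_integral_mono)
      fix c
      have "v + c \<in> cube ?a (l + 2 * ?w)" if "c \<in> ?Q"
        unfolding mem_box_cart
      proof
        fix j
        have "q $ j \<le> c $ j" "c $ j \<le> q $ j + l" using that by (auto simp: mem_box_cart)
        then show "?a $ j \<le> (v + c) $ j \<and> (v + c) $ j \<le> (?a + (l + 2 * ?w) *\<^sub>R One) $ j"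
          using vj[of j] by simp
      qed
      then show "ennreal (cmod (f (c + v)) powr r) * indicator ?Q c
         \<le> ennreal (cmod (f (v + c)) powr r) * indicator (cube ?a (l + 2 * ?w)) (v + c)"
        by (auto simp: indicator_def add.commute)
    qed
    also have "\<dots> = Lr_mass r f (cube ?a (l + 2 * ?w))"
      by (rule nn_integral_translate) measurable
    also have "\<dots> \<le> ennreal (3 ^ ?n * (l + 2 * ?w) ^ ?n * m)"
    proof (rule large_cube_bound[where x = x])
      fix y :: "real ^ 'n" and k :: "int ^ 'n"
      show "ennreal (cmod (f (y + real_vec k)) powr r) = ennreal (cmod (f y) powr r)"
        using per by (simp add: periodic1_def)
      have xq: "q $ j \<le> x $ j" "x $ j \<le> q $ j + l" for j using x by (auto simp: mem_box_cart)
      show "x \<in> cube ?a (l + 2 * ?w)"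
        unfolding mem_box_cart
      proof
        fix j show "?a $ j \<le> x $ j \<and> x $ j \<le> (?a + (l + 2 * ?w) *\<^sub>R One) $ j"
          using xq[of j] w by simp
      qed
    qed (use cube_means_leD[OF avg] m s w w2 fm in auto)
    finally show ?thesis .
  qed
  let ?k = "\<lambda>v :: real ^ 'n. \<Prod>j\<in>UNIV. 1 + (v $ j / s)\<^sup>2"
  define A where "A = 48 ^ ?n * l ^ ?n * m"
  have A: "0 \<le> A" using s m by (simp add: A_def)
  have kernel: "(\<integral>\<^sup>+c. ?F c v \<partial>lborel) \<le> ennreal A * (ennreal (1 / ?k v) * indicator ?H v)" for v
  proof (cases "v \<in> ?H")
    case True
    let ?W = "weight ?N s 0 v"
    have vj: "\<bar>v $ j\<bar> \<le> 1 / 2" for j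
    proof -
      have "- (1 / 2) \<le> v $ j \<and> v $ j \<le> 1 / 2" using True by (simp add: mem_box_cart)
      then show ?thesis by auto
    qed
    have W: "1 \<le> ?W" by (rule weight_ge_1[OF s(1)])
    have k: "0 < ?k v" by (intro prod_pos) (auto intro: add_pos_nonneg)
    have Wr: "?W \<le> ?W powr r" using W r powr_mono[of 1 r ?W] by simp
    have X: "0 \<le> max_abs v / s" using s max_abs_nonneg[of v] by simp
    have "(\<integral>\<^sup>+c. ?F c v \<partial>lborel) = (\<integral>\<^sup>+c. ennreal (1 / ?W powr r) * (ennreal (cmod (f (v + c)) powr r) * indicator ?Q c) \<partial>lborel)"
      using True by (intro nn_integral_cong) (auto simp: indicator_def add.commute simp flip: ennreal_mult)
    also have "\<dots> = ennreal (1 / ?W powr r) * (\<integral>\<^sup>+c\<in>?Q. ennreal (cmod (f (c + v)) powr r) \<partial>lborel)"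
      by (subst nn_integral_cmult) (auto simp: add.commute)
    also have "\<dots> \<le> ennreal (1 / ?W powr r) * ennreal (3 ^ ?n * (l + 2 * max_abs v) ^ ?n * m)"
      by (intro mult_left_mono shifted True) auto
    also have "\<dots> = ennreal ((1 / ?W powr r) * (3 ^ ?n * (l + 2 * max_abs v) ^ ?n * m))"
      by (rule ennreal_mult[symmetric]) (use m s max_abs_nonneg[of v] in auto)
    also have "\<dots> \<le> ennreal (A * (1 / ?k v))"
    proof (rule ennreal_leI)
      have "l + 2 * max_abs v \<le> l * (1 + 2 * (max_abs v / s))"
        using s max_abs_nonneg[of v] by (simp add: field_simps mult_right_mono)
      then have "(l + 2 * max_abs v) ^ ?n \<le> (l * (1 + 2 * (max_abs v / s))) ^ ?n"
        using s max_abs_nonneg[of v] by (intro power_mono) auto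
      also have "\<dots> = l ^ ?n * ((1 + 2 * (max_abs v / s)) ^ ?n * ?k v) * (1 / ?k v)"
      proof -
        have "(l * y) ^ ?n = l ^ ?n * (y ^ ?n * z) * (1 / z)" if "0 < z" for y z
          using that by (simp add: power_mult_distrib)
        then show ?thesis using k by blast
      qed
      also have "\<dots> \<le> l ^ ?n * (16 ^ ?n * ?W powr r) * (1 / ?k v)"
        using weight_dominates[OF s(1) vj] Wr k s
        by (intro mult_right_mono mult_left_mono) (auto intro: order_trans mult_left_mono)
      finally have "(1 / ?W powr r) * (3 ^ ?n * (l + 2 * max_abs v) ^ ?n * m)
         \<le> (1 / ?W powr r) * (3 ^ ?n * (l ^ ?n * (16 ^ ?n * ?W powr r) * (1 / ?k v)) * m)"
        using W m by (intro mult_left_mono mult_right_mono) auto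
      also have "\<dots> = A * (1 / ?k v)"
      proof -
        have "(48::real) ^ ?n = 3 ^ ?n * 16 ^ ?n" by (simp flip: power_mult_distrib)
        moreover have "?W powr r \<noteq> 0" using W by simp
        ultimately show ?thesis by (simp add: A_def field_simps)
      qed
      finally show "(1 / ?W powr r) * (3 ^ ?n * (l + 2 * max_abs v) ^ ?n * m) \<le> A * (1 / ?k v)" .
    qed
    also have "\<dots> = ennreal A * ennreal (1 / ?k v)"
      by (rule ennreal_mult) (use A k in auto)
    finally show ?thesis using True by simp
  qed simp
  have "(\<integral>\<^sup>+c\<in>?Q. weighted_mass ?N s r f c \<partial>lborel) = (\<integral>\<^sup>+c. (\<integral>\<^sup>+v. ?F c v \<partial>lborel) \<partial>lborel)"
  proof (rule nn_integral_cong)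
    fix c
    show "weighted_mass ?N s r f c * indicator ?Q c = (\<integral>\<^sup>+v. ?F c v \<partial>lborel)"
      using r by (cases "c \<in> ?Q") (simp_all add: weighted_mass_centred[OF cont per s(1)])
  qed
  also have "\<dots> = (\<integral>\<^sup>+v. (\<integral>\<^sup>+c. ?F c v \<partial>lborel) \<partial>lborel)"
    by (rule lborel_Fubini[symmetric, OF meas])
  also have "\<dots> \<le> (\<integral>\<^sup>+v. ennreal A * (ennreal (1 / ?k v) * indicator ?H v) \<partial>lborel)"
    by (intro nn_integral_mono kernel)
  also have "\<dots> = ennreal A * (\<integral>\<^sup>+v\<in>?H. ennreal (1 / ?k v) \<partial>lborel)"
  proof (rule nn_integral_cmult)
    have "1 + (v $ j / s)\<^sup>2 \<noteq> 0" for v :: "real ^ 'n" and j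
      using zero_le_power2[of "v $ j / s"] by linarith
    then have "continuous_on UNIV (\<lambda>v :: real ^ 'n. 1 / ?k v)"
      using s by (intro continuous_intros) auto
    from continuous_borel_measurable[OF this]
    show "(\<lambda>v. ennreal (1 / ?k v) * indicator ?H v) \<in> borel_measurable lborel"
      by simp
  qed
  also have "\<dots> \<le> ennreal A * ennreal ((pi * s) ^ ?n)"
    by (intro mult_left_mono nn_integral_product_kernel s) auto
  also have "\<dots> = ennreal ((48 * pi) ^ ?n * (s ^ ?n * l ^ ?n * m))"
    using A s by (simp add: A_def ennreal_mult[symmetric] power_mult_distrib mult_ac)
  finally show ?thesis .
qed


section \<open>Weighted bounds for sums over frequencies\<close>

lemma foldr_indicator_power:
  "foldr (\<lambda>j. D j ^^ (if j \<in> J then 1 else 0)) js f = foldr D (filter (\<lambda>i. i \<in> J) js) f"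
  by (induction js) auto

lemma multi_power_indicator:
  "multi_power D (\<lambda>j. if j \<in> J then 1 else 0) f = foldr D (filter (\<lambda>i. i \<in> J) coord_list) f"
  unfolding multi_power_def by (rule foldr_indicator_power)

lemma foldr_single_power:
  "distinct js \<Longrightarrow> foldr (\<lambda>i. D i ^^ (if i = j then l else 0)) js f = (if j \<in> set js then (D j ^^ l) f else f)"
  by (induction js) auto

lemma multi_power_single: "multi_power D (\<lambda>i. if i = j then l else 0) f = (D j ^^ l) f"
  unfolding multi_power_def by (simp add: foldr_single_power[OF coord_list(1)] coord_list(2))

lemma order_of_single: "order_of (\<lambda>i. if i = j then l else 0) = l"
  by (simp add: order_of_def)

lemma order_of_indicator: "order_of (\<lambda>i. if i \<in> J then 1 else 0) = card J"
  by (simp add: order_of_def sum.If_cases)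

lemma partial_eqI:
  assumes "((\<lambda>t. g (y + t *\<^sub>R axis j 1)) has_vector_derivative d) (at 0)"
  shows "partial j g y = d"
  unfolding partial_def using assms by (rule vector_derivative_at)

lemma partial_has_vector_derivative_0:
  assumes "g differentiable_on UNIV"
  shows "((\<lambda>t. g (y + t *\<^sub>R axis j 1)) has_vector_derivative partial j g y) (at 0)"
  using partial_has_vector_derivative[OF assms, where t = 0] by simp

lemma partial_diff:
  assumes "f differentiable_on UNIV" "g differentiable_on UNIV"
  shows "partial j (\<lambda>x. f x - g x) = (\<lambda>x. partial j f x - partial j g x)"
  by (rule ext, rule partial_eqI)
     (intro has_vector_derivative_diff partial_has_vector_derivative_0 assms)

lemma foldr_partial_diff:
  assumes "smooth f" "smooth g"
  shows "foldr partial js (\<lambda>x. f x - g x) = (\<lambda>x. foldr partial js f x - foldr partial js g x)"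
  by (induction js) (simp_all add: partial_diff smooth_foldr_differentiable assms)

lemma smooth_minus:
  assumes "smooth f" "smooth g"
  shows "smooth (\<lambda>x. f x - g x)"
  unfolding smooth_def foldr_partial_diff[OF assms]
  by (intro allI differentiable_on_diff smooth_foldr_differentiable assms)

lemma difference_funpow_apply_Suc:
  "(difference j ^^ Suc l) (\<sigma> y) \<xi> = (difference j ^^ l) (\<lambda>\<eta>. \<sigma> y (\<eta> + axis j 1) - \<sigma> y \<eta>) \<xi>"
proof -
  have "difference j (\<sigma> y) = (\<lambda>\<eta>. \<sigma> y (\<eta> + axis j 1) - \<sigma> y \<eta>)"
    by (rule ext) (simp add: difference_def)
  then show ?thesis by (simp add: funpow_swap1)
qed

lemma smooth_difference_funpow:
  assumes "\<And>\<xi>. smooth (\<lambda>x. \<sigma> x \<xi>)"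
  shows "smooth (\<lambda>x. (difference j ^^ l) (\<sigma> x) \<xi>)"
  using assms
proof (induction l arbitrary: \<sigma>)
  case (Suc l)
  show ?case
    unfolding difference_funpow_apply_Suc
    by (rule Suc.IH) (intro smooth_minus Suc.prems)
qed simp

lemma partial_difference_funpow:
  assumes "\<And>\<xi>. smooth (\<lambda>x. \<sigma> x \<xi>)"
  shows "partial i (\<lambda>y. (difference j ^^ l) (\<sigma> y) \<xi>) z = (difference j ^^ l) (\<lambda>\<eta>. partial i (\<lambda>y. \<sigma> y \<eta>) z) \<xi>"
  using assms
proof (induction l arbitrary: \<sigma>)
  case (Suc l)
  have d: "(\<lambda>x. \<sigma> x \<eta>) differentiable_on UNIV" for \<eta>
    using smooth_foldr_differentiable[OF Suc.prems, of "[]"] by simp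
  have "partial i (\<lambda>y. (difference j ^^ Suc l) (\<sigma> y) \<xi>) z
      = (difference j ^^ l) (\<lambda>\<eta>. partial i (\<lambda>y. \<sigma> y (\<eta> + axis j 1) - \<sigma> y \<eta>) z) \<xi>"
    unfolding difference_funpow_apply_Suc
    by (rule Suc.IH) (intro smooth_minus Suc.prems)
  also have "\<dots> = (difference j ^^ l) (\<lambda>\<eta>. partial i (\<lambda>y. \<sigma> y (\<eta> + axis j 1)) z - partial i (\<lambda>y. \<sigma> y \<eta>) z) \<xi>"
    by (simp only: partial_diff[OF d d])
  also have "\<dots> = (difference j ^^ Suc l) (\<lambda>\<eta>. partial i (\<lambda>y. \<sigma> y \<eta>) z) \<xi>"
    using difference_funpow_apply_Suc[of l j "\<lambda>z \<eta>. partial i (\<lambda>y. \<sigma> y \<eta>) z" z \<xi>] by simp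
  finally show ?case .
qed simp

definition dyadic_scale :: "real \<Rightarrow> nat \<Rightarrow> real" where
  "dyadic_scale \<rho> k = (2 ^ k) powr (- \<rho>)"

lemma dyadic_scale_pos: "0 < dyadic_scale \<rho> k"
  by (simp add: dyadic_scale_def)

lemma dyadic_scale_le_1: "0 \<le> \<rho> \<Longrightarrow> dyadic_scale \<rho> k \<le> 1"
  using powr_mono[of "- \<rho>" 0 "2 ^ k :: real"] by (simp add: dyadic_scale_def)

lemma inverse_le_dyadic_scale: "\<rho> \<le> 1 \<Longrightarrow> 1 / 2 ^ k \<le> dyadic_scale \<rho> k"
  using powr_mono[of "- 1" "- \<rho>" "2 ^ k :: real"] by (simp add: dyadic_scale_def powr_minus_divide)

lemma dyadic_scale_power: "dyadic_scale \<rho> k ^ l = (2 ^ k) powr (- \<rho> * real l)"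
  unfolding dyadic_scale_def by (subst powr_power) (auto simp: mult.commute)

text \<open>
  Finitely many of the seminorms are involved, and on a shell the bracket is comparable to \<open>2 ^
  k\<close>. In terms of the scale, a difference gains a factor and a derivative loses one.
\<close>
lemma symbol_shell_bound:
  fixes \<sigma> :: "real ^ 'n::finite \<Rightarrow> int ^ 'n \<Rightarrow> complex"
  assumes "\<sigma> \<in> symbol_class m \<rho> \<rho>" "0 \<le> \<rho>"
  obtains A where "0 \<le> A"
    "\<And>k \<xi> l j J x. \<xi> \<in> shell N k \<Longrightarrow> l \<le> N \<Longrightarrow>
      cmod (foldr partial (filter (\<lambda>i. i \<in> J) coord_list) (\<lambda>y. (difference j ^^ l) (\<sigma> y) \<xi>) x)
      \<le> A * (2 ^ k) powr m * dyadic_scale \<rho> k ^ l / dyadic_scale \<rho> k ^ card J"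
proof -
  let ?P = "\<lambda>\<alpha> \<beta> C. \<forall>x \<xi>. cmod (multi_power partial \<beta> (\<lambda>y. multi_power difference \<alpha> (\<sigma> y) \<xi>) x)
        \<le> C * japanese_bracket \<xi> powr (m - \<rho> * real (order_of \<alpha>) + \<rho> * real (order_of \<beta>))"
  define C where "C \<alpha> \<beta> = (SOME C. ?P \<alpha> \<beta> C)" for \<alpha> \<beta>
  have C: "?P \<alpha> \<beta> (C \<alpha> \<beta>)" for \<alpha> \<beta>
  proof -
    have "\<exists>C. ?P \<alpha> \<beta> C" using assms(1) by (simp add: symbol_class_def)
    then show ?thesis unfolding C_def by (rule someI_ex)
  qed
  define Cs where "Cs l j J = \<bar>C (\<lambda>i. if i = j then l else 0) (\<lambda>i. if i \<in> J then 1 else 0)\<bar>" for l j J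
  define C1 where "C1 = (\<Sum>l\<le>N. \<Sum>j\<in>UNIV. \<Sum>J\<in>UNIV. Cs l j J)"
  define D where "D = (2 * real N + 2) * (real CARD('n) + 1)"
  define E where "E = \<bar>m\<bar> + \<rho> * real N + \<rho> * real CARD('n)"
  have D1: "1 \<le> D"
  proof -
    have "1 * 1 \<le> D" unfolding D_def by (intro mult_mono) auto
    then show ?thesis by simp
  qed
  have C1: "Cs l j J \<le> C1" if "l \<le> N" for l j J
  proof -
    have "Cs l j J \<le> (\<Sum>J\<in>UNIV. Cs l j J)" by (intro member_le_sum) (auto simp: Cs_def)
    also have "\<dots> \<le> (\<Sum>j\<in>UNIV. \<Sum>J\<in>UNIV. Cs l j J)"
      by (rule member_le_sum[of j UNIV "\<lambda>j. \<Sum>J\<in>UNIV. Cs l j J"]) (auto simp: Cs_def sum_nonneg)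
    also have "\<dots> \<le> C1"
      unfolding C1_def using that
      by (intro member_le_sum[of l "{..N}" "\<lambda>l. \<Sum>j\<in>UNIV. \<Sum>J\<in>UNIV. Cs l j J"]) (auto simp: Cs_def sum_nonneg)
    finally show ?thesis .
  qed
  show ?thesis
  proof
    show "0 \<le> C1 * D powr E" by (simp add: C1_def Cs_def sum_nonneg)
    fix k l x and j :: 'n and J :: "'n set" and \<xi> :: "int ^ 'n"
    assume \<xi>: "\<xi> \<in> shell N k" and l: "l \<le> N"
    define e where "e = m - \<rho> * real l + \<rho> * real (card J)"
    have "card J \<le> CARD('n)" by (intro card_mono) auto
    then have "\<rho> * real l \<le> \<rho> * real N" "\<rho> * real (card J) \<le> \<rho> * real CARD('n)"
      "0 \<le> \<rho> * real l" "0 \<le> \<rho> * real (card J)"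
      using l assms(2) by (auto intro!: mult_left_mono)
    then have e: "\<bar>e\<bar> \<le> E"
      unfolding e_def E_def by linarith
    have "cmod (foldr partial (filter (\<lambda>i. i \<in> J) coord_list) (\<lambda>y. (difference j ^^ l) (\<sigma> y) \<xi>) x)
       \<le> C (\<lambda>i. if i = j then l else 0) (\<lambda>i. if i \<in> J then 1 else 0) * japanese_bracket \<xi> powr e"
      using C[rule_format, where \<alpha> = "\<lambda>i. if i = j then l else 0" and \<beta> = "\<lambda>i. if i \<in> J then 1 else 0" and x = x and \<xi> = \<xi>]
      by (simp only: multi_power_single multi_power_indicator order_of_single order_of_indicator e_def)
    also have "\<dots> \<le> Cs l j J * japanese_bracket \<xi> powr e"
      by (intro mult_right_mono) (auto simp: Cs_def)
    also have "\<dots> \<le> C1 * (D powr E * (2 ^ k) powr e)"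
    proof (intro mult_mono C1 l)
      have "japanese_bracket \<xi> powr e \<le> D powr \<bar>e\<bar> * (2 ^ k) powr e"
        unfolding D_def by (rule japanese_bracket_powr_shell[OF \<xi>])
      also have "\<dots> \<le> D powr E * (2 ^ k) powr e"
        using D1 e by (intro mult_right_mono powr_mono) auto
      finally show "japanese_bracket \<xi> powr e \<le> D powr E * (2 ^ k) powr e" .
    qed (auto simp: C1_def Cs_def sum_nonneg)
    also have "(2 ^ k) powr e = (2 ^ k) powr m * dyadic_scale \<rho> k ^ l / dyadic_scale \<rho> k ^ card J"
      unfolding dyadic_scale_power e_def by (simp add: powr_add powr_diff powr_minus_divide)
    finally show "cmod (foldr partial (filter (\<lambda>i. i \<in> J) coord_list) (\<lambda>y. (difference j ^^ l) (\<sigma> y) \<xi>) x)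
      \<le> C1 * D powr E * (2 ^ k) powr m * dyadic_scale \<rho> k ^ l / dyadic_scale \<rho> k ^ card J"
      by (simp add: mult_ac)
  qed
qed

text \<open>
  The triples \<open>(j, i, l)\<close> of a direction, a total order of differences, and the part of this
  order that falls on the symbol.
\<close>
definition reduction_index :: "nat \<Rightarrow> ('n::finite \<times> nat \<times> nat) set" where
  "reduction_index N = (SIGMA j:UNIV. SIGMA i:{..N}. {..i})"

lemma finite_reduction_index [simp]: "finite (reduction_index N)"
  by (simp add: reduction_index_def)

definition reduced_coefficient ::
  "nat \<Rightarrow> real \<Rightarrow> real ^ 'n \<Rightarrow> (real ^ 'n \<Rightarrow> complex) \<Rightarrow> (int ^ 'n \<Rightarrow> complex) \<Rightarrow> 'n::finite \<times> nat \<times> nat \<Rightarrow> int ^ 'n \<Rightarrow> complex" where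
  "reduced_coefficient M s c f u = (\<lambda>(j, i, l) \<xi>.
     (difference j ^^ (i - l)) u (\<xi> + axis j (int l)) * fourier_torus (modulated_part M s c f j) \<xi>)"

lemma weighted_reduction_index:
  fixes u v :: "int ^ 'n::finite \<Rightarrow> complex"
  assumes "finite S" "\<And>\<xi> j a. a \<le> 2 * M \<Longrightarrow> u (\<xi> + axis j (int a)) \<noteq> 0 \<Longrightarrow> \<xi> \<in> S"
    "0 < s" "\<And>j. \<bar>x $ j - c $ j\<bar> \<le> s" "continuous_on UNIV f" "even M"
  shows "cmod (\<Sum>\<xi>\<in>S. u \<xi> * fourier_torus f \<xi> * wave \<xi> x * v \<xi>)
    \<le> cmod (\<Sum>\<xi>\<in>S. u \<xi> * fourier_torus (weighted_part (2 * M) s c f) \<xi> * wave \<xi> x * v \<xi>)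
      + (\<Sum>t\<in>reduction_index (2 * M). (8 * pi) ^ (2 * M) * ((1 / s) ^ fst (snd t) *
          cmod (\<Sum>\<xi>\<in>S. reduced_coefficient M s c f u t \<xi> * wave \<xi> x * (difference (fst t) ^^ snd (snd t)) v \<xi>)))"
  using weighted_reduction[OF assms, where v = v]
  by (simp add: reduction_index_def reduced_coefficient_def sum.Sigma case_prod_unfold)

definition weighted_mass_real :: "nat \<Rightarrow> real \<Rightarrow> real \<Rightarrow> (real ^ 'n::finite \<Rightarrow> complex) \<Rightarrow> real ^ 'n \<Rightarrow> real" where
  "weighted_mass_real N s r f c = (LINT y:unit_cube|lborel. cmod (weighted_part N s c f y) powr r)"

lemma weighted_mass_real_nonneg: "0 \<le> weighted_mass_real N s r f c"
  unfolding weighted_mass_real_def set_lebesgue_integral_def by (intro integral_nonneg_AE) auto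

text \<open>
  The right-hand side of \<open>restricted_hausdorff_young\<close> for the weighted part of \<open>f\<close>.
\<close>
definition coefficient_bound :: "(int ^ 'n::finite) set \<Rightarrow> nat \<Rightarrow> real \<Rightarrow> real \<Rightarrow> (real ^ 'n \<Rightarrow> complex) \<Rightarrow> real ^ 'n \<Rightarrow> real" where
  "coefficient_bound S N s r f c = 4 * real (card S) powr (2 / r - 1) * weighted_mass_real N s r f c powr (2 / r)"

lemma coefficient_bound_nonneg: "0 \<le> coefficient_bound S N s r f c"
  by (simp add: coefficient_bound_def)

lemma weighted_part_coefficients:
  assumes "continuous_on UNIV f" "0 < s" "finite S" "1 < r" "r \<le> 2"
  shows "(\<Sum>\<xi>\<in>S. (cmod (fourier_torus (weighted_part N s c f) \<xi>))\<^sup>2) \<le> coefficient_bound S N s r f c"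
  unfolding coefficient_bound_def weighted_mass_real_def
  by (rule restricted_hausdorff_young[OF continuous_weighted_part]) (use assms in auto)

lemma modulated_part_coefficients:
  assumes "continuous_on UNIV f" "0 < s" "finite S" "1 < r" "r \<le> 2"
  shows "(\<Sum>\<xi>\<in>S. (cmod (fourier_torus (modulated_part M s c f j) \<xi>))\<^sup>2) \<le> coefficient_bound S (2 * M) s r f c"
  using restricted_hausdorff_young[OF continuous_modulated_part[OF assms(2,1)] assms(3-5), of M c j]
  by (simp only: coefficient_bound_def weighted_mass_real_def cmod_modulated_part)

lemma reduced_coefficient_sum:
  fixes u :: "int ^ 'n::finite \<Rightarrow> complex"
  assumes f: "continuous_on UNIV f" "0 < s" "finite S" "1 < r" "r \<le> 2" and t: "t \<in> reduction_index (2 * M)"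
    and u: "\<And>i j \<xi>. i \<le> 2 * M \<Longrightarrow> cmod ((difference j ^^ i) u \<xi>) \<le> U * s ^ i" and U: "0 \<le> U"
  shows "(\<Sum>\<xi>\<in>S. (cmod (reduced_coefficient M s c f u t \<xi>))\<^sup>2)
     \<le> (U * s ^ (fst (snd t) - snd (snd t)))\<^sup>2 * coefficient_bound S (2 * M) s r f c"
proof -
  obtain j i l where t: "t = (j, i, l)" "i \<le> 2 * M" "l \<le> i"
    using t by (auto simp: reduction_index_def)
  have "(\<Sum>\<xi>\<in>S. (cmod (reduced_coefficient M s c f u t \<xi>))\<^sup>2)
     \<le> (\<Sum>\<xi>\<in>S. (U * s ^ (i - l))\<^sup>2 * (cmod (fourier_torus (modulated_part M s c f j) \<xi>))\<^sup>2)"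
    unfolding reduced_coefficient_def t prod.case norm_mult power_mult_distrib
    using u[of "i - l"] t unfolding power_mult_distrib[symmetric]
    by (intro sum_mono power_mono mult_right_mono) auto
  also have "\<dots> = (U * s ^ (i - l))\<^sup>2 * (\<Sum>\<xi>\<in>S. (cmod (fourier_torus (modulated_part M s c f j) \<xi>))\<^sup>2)"
    by (simp add: sum_distrib_left)
  also have "\<dots> \<le> (U * s ^ (i - l))\<^sup>2 * coefficient_bound S (2 * M) s r f c"
    by (intro mult_left_mono modulated_part_coefficients f) auto
  finally show ?thesis by (simp add: t)
qed

lemma cmod_wave_sum_le:
  assumes w: "\<And>\<xi>. \<xi> \<in> S \<Longrightarrow> cmod (w \<xi>) \<le> B" and B: "0 \<le> B" and d: "(\<Sum>\<xi>\<in>S. (cmod (d \<xi>))\<^sup>2) \<le> Q\<^sup>2 * E" and Q: "0 \<le> Q"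
  shows "cmod (\<Sum>\<xi>\<in>S. d \<xi> * wave \<xi> x * w \<xi>) \<le> B * Q * sqrt (real (card S) * E)"
proof -
  have "cmod (\<Sum>\<xi>\<in>S. d \<xi> * wave \<xi> x * w \<xi>) \<le> (\<Sum>\<xi>\<in>S. cmod (d \<xi> * wave \<xi> x * w \<xi>))"
    by (rule norm_sum)
  also have "\<dots> \<le> (\<Sum>\<xi>\<in>S. B * (cmod (d \<xi>) * 1))"
    using mult_right_mono[OF w norm_ge_zero] by (intro sum_mono) (simp add: norm_mult mult.commute)
  also have "\<dots> = B * (\<Sum>\<xi>\<in>S. cmod (d \<xi>) * 1)" by (simp add: sum_distrib_left)
  also have "\<dots> \<le> B * sqrt ((\<Sum>\<xi>\<in>S. (cmod (d \<xi>))\<^sup>2) * (\<Sum>\<xi>\<in>S. 1\<^sup>2))"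
    by (intro mult_left_mono real_le_rsqrt[OF Cauchy_Schwarz_ineq_sum] B)
  also have "\<dots> \<le> B * sqrt (Q\<^sup>2 * (real (card S) * E))"
    using B mult_right_mono[OF d, of "real (card S)"] by (intro mult_left_mono real_sqrt_le_mono) (auto simp: mult_ac)
  also have "\<dots> = B * Q * sqrt (real (card S) * E)"
    using Q by (simp add: real_sqrt_mult)
  finally show ?thesis .
qed

text \<open>
  In each term of the reduction the symbol gains \<open>s ^ l\<close> and the cutoff \<open>s ^ (i - l)\<close>, which
  together cancel the factor \<open>(1 / s) ^ i\<close>.
\<close>
lemma weighted_sup_bound:
  fixes u v :: "int ^ 'n::finite \<Rightarrow> complex"
  assumes S: "finite S" and supp: "\<And>\<xi> j a. a \<le> 2 * M \<Longrightarrow> u (\<xi> + axis j (int a)) \<noteq> 0 \<Longrightarrow> \<xi> \<in> S"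
    and s: "0 < s" and near: "\<And>j. \<bar>x $ j - c $ j\<bar> \<le> s" and f: "continuous_on UNIV f" and M: "even M"
    and r: "1 < r" "r \<le> 2" and U: "0 \<le> U" and A: "0 \<le> A"
    and u: "\<And>i j \<xi>. i \<le> 2 * M \<Longrightarrow> cmod ((difference j ^^ i) u \<xi>) \<le> U * s ^ i"
    and v: "\<And>i j \<xi>. \<xi> \<in> S \<Longrightarrow> i \<le> 2 * M \<Longrightarrow> cmod ((difference j ^^ i) v \<xi>) \<le> A * s ^ i"
  shows "cmod (\<Sum>\<xi>\<in>S. u \<xi> * fourier_torus f \<xi> * wave \<xi> x * v \<xi>)
    \<le> (1 + real (card (reduction_index (2 * M) :: ('n \<times> nat \<times> nat) set)) * (8 * pi) ^ (2 * M)) *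
      (A * U * sqrt (real (card S) * coefficient_bound S (2 * M) s r f c))"
proof -
  let ?R = "sqrt (real (card S) * coefficient_bound S (2 * M) s r f c)"
  let ?T = "reduction_index (2 * M) :: ('n \<times> nat \<times> nat) set"
  have main: "cmod (\<Sum>\<xi>\<in>S. u \<xi> * fourier_torus (weighted_part (2 * M) s c f) \<xi> * wave \<xi> x * v \<xi>) \<le> A * U * ?R"
  proof (rule cmod_wave_sum_le[OF _ A _ U])
    show "cmod (v \<xi>) \<le> A" if "\<xi> \<in> S" for \<xi>
      using v[OF that, of 0] by simp
    have "(\<Sum>\<xi>\<in>S. (cmod (u \<xi> * fourier_torus (weighted_part (2 * M) s c f) \<xi>))\<^sup>2)
       \<le> (\<Sum>\<xi>\<in>S. U\<^sup>2 * (cmod (fourier_torus (weighted_part (2 * M) s c f) \<xi>))\<^sup>2)"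
      using u[of 0] unfolding norm_mult power_mult_distrib[symmetric]
      by (intro sum_mono power_mono mult_right_mono) auto
    also have "\<dots> = U\<^sup>2 * (\<Sum>\<xi>\<in>S. (cmod (fourier_torus (weighted_part (2 * M) s c f) \<xi>))\<^sup>2)"
      by (simp add: sum_distrib_left)
    also have "\<dots> \<le> U\<^sup>2 * coefficient_bound S (2 * M) s r f c"
      by (intro mult_left_mono weighted_part_coefficients f s S r) auto
    finally show "(\<Sum>\<xi>\<in>S. (cmod (u \<xi> * fourier_torus (weighted_part (2 * M) s c f) \<xi>))\<^sup>2)
       \<le> U\<^sup>2 * coefficient_bound S (2 * M) s r f c" .
  qed
  have terms: "(8 * pi) ^ (2 * M) * ((1 / s) ^ fst (snd t) *
          cmod (\<Sum>\<xi>\<in>S. reduced_coefficient M s c f u t \<xi> * wave \<xi> x * (difference (fst t) ^^ snd (snd t)) v \<xi>))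
      \<le> (8 * pi) ^ (2 * M) * (A * U * ?R)" if t: "t \<in> ?T" for t
  proof (rule mult_left_mono)
    obtain j i l where jil: "t = (j, i, l)" "i \<le> 2 * M" "l \<le> i"
      using t by (auto simp: reduction_index_def)
    have "cmod (\<Sum>\<xi>\<in>S. reduced_coefficient M s c f u t \<xi> * wave \<xi> x * (difference (fst t) ^^ snd (snd t)) v \<xi>)
       \<le> (A * s ^ l) * (U * s ^ (i - l)) * ?R"
      using v[where i = l] jil A U s reduced_coefficient_sum[OF f s S r t u U, where c = c]
      by (intro cmod_wave_sum_le) auto
    also have "\<dots> = s ^ i * (A * U * ?R)"
      using jil by (simp add: power_add[symmetric] mult_ac)
    finally have "(1 / s) ^ i * cmod (\<Sum>\<xi>\<in>S. reduced_coefficient M s c f u t \<xi> * wave \<xi> x * (difference (fst t) ^^ snd (snd t)) v \<xi>)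
       \<le> (1 / s) ^ i * (s ^ i * (A * U * ?R))"
      using s by (intro mult_left_mono) auto
    also have "\<dots> = A * U * ?R"
      using s by (simp add: power_divide)
    finally show "(1 / s) ^ fst (snd t) * cmod (\<Sum>\<xi>\<in>S. reduced_coefficient M s c f u t \<xi> * wave \<xi> x * (difference (fst t) ^^ snd (snd t)) v \<xi>)
       \<le> A * U * ?R" by (simp add: jil)
  qed auto
  have "cmod (\<Sum>\<xi>\<in>S. u \<xi> * fourier_torus f \<xi> * wave \<xi> x * v \<xi>)
     \<le> A * U * ?R + (\<Sum>t\<in>?T. (8 * pi) ^ (2 * M) * (A * U * ?R))"
    using order_trans[OF weighted_reduction_index[OF S supp s near f M, where v = v]
        add_mono[OF main sum_mono[OF terms]]] .
  then show ?thesis by (simp add: algebra_simps)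
qed

text \<open>
  As in the previous lemma the powers of \<open>s\<close> cancel, now after \<open>local_L2_bound\<close> has been applied
  to each term of the reduction.
\<close>
lemma weighted_L2_bound:
  fixes u :: "int ^ 'n::finite \<Rightarrow> complex" and \<sigma> :: "real ^ 'n \<Rightarrow> int ^ 'n \<Rightarrow> complex"
  assumes S: "finite S" and supp: "\<And>\<xi> j a. a \<le> 2 * M \<Longrightarrow> u (\<xi> + axis j (int a)) \<noteq> 0 \<Longrightarrow> \<xi> \<in> S"
    and s: "0 < s" "s \<le> 1" and c: "c \<in> cube b s" and f: "continuous_on UNIV f" and M: "even M"
    and r: "1 < r" "r \<le> 2" and U: "0 \<le> U" and A: "0 \<le> A"
    and u: "\<And>i j \<xi>. i \<le> 2 * M \<Longrightarrow> cmod ((difference j ^^ i) u \<xi>) \<le> U * s ^ i"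
    and smooth: "\<And>\<xi>. smooth (\<lambda>x. \<sigma> x \<xi>)"
    and sigma: "\<And>\<xi> l j J x. \<xi> \<in> S \<Longrightarrow> l \<le> 2 * M \<Longrightarrow>
      cmod (foldr partial (filter (\<lambda>i. i \<in> J) coord_list) (\<lambda>y. (difference j ^^ l) (\<sigma> y) \<xi>) x) \<le> A * s ^ l / s ^ card J"
  shows "(\<integral>\<^sup>+x\<in>cube b s. ennreal ((cmod (\<Sum>\<xi>\<in>S. u \<xi> * fourier_torus f \<xi> * wave \<xi> x * \<sigma> x \<xi>))\<^sup>2) \<partial>lborel)
    \<le> ennreal (2 * (1 + ((8 * pi) ^ (2 * M) * real (card (reduction_index (2 * M) :: ('n \<times> nat \<times> nat) set)))\<^sup>2) *
        4 ^ CARD('n) * ((A * U)\<^sup>2 * coefficient_bound S (2 * M) s r f c))"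
proof -
  let ?B = "cube b s" and ?T = "reduction_index (2 * M) :: ('n \<times> nat \<times> nat) set"
  let ?E = "coefficient_bound S (2 * M) s r f c"
  let ?k = "(8 * pi) ^ (2 * M)"
  define X where "X = 4 ^ CARD('n) * ((A * U)\<^sup>2 * ?E)"
  have X: "0 \<le> X" by (simp add: X_def coefficient_bound_nonneg)
  define G0 where "G0 x = (\<Sum>\<xi>\<in>S. (u \<xi> * fourier_torus (weighted_part (2 * M) s c f) \<xi>) * wave \<xi> x * \<sigma> x \<xi>)" for x
  define G where "G t x = (\<Sum>\<xi>\<in>S. reduced_coefficient M s c f u t \<xi> * wave \<xi> x * (difference (fst t) ^^ snd (snd t)) (\<sigma> x) \<xi>)" for t x
  define w where "w t = ?k * (1 / s) ^ fst (snd t)" for t :: "'n \<times> nat \<times> nat"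
  have meas0 [measurable]: "G0 \<in> borel_measurable borel"
    unfolding G0_def
    by (intro continuous_borel_measurable continuous_intros smooth_continuous smooth)
  have meas1 [measurable]: "G t \<in> borel_measurable borel" for t
    unfolding G_def
    by (intro continuous_borel_measurable continuous_intros smooth_continuous smooth_difference_funpow smooth)
  have Bm [measurable]: "?B \<in> sets borel" by simp
  have int0: "(\<integral>\<^sup>+x\<in>?B. ennreal ((cmod (G0 x))\<^sup>2) \<partial>lborel) \<le> ennreal X"
  proof -
    have "(\<integral>\<^sup>+x\<in>?B. ennreal ((cmod (G0 x))\<^sup>2) \<partial>lborel)
       \<le> ennreal (4 ^ CARD('n) * A\<^sup>2 * (\<Sum>\<xi>\<in>S. (cmod (u \<xi> * fourier_torus (weighted_part (2 * M) s c f) \<xi>))\<^sup>2))"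
      unfolding G0_def
    proof (rule local_L2_bound[OF smooth S s A])
      fix J \<xi> x assume "\<xi> \<in> S"
      then show "cmod (foldr partial (filter (\<lambda>i. i \<in> J) coord_list) (\<lambda>x. \<sigma> x \<xi>) x) \<le> A / s ^ card J"
        using sigma[of \<xi> 0 J _ x] by simp
    qed
    also have "\<dots> \<le> ennreal X"
    proof (rule ennreal_leI)
      have "(\<Sum>\<xi>\<in>S. (cmod (u \<xi> * fourier_torus (weighted_part (2 * M) s c f) \<xi>))\<^sup>2)
         \<le> (\<Sum>\<xi>\<in>S. U\<^sup>2 * (cmod (fourier_torus (weighted_part (2 * M) s c f) \<xi>))\<^sup>2)"
        using u[of 0] unfolding norm_mult power_mult_distrib[symmetric]
        by (intro sum_mono power_mono mult_right_mono) auto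
      also have "\<dots> = U\<^sup>2 * (\<Sum>\<xi>\<in>S. (cmod (fourier_torus (weighted_part (2 * M) s c f) \<xi>))\<^sup>2)"
        by (simp add: sum_distrib_left)
      also have "\<dots> \<le> U\<^sup>2 * ?E"
        by (intro mult_left_mono weighted_part_coefficients f s S r) auto
      finally show "4 ^ CARD('n) * A\<^sup>2 * (\<Sum>\<xi>\<in>S. (cmod (u \<xi> * fourier_torus (weighted_part (2 * M) s c f) \<xi>))\<^sup>2) \<le> X"
        unfolding X_def power_mult_distrib mult.assoc by (intro mult_left_mono) auto
    qed
    finally show ?thesis .
  qed
  have int1: "(\<integral>\<^sup>+x\<in>?B. ennreal ((w t * cmod (G t x))\<^sup>2) \<partial>lborel) \<le> ennreal (?k\<^sup>2 * X)" if t: "t \<in> ?T" for t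
  proof -
    obtain j i l where jil: "t = (j, i, l)" "i \<le> 2 * M" "l \<le> i"
      using t by (auto simp: reduction_index_def)
    have "L2_mass (G t) ?B
       \<le> ennreal (4 ^ CARD('n) * (A * s ^ l)\<^sup>2 * (\<Sum>\<xi>\<in>S. (cmod (reduced_coefficient M s c f u t \<xi>))\<^sup>2))"
      unfolding G_def jil fst_conv snd_conv
    proof (rule local_L2_bound[OF smooth_difference_funpow[OF smooth] S s])
      show "0 \<le> A * s ^ l" using A s by simp
      fix J \<xi> x assume "\<xi> \<in> S"
      then show "cmod (foldr partial (filter (\<lambda>i. i \<in> J) coord_list) (\<lambda>x. (difference j ^^ l) (\<sigma> x) \<xi>) x) \<le> A * s ^ l / s ^ card J"
        using sigma[of \<xi> l J j x] jil by simp
    qed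
    also have "\<dots> \<le> ennreal (s ^ (2 * i) * X)"
    proof (rule ennreal_leI)
      have "4 ^ CARD('n) * (A * s ^ l)\<^sup>2 * (\<Sum>\<xi>\<in>S. (cmod (reduced_coefficient M s c f u t \<xi>))\<^sup>2)
         \<le> 4 ^ CARD('n) * (A * s ^ l)\<^sup>2 * ((U * s ^ (i - l))\<^sup>2 * ?E)"
        using reduced_coefficient_sum[OF f s(1) S r t u U, where c = c] jil by (intro mult_left_mono) auto
      also have "\<dots> = (s ^ l * s ^ (i - l))\<^sup>2 * X"
        by (simp add: X_def power_mult_distrib mult_ac)
      also have "(s ^ l * s ^ (i - l))\<^sup>2 = s ^ (2 * i)"
        using jil by (simp add: power_add[symmetric] power_mult[symmetric] mult.commute)
      finally show "4 ^ CARD('n) * (A * s ^ l)\<^sup>2 * (\<Sum>\<xi>\<in>S. (cmod (reduced_coefficient M s c f u t \<xi>))\<^sup>2) \<le> s ^ (2 * i) * X" .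
    qed
    finally have le: "L2_mass (G t) ?B \<le> ennreal (s ^ (2 * i) * X)" .
    have "(\<integral>\<^sup>+x\<in>?B. ennreal ((w t * cmod (G t x))\<^sup>2) \<partial>lborel)
       = (\<integral>\<^sup>+x. ennreal ((w t)\<^sup>2) * (ennreal ((cmod (G t x))\<^sup>2) * indicator ?B x) \<partial>lborel)"
      by (simp add: power_mult_distrib ennreal_mult mult.assoc)
    also have "\<dots> = ennreal ((w t)\<^sup>2) * L2_mass (G t) ?B"
      by (rule nn_integral_cmult) measurable
    also have "\<dots> \<le> ennreal ((w t)\<^sup>2) * ennreal (s ^ (2 * i) * X)"
      by (intro mult_left_mono le) auto
    also have "\<dots> = ennreal ((w t)\<^sup>2 * (s ^ (2 * i) * X))"
      by (rule ennreal_mult[symmetric]) (use s X in auto)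
    also have "(w t)\<^sup>2 * (s ^ (2 * i) * X) = ?k\<^sup>2 * X"
    proof -
      have "((1 / s) ^ i)\<^sup>2 * s ^ (2 * i) = 1"
        using s by (simp add: power_divide power_mult[symmetric] mult.commute)
      then have "?k\<^sup>2 * (((1 / s) ^ i)\<^sup>2 * s ^ (2 * i)) * X = ?k\<^sup>2 * X" by simp
      then show ?thesis by (simp only: w_def jil fst_conv snd_conv power_mult_distrib mult_ac)
    qed
    finally show ?thesis .
  qed
  let ?c = "real (card ?T)"
  have "(\<integral>\<^sup>+x\<in>?B. ennreal ((cmod (\<Sum>\<xi>\<in>S. u \<xi> * fourier_torus f \<xi> * wave \<xi> x * \<sigma> x \<xi>))\<^sup>2) \<partial>lborel)
     \<le> (\<integral>\<^sup>+x. 2 * (ennreal ((cmod (G0 x))\<^sup>2) * indicator ?B x)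
          + ennreal (2 * ?c) * (\<Sum>t\<in>?T. ennreal ((w t * cmod (G t x))\<^sup>2) * indicator ?B x) \<partial>lborel)"
  proof (rule nn_integral_mono)
    fix x
    show "ennreal ((cmod (\<Sum>\<xi>\<in>S. u \<xi> * fourier_torus f \<xi> * wave \<xi> x * \<sigma> x \<xi>))\<^sup>2) * indicator ?B x
      \<le> 2 * (ennreal ((cmod (G0 x))\<^sup>2) * indicator ?B x)
          + ennreal (2 * ?c) * (\<Sum>t\<in>?T. ennreal ((w t * cmod (G t x))\<^sup>2) * indicator ?B x)"
    proof (cases "x \<in> ?B")
      case True
      have near: "\<bar>x $ j - c $ j\<bar> \<le> s" for j
      proof -
        have "b $ j \<le> x $ j \<and> x $ j \<le> b $ j + s" "b $ j \<le> c $ j \<and> c $ j \<le> b $ j + s"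
          using True c by (auto simp: mem_box_cart)
        then show ?thesis by linarith
      qed
      let ?g = "\<Sum>t\<in>?T. w t * cmod (G t x)"
      have "cmod (\<Sum>\<xi>\<in>S. u \<xi> * fourier_torus f \<xi> * wave \<xi> x * \<sigma> x \<xi>) \<le> cmod (G0 x) + ?g"
        using weighted_reduction_index[OF S supp s(1) near f M, where v = "\<sigma> x"]
        by (simp add: G0_def G_def w_def mult.assoc)
      then have "(cmod (\<Sum>\<xi>\<in>S. u \<xi> * fourier_torus f \<xi> * wave \<xi> x * \<sigma> x \<xi>))\<^sup>2 \<le> (cmod (G0 x) + ?g)\<^sup>2"
        by (intro power_mono) auto
      also have "\<dots> \<le> 2 * (cmod (G0 x))\<^sup>2 + 2 * ?g\<^sup>2"
        using sum_squares_bound[of "cmod (G0 x)" ?g] by (simp add: power2_sum)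
      also have "\<dots> \<le> 2 * (cmod (G0 x))\<^sup>2 + 2 * ((\<Sum>t\<in>?T. (w t * cmod (G t x))\<^sup>2) * ?c)"
        by (intro add_mono mult_left_mono sum_squared_le_sum_of_squares) auto
      also have "\<dots> = 2 * (cmod (G0 x))\<^sup>2 + (2 * ?c) * (\<Sum>t\<in>?T. (w t * cmod (G t x))\<^sup>2)"
        by simp
      finally have "ennreal ((cmod (\<Sum>\<xi>\<in>S. u \<xi> * fourier_torus f \<xi> * wave \<xi> x * \<sigma> x \<xi>))\<^sup>2)
         \<le> ennreal (2 * (cmod (G0 x))\<^sup>2 + (2 * ?c) * (\<Sum>t\<in>?T. (w t * cmod (G t x))\<^sup>2))"
        by (rule ennreal_leI)
      also have "\<dots> = 2 * ennreal ((cmod (G0 x))\<^sup>2) + ennreal (2 * ?c) * (\<Sum>t\<in>?T. ennreal ((w t * cmod (G t x))\<^sup>2))"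
        by (subst ennreal_plus) (auto simp: ennreal_mult sum_ennreal sum_nonneg)
      finally show ?thesis using True by simp
    qed simp
  qed
  also have "\<dots> = 2 * (\<integral>\<^sup>+x\<in>?B. ennreal ((cmod (G0 x))\<^sup>2) \<partial>lborel)
      + ennreal (2 * ?c) * (\<Sum>t\<in>?T. (\<integral>\<^sup>+x\<in>?B. ennreal ((w t * cmod (G t x))\<^sup>2) \<partial>lborel))"
  proof -
    let ?p = "\<lambda>x. ennreal ((cmod (G0 x))\<^sup>2) * indicator ?B x"
    let ?q = "\<lambda>t x. ennreal ((w t * cmod (G t x))\<^sup>2) * indicator ?B x"
    have 1: "(\<integral>\<^sup>+x. 2 * ?p x + ennreal (2 * ?c) * (\<Sum>t\<in>?T. ?q t x) \<partial>lborel)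
        = (\<integral>\<^sup>+x. 2 * ?p x \<partial>lborel) + (\<integral>\<^sup>+x. ennreal (2 * ?c) * (\<Sum>t\<in>?T. ?q t x) \<partial>lborel)"
      by (rule nn_integral_add) measurable
    have 2: "(\<integral>\<^sup>+x. 2 * ?p x \<partial>lborel) = 2 * (\<integral>\<^sup>+x. ?p x \<partial>lborel)"
      by (rule nn_integral_cmult) measurable
    have 3: "(\<integral>\<^sup>+x. ennreal (2 * ?c) * (\<Sum>t\<in>?T. ?q t x) \<partial>lborel)
        = ennreal (2 * ?c) * (\<integral>\<^sup>+x. (\<Sum>t\<in>?T. ?q t x) \<partial>lborel)"
      by (rule nn_integral_cmult) measurable
    have 4: "(\<integral>\<^sup>+x. (\<Sum>t\<in>?T. ?q t x) \<partial>lborel) = (\<Sum>t\<in>?T. (\<integral>\<^sup>+x. ?q t x \<partial>lborel))"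
      by (rule nn_integral_sum) measurable
    show ?thesis by (simp only: 1 2 3 4)
  qed
  also have "\<dots> \<le> 2 * ennreal X + ennreal (2 * ?c) * (\<Sum>t\<in>?T. ennreal (?k\<^sup>2 * X))"
    by (intro add_mono mult_left_mono sum_mono int0 int1) auto
  also have "\<dots> = ennreal (2 * X + (2 * ?c) * (?c * (?k\<^sup>2 * X)))"
  proof -
    have "(\<Sum>t\<in>?T. ennreal (?k\<^sup>2 * X)) = ennreal (?c * (?k\<^sup>2 * X))"
      using X by (subst sum_ennreal) auto
    moreover have "2 * ennreal p + ennreal q * ennreal r = ennreal (2 * p + q * r)"
      if "0 \<le> p" "0 \<le> q" "0 \<le> r" for p q r
      using that by (simp add: ennreal_mult ennreal_plus)
    ultimately show ?thesis using X by simp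
  qed
  also have "2 * X + (2 * ?c) * (?c * (?k\<^sup>2 * X)) = 2 * (1 + (?k * ?c)\<^sup>2) * X"
    by (simp add: power2_eq_square algebra_simps)
  finally show ?thesis by (simp only: X_def mult.assoc)
qed


section \<open>Dyadic pieces\<close>

lemma wave_has_vector_derivative:
  "((\<lambda>t. wave \<xi> (z + t *\<^sub>R axis i 1)) has_vector_derivative (2 * pi * \<i> * of_int (\<xi> $ i)) * wave \<xi> z) (at 0)"
proof -
  let ?a = "2 * pi * (z \<bullet> real_vec \<xi>)" and ?b = "2 * pi * real_of_int (\<xi> $ i)"
  have "((\<lambda>w. exp (\<i> * (of_real ?a + of_real ?b * w))) has_field_derivative
      exp (\<i> * (of_real ?a + of_real ?b * of_real 0)) * (\<i> * of_real ?b)) (at (of_real 0))"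
    by (auto intro!: derivative_eq_intros)
  from has_vector_derivative_real_field[OF this]
  have "((\<lambda>t. exp (\<i> * (of_real ?a + of_real ?b * of_real t))) has_vector_derivative
      exp (\<i> * (of_real ?a + of_real ?b * of_real 0)) * (\<i> * of_real ?b)) (at 0)" .
  moreover have "wave \<xi> (z + t *\<^sub>R axis i 1) = exp (\<i> * (of_real ?a + of_real ?b * of_real t))" for t
    by (simp add: wave_def cis_conv_exp inner_add_left inner_axis' real_vec_def algebra_simps)
  ultimately show ?thesis
    by (simp add: wave_def[of _ z] cis_conv_exp mult_ac)
qed

lemma wave_differentiable: "wave (\<xi> :: int ^ 'a::finite) differentiable_on UNIV"
proof -
  have "((\<lambda>x. \<i> * complex_of_real (2 * pi * (x \<bullet> real_vec \<xi>))) has_derivative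
      (\<lambda>h. \<i> * complex_of_real (2 * pi * (h \<bullet> real_vec \<xi>)))) (at x)" for x :: "real ^ 'a"
    by (auto intro!: derivative_eq_intros)
  from has_derivative_compose[OF this DERIV_exp[unfolded has_field_derivative_def]]
  have "(\<lambda>x. exp (\<i> * complex_of_real (2 * pi * (x \<bullet> real_vec \<xi>)))) differentiable (at x)" for x :: "real ^ 'a"
    unfolding differentiable_def by blast
  then show ?thesis
    by (simp add: differentiable_on_def wave_def[abs_def] cis_conv_exp)
qed

lemma partial_wave_sum:
  assumes S: "finite S" and d: "\<And>\<xi>. (\<lambda>x. \<sigma> x \<xi>) differentiable_on UNIV"
  shows "partial i (\<lambda>y. \<Sum>\<xi>\<in>S. p \<xi> * c \<xi> * wave \<xi> y * \<sigma> y \<xi>) z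
    = 2 * pi * \<i> * (\<Sum>\<xi>\<in>S. (p \<xi> * of_int (\<xi> $ i)) * c \<xi> * wave \<xi> z * \<sigma> z \<xi>)
      + (\<Sum>\<xi>\<in>S. p \<xi> * c \<xi> * wave \<xi> z * partial i (\<lambda>y. \<sigma> y \<xi>) z)"
proof (rule partial_eqI)
  have "((\<lambda>t. p \<xi> * c \<xi> * (wave \<xi> (z + t *\<^sub>R axis i 1) * \<sigma> (z + t *\<^sub>R axis i 1) \<xi>)) has_vector_derivative
      p \<xi> * c \<xi> * (wave \<xi> (z + 0 *\<^sub>R axis i 1) * partial i (\<lambda>y. \<sigma> y \<xi>) z
        + ((2 * pi * \<i> * of_int (\<xi> $ i)) * wave \<xi> z) * \<sigma> (z + 0 *\<^sub>R axis i 1) \<xi>)) (at 0)" for \<xi>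
    by (intro has_vector_derivative_mult_right has_vector_derivative_mult wave_has_vector_derivative
        partial_has_vector_derivative_0[OF d])
  from has_vector_derivative_sum[of S, OF this]
  have "((\<lambda>t. \<Sum>\<xi>\<in>S. p \<xi> * c \<xi> * (wave \<xi> (z + t *\<^sub>R axis i 1) * \<sigma> (z + t *\<^sub>R axis i 1) \<xi>)) has_vector_derivative
      (\<Sum>\<xi>\<in>S. p \<xi> * c \<xi> * (wave \<xi> (z + 0 *\<^sub>R axis i 1) * partial i (\<lambda>y. \<sigma> y \<xi>) z
        + ((2 * pi * \<i> * of_int (\<xi> $ i)) * wave \<xi> z) * \<sigma> (z + 0 *\<^sub>R axis i 1) \<xi>))) (at 0)" .
  then show "((\<lambda>t. \<Sum>\<xi>\<in>S. p \<xi> * c \<xi> * wave \<xi> (z + t *\<^sub>R axis i 1) * \<sigma> (z + t *\<^sub>R axis i 1) \<xi>) has_vector_derivative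
     2 * pi * \<i> * (\<Sum>\<xi>\<in>S. (p \<xi> * of_int (\<xi> $ i)) * c \<xi> * wave \<xi> z * \<sigma> z \<xi>)
      + (\<Sum>\<xi>\<in>S. p \<xi> * c \<xi> * wave \<xi> z * partial i (\<lambda>y. \<sigma> y \<xi>) z)) (at 0)"
    by (simp add: distrib_left sum.distrib sum_distrib_left mult_ac add.commute)
qed

definition dyadic_piece ::
  "nat \<Rightarrow> (real ^ 'n::finite \<Rightarrow> int ^ 'n \<Rightarrow> complex) \<Rightarrow> (real ^ 'n \<Rightarrow> complex) \<Rightarrow> nat \<Rightarrow> real ^ 'n \<Rightarrow> complex" where
  "dyadic_piece N \<sigma> f k x = (\<Sum>\<xi>\<in>shell N k. shell_cutoff N k \<xi> * fourier_torus f \<xi> * wave \<xi> x * \<sigma> x \<xi>)"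

text \<open>
  Here the order \<open>m\<close> enters. It is such that \<open>2 m + n (2 / r - 1) \<le> - n + 2 n \<rho> / r\<close>, and the
  last summand is the normalisation \<open>s ^ n\<close> of the mass. In the applications \<open>P\<close> is \<open>2 ^ k\<close>, \<open>NS\<close>
  the number of frequencies in the shell, and \<open>H\<close> the mass.
\<close>
lemma exponent_bookkeeping:
  fixes n :: nat and P \<kappa> m \<rho> r H NS :: real
  assumes P: "1 \<le> P" and \<kappa>: "1 \<le> \<kappa>" and r: "1 < r" "r \<le> 2" and m: "m \<le> - real n * (1 - \<rho>) / r"
    and H: "0 \<le> H" and NS: "0 \<le> NS" "NS \<le> (\<kappa> * P) ^ n"
  defines "s \<equiv> P powr (- \<rho>)"
  shows "(P powr m)\<^sup>2 * (NS powr (2 / r - 1) * H powr (2 / r))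
      \<le> \<kappa> powr (real n * (2 / r - 1)) * ((1 / P) ^ n * (H / s ^ n) powr (2 / r))"
    and "P powr m * sqrt (NS * (4 * NS powr (2 / r - 1) * H powr (2 / r)))
      \<le> 2 * \<kappa> powr (real n / r) * (H / s ^ n) powr (1 / r)"
proof -
  have P0: "0 < P" and \<kappa>0: "0 < \<kappa>" using P \<kappa> by auto
  have sn: "s ^ n = P powr (- (\<rho> * n))"
    using P0 unfolding s_def by (subst powr_power) (auto simp: mult.commute)
  have Hs: "(H / s ^ n) powr q = H powr q * P powr (\<rho> * n * q)" for q
  proof -
    have "H / s ^ n = H * P powr (\<rho> * n)" unfolding sn by (simp add: powr_minus_divide)
    then show ?thesis using H by (simp add: powr_mult powr_powr)
  qed
  have NSq: "NS powr q \<le> \<kappa> powr (n * q) * P powr (n * q)" if "0 \<le> q" for q :: real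
  proof -
    have "NS powr q \<le> ((\<kappa> * P) ^ n) powr q" using that NS by (intro powr_mono2) auto
    also have "(\<kappa> * P) ^ n = (\<kappa> * P) powr n" using P0 \<kappa>0 by (simp add: powr_realpow)
    finally show ?thesis using P0 \<kappa>0 by (simp add: powr_powr powr_mult)
  qed
  have r2: "0 \<le> 2 / r - 1" using r by (simp add: field_simps)
  have e1: "2 * m + n * (2 / r - 1) \<le> - n + \<rho> * n * (2 / r)"
  proof -
    have "2 * m \<le> 2 * (- real n * (1 - \<rho>) / r)" using m by simp
    also have "\<dots> = - n * (2 / r) + \<rho> * n * (2 / r)" using r by (simp add: field_simps)
    finally show ?thesis by (simp add: algebra_simps)
  qed
  have "(P powr m)\<^sup>2 * (NS powr (2 / r - 1) * H powr (2 / r))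
     \<le> (P powr m)\<^sup>2 * ((\<kappa> powr (n * (2 / r - 1)) * P powr (n * (2 / r - 1))) * H powr (2 / r))"
    by (rule mult_left_mono[OF mult_right_mono[OF NSq[OF r2]]]) auto
  also have "\<dots> = \<kappa> powr (n * (2 / r - 1)) * (P powr (2 * m + n * (2 / r - 1)) * H powr (2 / r))"
  proof -
    have "(P powr m)\<^sup>2 = P powr (2 * m)" using P0 by (simp add: power2_eq_square powr_add[symmetric])
    then show ?thesis by (simp add: powr_add)
  qed
  also have "\<dots> \<le> \<kappa> powr (n * (2 / r - 1)) * (P powr (- n + \<rho> * n * (2 / r)) * H powr (2 / r))"
    using P e1 by (intro mult_left_mono mult_right_mono powr_mono) auto
  also have "\<dots> = \<kappa> powr (n * (2 / r - 1)) * ((1 / P) ^ n * (H / s ^ n) powr (2 / r))"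
  proof -
    have "(1 / P) ^ n = P powr (- n)"
      using P0 by (simp add: powr_minus_divide powr_realpow power_divide)
    moreover have "P powr (- n + \<rho> * n * (2 / r)) = P powr (- n) * P powr (\<rho> * n * (2 / r))"
      by (rule powr_add)
    ultimately show ?thesis by (simp only: Hs mult_ac)
  qed
  finally show "(P powr m)\<^sup>2 * (NS powr (2 / r - 1) * H powr (2 / r))
      \<le> \<kappa> powr (n * (2 / r - 1)) * ((1 / P) ^ n * (H / s ^ n) powr (2 / r))" .
  have e2: "m + n * (1 / r) \<le> \<rho> * n * (1 / r)"
  proof -
    have "m + n * (1 / r) \<le> (- real n * (1 - \<rho>) / r) + n * (1 / r)" using m by simp
    also have "\<dots> = \<rho> * n * (1 / r)" using r by (simp add: field_simps)
    finally show ?thesis .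
  qed
  have "NS * (4 * NS powr (2 / r - 1) * H powr (2 / r)) = (2 * (NS powr (1 / r) * H powr (1 / r)))\<^sup>2"
  proof (cases "NS = 0")
    case False
    then have "NS * NS powr (2 / r - 1) = NS powr (2 / r)"
      using NS powr_add[of NS 1 "2 / r - 1"] by simp
    moreover have "(NS powr (1 / r))\<^sup>2 = NS powr (2 / r)" "(H powr (1 / r))\<^sup>2 = H powr (2 / r)"
      by (simp_all add: power2_eq_square powr_add[symmetric])
    ultimately show ?thesis by (simp add: power_mult_distrib)
  qed simp
  then have "sqrt (NS * (4 * NS powr (2 / r - 1) * H powr (2 / r))) = 2 * (NS powr (1 / r) * H powr (1 / r))"
    by (simp only: real_sqrt_abs) (simp add: abs_mult)
  then have "P powr m * sqrt (NS * (4 * NS powr (2 / r - 1) * H powr (2 / r))) = 2 * (P powr m * (NS powr (1 / r) * H powr (1 / r)))"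
    by simp
  also have "\<dots> \<le> 2 * (P powr m * ((\<kappa> powr (n * (1 / r)) * P powr (n * (1 / r))) * H powr (1 / r)))"
    using r by (intro mult_left_mono mult_right_mono NSq) auto
  also have "\<dots> = 2 * \<kappa> powr (n / r) * (P powr (m + n * (1 / r)) * H powr (1 / r))"
    by (simp add: powr_add)
  also have "\<dots> \<le> 2 * \<kappa> powr (n / r) * (P powr (\<rho> * n * (1 / r)) * H powr (1 / r))"
    using P e2 by (intro mult_left_mono mult_right_mono powr_mono) auto
  also have "\<dots> = 2 * \<kappa> powr (n / r) * (H / s ^ n) powr (1 / r)"
    unfolding Hs by (simp add: mult_ac)
  finally show "P powr m * sqrt (NS * (4 * NS powr (2 / r - 1) * H powr (2 / r)))
      \<le> 2 * \<kappa> powr (n / r) * (H / s ^ n) powr (1 / r)" .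
qed

lemma shell_cutoff_scale_bound:
  assumes "\<rho> \<le> 1" "i \<le> N"
  shows "cmod ((difference j ^^ i) (shell_cutoff N k) \<xi>) \<le> (2 * 4 ^ N) * dyadic_scale \<rho> k ^ i"
proof -
  have "cmod ((difference j ^^ i) (shell_cutoff N k) \<xi>) \<le> 2 * (4 / 2 ^ k) ^ i"
    by (rule shell_cutoff_difference_bound[OF assms(2)])
  also have "\<dots> = 2 * 4 ^ i * (1 / 2 ^ k) ^ i" by (simp add: power_divide)
  also have "\<dots> \<le> (2 * 4 ^ N) * dyadic_scale \<rho> k ^ i"
    using assms inverse_le_dyadic_scale[OF assms(1), of k]
    by (intro mult_mono power_mono mult_left_mono power_increasing) auto
  finally show ?thesis .
qed

lemma shell_cutoff_coordinate_scale_bound: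
  assumes "\<rho> \<le> 1" "i \<le> N"
  shows "cmod ((difference j ^^ i) (\<lambda>\<eta>. shell_cutoff N k \<eta> * of_int (\<eta> $ j')) \<xi>)
    \<le> (2 * (4 * real N + 1) * 4 ^ N * 2 ^ k) * dyadic_scale \<rho> k ^ i"
proof (rule order_trans[OF shell_cutoff_coordinate_difference_bound[OF assms(2)]])
  show "(2 * (4 * real N + 1) * 4 ^ N * 2 ^ k) * (1 / 2 ^ k) ^ i
     \<le> (2 * (4 * real N + 1) * 4 ^ N * 2 ^ k) * dyadic_scale \<rho> k ^ i"
    using inverse_le_dyadic_scale[OF assms(1), of k] by (intro mult_left_mono power_mono) auto
qed

lemma filter_singleton_coord: "filter (\<lambda>i'. i' \<in> {i}) coord_list = [i]"
proof -
  have "filter (\<lambda>i'. i' \<in> {i}) js = (if i \<in> set js then [i] else [])" if "distinct js" for js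
    using that by (induction js) auto
  then show ?thesis using coord_list by (simp add: coord_list)
qed

lemma symbol_smooth: "\<sigma> \<in> symbol_class m \<rho> \<delta> \<Longrightarrow> smooth (\<lambda>x. \<sigma> x \<xi>)"
  by (simp add: symbol_class_def smooth_torus_def)

text \<open>
  The power \<open>N\<close> in the weight is the one of \<open>weight_dominates\<close>. It is also the number of
  differences that the cutoffs and the symbol have to admit.
\<close>
lemma dyadic_piece_local_L2:
  fixes \<sigma> :: "real ^ 'n::finite \<Rightarrow> int ^ 'n \<Rightarrow> complex"
  assumes r: "1 < r" "r \<le> 2" and \<rho>: "0 < \<rho>" "\<rho> < 1" and m: "m \<le> - real CARD('n) * (1 - \<rho>) / r"
    and \<sigma>: "\<sigma> \<in> symbol_class m \<rho> \<rho>"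
  defines "N \<equiv> 4 * CARD('n)"
  obtains C where "0 \<le> C"
    "\<And>f k b c. continuous_on UNIV f \<Longrightarrow> c \<in> cube b (dyadic_scale \<rho> k) \<Longrightarrow>
      L2_mass (dyadic_piece N \<sigma> f k) (cube b (dyadic_scale \<rho> k))
      \<le> ennreal (C * ((1 / 2 ^ k) ^ CARD('n) * (weighted_mass_real N (dyadic_scale \<rho> k) r f c / dyadic_scale \<rho> k ^ CARD('n)) powr (2 / r)))"
proof -
  let ?n = "CARD('n)"
  define M where "M = 2 * CARD('n)"
  have N: "N = 2 * M" "even M" by (simp_all add: N_def M_def)
  obtain A0 where A0: "0 \<le> A0" and sym: "\<And>k \<xi> l j J x. \<xi> \<in> shell N k \<Longrightarrow> l \<le> N \<Longrightarrow>
      cmod (foldr partial (filter (\<lambda>i. i \<in> J) coord_list) (\<lambda>y. (difference j ^^ l) (\<sigma> y) \<xi>) x)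
      \<le> A0 * (2 ^ k) powr m * dyadic_scale \<rho> k ^ l / dyadic_scale \<rho> k ^ card J"
    using symbol_shell_bound[OF \<sigma>, of N] \<rho> by auto
  define U :: real where "U = 2 * 4 ^ N"
  define K where "K = 2 * (1 + ((8 * pi) ^ (2 * M) * real (card (reduction_index (2 * M) :: ('n \<times> nat \<times> nat) set)))\<^sup>2) * 4 ^ ?n"
  define \<kappa> where "\<kappa> = 4 * real N + 3"
  define C where "C = K * (A0\<^sup>2 * U\<^sup>2 * 4) * \<kappa> powr (real ?n * (2 / r - 1))"
  have K: "0 \<le> K" by (simp add: K_def)
  show ?thesis
  proof
    show "0 \<le> C" using K by (simp add: C_def)
    fix f :: "real ^ 'n \<Rightarrow> complex" and k :: nat and b c :: "real ^ 'n"
    assume f: "continuous_on UNIV f" and c: "c \<in> cube b (dyadic_scale \<rho> k)"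
    let ?s = "dyadic_scale \<rho> k" and ?S = "shell N k :: (int ^ 'n) set" and ?P = "(2::real) ^ k"
    let ?H = "weighted_mass_real N ?s r f c"
    have "(\<integral>\<^sup>+x\<in>cube b ?s. ennreal ((cmod (\<Sum>\<xi>\<in>?S. shell_cutoff N k \<xi> * fourier_torus f \<xi> * wave \<xi> x * \<sigma> x \<xi>))\<^sup>2) \<partial>lborel)
      \<le> ennreal (2 * (1 + ((8 * pi) ^ (2 * M) * real (card (reduction_index (2 * M) :: ('n \<times> nat \<times> nat) set)))\<^sup>2) *
        4 ^ CARD('n) * ((A0 * ?P powr m * U)\<^sup>2 * coefficient_bound ?S (2 * M) ?s r f c))"
    proof (rule weighted_L2_bound)
      show "\<xi> \<in> ?S" if "a \<le> 2 * M" "shell_cutoff N k (\<xi> + axis j (int a)) \<noteq> 0" for \<xi> j a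
        using shell_cutoff_support[OF that(2)] that(1) N by simp
      show "?s \<le> 1" using \<rho> by (intro dyadic_scale_le_1) simp
      show "cmod ((difference j ^^ i) (shell_cutoff N k) \<xi>) \<le> U * ?s ^ i" if "i \<le> 2 * M" for i j and \<xi> :: "int ^ 'n"
        unfolding U_def by (rule shell_cutoff_scale_bound) (use that N \<rho> in auto)
      show "cmod (foldr partial (filter (\<lambda>i. i \<in> J) coord_list) (\<lambda>y. (difference j ^^ l) (\<sigma> y) \<xi>) x)
        \<le> A0 * ?P powr m * ?s ^ l / ?s ^ card J" if "\<xi> \<in> ?S" "l \<le> 2 * M" for \<xi> l j J x
        using sym[OF that(1)] that(2) N by simp
    qed (use f c r N A0 dyadic_scale_pos symbol_smooth[OF \<sigma>] in \<open>auto simp: U_def\<close>)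
    also have "\<dots> \<le> ennreal (C * ((1 / ?P) ^ ?n * (?H / ?s ^ ?n) powr (2 / r)))"
    proof (rule ennreal_leI)
      have "K * ((A0 * ?P powr m * U)\<^sup>2 * coefficient_bound ?S N ?s r f c)
         = K * (A0\<^sup>2 * U\<^sup>2 * 4) * ((?P powr m)\<^sup>2 * (real (card ?S) powr (2 / r - 1) * ?H powr (2 / r)))"
        by (simp add: coefficient_bound_def power_mult_distrib mult_ac)
      also have "\<dots> \<le> K * (A0\<^sup>2 * U\<^sup>2 * 4) * (\<kappa> powr (real ?n * (2 / r - 1)) * ((1 / ?P) ^ ?n * (?H / ?s ^ ?n) powr (2 / r)))"
        unfolding dyadic_scale_def using K r m card_shell_le[of N k]
        by (intro mult_left_mono exponent_bookkeeping(1)) (auto simp: \<kappa>_def weighted_mass_real_nonneg)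
      finally show "2 * (1 + ((8 * pi) ^ (2 * M) * real (card (reduction_index (2 * M) :: ('n \<times> nat \<times> nat) set)))\<^sup>2) *
        4 ^ CARD('n) * ((A0 * ?P powr m * U)\<^sup>2 * coefficient_bound ?S (2 * M) ?s r f c)
        \<le> C * ((1 / ?P) ^ ?n * (?H / ?s ^ ?n) powr (2 / r))"
        by (simp add: K_def C_def N mult.assoc)
    qed
    finally show "L2_mass (dyadic_piece N \<sigma> f k) (cube b (dyadic_scale \<rho> k))
      \<le> ennreal (C * ((1 / 2 ^ k) ^ ?n * (?H / ?s ^ ?n) powr (2 / r)))"
      by (simp only: dyadic_piece_def)
  qed
qed

text \<open>
  A derivative falls either on the wave, which gives a coordinate of the frequency, absorbed in
  the cutoff at the price \<open>2 ^ k\<close>, or on the symbol, which costs \<open>1 / s \<le> 2 ^ k\<close>.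
\<close>
lemma dyadic_piece_gradient:
  fixes \<sigma> :: "real ^ 'n::finite \<Rightarrow> int ^ 'n \<Rightarrow> complex"
  assumes r: "1 < r" "r \<le> 2" and \<rho>: "0 < \<rho>" "\<rho> < 1" and m: "m \<le> - real CARD('n) * (1 - \<rho>) / r"
    and \<sigma>: "\<sigma> \<in> symbol_class m \<rho> \<rho>"
  defines "N \<equiv> 4 * CARD('n)"
  obtains C where "0 \<le> C"
    "\<And>f k z c i. continuous_on UNIV f \<Longrightarrow> (\<And>j. \<bar>z $ j - c $ j\<bar> \<le> dyadic_scale \<rho> k) \<Longrightarrow>
      cmod (partial i (dyadic_piece N \<sigma> f k) z)
      \<le> C * (2 ^ k * (weighted_mass_real N (dyadic_scale \<rho> k) r f c / dyadic_scale \<rho> k ^ CARD('n)) powr (1 / r))"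
proof -
  let ?n = "CARD('n)"
  define M where "M = 2 * CARD('n)"
  have N: "N = 2 * M" "even M" by (simp_all add: N_def M_def)
  obtain A0 where A0: "0 \<le> A0" and sym: "\<And>k \<xi> l j J x. \<xi> \<in> shell N k \<Longrightarrow> l \<le> N \<Longrightarrow>
      cmod (foldr partial (filter (\<lambda>i. i \<in> J) coord_list) (\<lambda>y. (difference j ^^ l) (\<sigma> y) \<xi>) x)
      \<le> A0 * (2 ^ k) powr m * dyadic_scale \<rho> k ^ l / dyadic_scale \<rho> k ^ card J"
    using symbol_shell_bound[OF \<sigma>, of N] \<rho> by auto
  define U :: real where "U = 2 * 4 ^ N"
  define U1 :: real where "U1 = 2 * (4 * real N + 1) * 4 ^ N"
  define K where "K = 1 + real (card (reduction_index (2 * M) :: ('n \<times> nat \<times> nat) set)) * (8 * pi) ^ (2 * M)"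
  define \<kappa> where "\<kappa> = 4 * real N + 3"
  define C where "C = (2 * pi * U1 + U) * K * A0 * (2 * \<kappa> powr (real ?n / r))"
  have K: "0 \<le> K" by (simp add: K_def)
  have U: "0 \<le> U" "0 \<le> U1" by (simp_all add: U_def U1_def)
  have smooth: "smooth (\<lambda>x. \<sigma> x \<xi>)" for \<xi> by (rule symbol_smooth[OF \<sigma>])
  show ?thesis
  proof
    show "0 \<le> C" using K U A0 by (simp add: C_def)
    fix f :: "real ^ 'n \<Rightarrow> complex" and k :: nat and z c :: "real ^ 'n" and i
    assume f: "continuous_on UNIV f" and near: "\<And>j. \<bar>z $ j - c $ j\<bar> \<le> dyadic_scale \<rho> k"
    let ?s = "dyadic_scale \<rho> k" and ?S = "shell N k :: (int ^ 'n) set" and ?P = "(2::real) ^ k"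
    let ?H = "weighted_mass_real N ?s r f c"
    define R where "R = sqrt (real (card ?S) * coefficient_bound ?S (2 * M) ?s r f c)"
    have R: "0 \<le> R" by (simp add: R_def coefficient_bound_nonneg)
    have support: "\<xi> \<in> ?S" if "a \<le> 2 * M" "shell_cutoff N k (\<xi> + axis j (int a)) \<noteq> 0" for \<xi> j a
      using shell_cutoff_support[OF that(2)] that(1) N by simp
    have 1: "cmod (\<Sum>\<xi>\<in>?S. (shell_cutoff N k \<xi> * of_int (\<xi> $ i)) * fourier_torus f \<xi> * wave \<xi> z * \<sigma> z \<xi>)
      \<le> K * ((A0 * ?P powr m) * (U1 * ?P) * R)"
      unfolding K_def R_def
    proof (rule weighted_sup_bound[where u = "\<lambda>\<xi>. shell_cutoff N k \<xi> * of_int (\<xi> $ i)" and v = "\<sigma> z"])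
      show "\<xi> \<in> ?S" if "a \<le> 2 * M" "shell_cutoff N k (\<xi> + axis j (int a)) * of_int ((\<xi> + axis j (int a)) $ i) \<noteq> 0" for \<xi> j a
        using support[OF that(1)] that(2) by fastforce
      show "cmod ((difference j ^^ i') (\<lambda>\<xi>. shell_cutoff N k \<xi> * of_int (\<xi> $ i)) \<xi>) \<le> U1 * ?P * ?s ^ i'"
        if "i' \<le> 2 * M" for i' j and \<xi> :: "int ^ 'n"
        unfolding U1_def by (rule shell_cutoff_coordinate_scale_bound) (use that N \<rho> in auto)
      show "cmod ((difference j ^^ l) (\<sigma> z) \<xi>) \<le> A0 * ?P powr m * ?s ^ l" if "\<xi> \<in> ?S" "l \<le> 2 * M" for l j \<xi>
        using sym[OF that(1), of l "{}" j z] that(2) N by simp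
    qed (use f near r N A0 U dyadic_scale_pos in auto)
    have 2: "cmod (\<Sum>\<xi>\<in>?S. shell_cutoff N k \<xi> * fourier_torus f \<xi> * wave \<xi> z * partial i (\<lambda>y. \<sigma> y \<xi>) z)
      \<le> K * ((A0 * ?P powr m / ?s) * U * R)"
      unfolding K_def R_def
    proof (rule weighted_sup_bound[where v = "\<lambda>\<xi>. partial i (\<lambda>y. \<sigma> y \<xi>) z"])
      show "\<xi> \<in> ?S" if "a \<le> 2 * M" "shell_cutoff N k (\<xi> + axis j (int a)) \<noteq> 0" for \<xi> j a
        by (rule support[OF that])
      show "cmod ((difference j ^^ i) (shell_cutoff N k) \<xi>) \<le> U * ?s ^ i" if "i \<le> 2 * M" for i j and \<xi> :: "int ^ 'n"
        unfolding U_def by (rule shell_cutoff_scale_bound) (use that N \<rho> in auto)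
      show "cmod ((difference j ^^ l) (\<lambda>\<xi>. partial i (\<lambda>y. \<sigma> y \<xi>) z) \<xi>) \<le> A0 * ?P powr m / ?s * ?s ^ l"
        if "\<xi> \<in> ?S" "l \<le> 2 * M" for l j \<xi>
        using sym[OF that(1), of l "{i}" j z] that(2) N
        unfolding filter_singleton_coord
        by (simp add: partial_difference_funpow[OF smooth])
    qed (use f near r N A0 U dyadic_scale_pos in \<open>auto simp: less_imp_le\<close>)
    have sP: "1 / ?s \<le> ?P"
      using inverse_le_dyadic_scale[of \<rho> k] \<rho> dyadic_scale_pos[of \<rho> k] by (simp add: field_simps)
    have d: "(\<lambda>x. \<sigma> x \<xi>) differentiable_on UNIV" for \<xi>
      using smooth_foldr_differentiable[OF smooth, of "[]"] by simp
    have "cmod (partial i (dyadic_piece N \<sigma> f k) z)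
       \<le> 2 * pi * (K * ((A0 * ?P powr m) * (U1 * ?P) * R)) + K * ((A0 * ?P powr m / ?s) * U * R)"
    proof -
      have "partial i (dyadic_piece N \<sigma> f k) z
        = 2 * pi * \<i> * (\<Sum>\<xi>\<in>?S. (shell_cutoff N k \<xi> * of_int (\<xi> $ i)) * fourier_torus f \<xi> * wave \<xi> z * \<sigma> z \<xi>)
          + (\<Sum>\<xi>\<in>?S. shell_cutoff N k \<xi> * fourier_torus f \<xi> * wave \<xi> z * partial i (\<lambda>y. \<sigma> y \<xi>) z)"
        unfolding dyadic_piece_def[abs_def] by (rule partial_wave_sum[OF finite_shell d])
      then show ?thesis
        using norm_triangle_mono[OF _ 2, of "2 * pi * \<i> * (\<Sum>\<xi>\<in>?S. (shell_cutoff N k \<xi> * of_int (\<xi> $ i)) * fourier_torus f \<xi> * wave \<xi> z * \<sigma> z \<xi>)"] 1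
        by (simp add: norm_mult)
    qed
    also have "\<dots> = 2 * pi * (K * ((A0 * ?P powr m) * (U1 * ?P) * R)) + K * ((A0 * ?P powr m * (1 / ?s)) * U * R)"
      by simp
    also have "\<dots> \<le> 2 * pi * (K * ((A0 * ?P powr m) * (U1 * ?P) * R)) + K * ((A0 * ?P powr m * ?P) * U * R)"
      using K A0 U R sP by (intro add_left_mono mult_left_mono mult_right_mono) auto
    also have "\<dots> = (2 * pi * U1 + U) * K * A0 * (?P * (?P powr m * R))"
      by (simp add: algebra_simps)
    also have "\<dots> \<le> (2 * pi * U1 + U) * K * A0 * (?P * (2 * \<kappa> powr (real ?n / r) * (?H / ?s ^ ?n) powr (1 / r)))"
    proof (intro mult_left_mono)
      show "?P powr m * R \<le> 2 * \<kappa> powr (real ?n / r) * (?H / ?s ^ ?n) powr (1 / r)"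
        unfolding R_def coefficient_bound_def dyadic_scale_def N(1)[symmetric]
        using r m card_shell_le[of N k]
        by (intro exponent_bookkeeping(2)) (auto simp: \<kappa>_def weighted_mass_real_nonneg)
    qed (use K A0 U in auto)
    also have "\<dots> = C * (?P * (?H / ?s ^ ?n) powr (1 / r))"
      by (simp add: C_def)
    finally show "cmod (partial i (dyadic_piece N \<sigma> f k) z) \<le> C * (2 ^ k * (?H / ?s ^ ?n) powr (1 / r))" .
  qed
qed


section \<open>Convergence of the dyadic decomposition\<close>

lemma smooth_torusD: "f \<in> smooth_torus \<Longrightarrow> smooth f" "f \<in> smooth_torus \<Longrightarrow> periodic1 f"
  by (auto simp: smooth_torus_def)

lemma smooth_torus_partial:
  assumes "f \<in> smooth_torus"
  shows "partial j f \<in> smooth_torus"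
proof -
  have "foldr partial js (partial j f) = foldr partial (js @ [j]) f" for js by simp
  then have "smooth (partial j f)"
    using smooth_torusD(1)[OF assms] unfolding smooth_def by metis
  moreover have "periodic1 (partial j f)"
    using smooth_torusD(2)[OF assms]
    by (simp add: periodic1_def partial_def add.assoc add.commute[of "real_vec _"]) (simp flip: add.assoc)
  ultimately show ?thesis by (simp add: smooth_torus_def)
qed

lemma fourier_translate:
  assumes cont: "continuous_on UNIV f" and per: "periodic1 f"
  shows "(LINT x:unit_cube|lborel. cnj (wave \<xi> x) * f (x + v)) = wave \<xi> v * fourier_torus f \<xi>"
proof -
  have "(LINT x:unit_cube|lborel. cnj (wave \<xi> x) * f (x + v))
      = (LINT x:unit_cube|lborel. wave \<xi> v * (cnj (wave \<xi> (x + v)) * f (x + v)))"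
  proof -
    have "wave \<xi> v * (cnj (wave \<xi> (x + v)) * f (x + v)) = (wave \<xi> v * cnj (wave \<xi> v)) * (cnj (wave \<xi> x) * f (x + v))" for x
      by (simp only: wave_add_point complex_cnj_mult mult_ac)
    then have "wave \<xi> v * (cnj (wave \<xi> (x + v)) * f (x + v)) = cnj (wave \<xi> x) * f (x + v)" for x
      by simp
    then show ?thesis by (simp only:)
  qed
  also have "\<dots> = wave \<xi> v * (LINT x:unit_cube|lborel. cnj (wave \<xi> (x + v)) * f (x + v))"
    by simp
  also have "(LINT x:unit_cube|lborel. cnj (wave \<xi> (x + v)) * f (x + v)) = (LINT x:unit_cube|lborel. cnj (wave \<xi> x) * f x)"
    using per periodic1_wave[of \<xi>]
    by (intro integral_periodic_translate[where g = "\<lambda>x. cnj (wave \<xi> x) * f x"] continuous_intros cont)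
       (simp add: periodic1_def)
  finally show ?thesis by (simp add: fourier_torus_eq[OF cont])
qed

text \<open>
  Differentiate the Fourier coefficients of the translates of \<open>f\<close> with respect to the
  translation.
\<close>
lemma fourier_partial:
  assumes f: "f \<in> smooth_torus"
  shows "fourier_torus (partial j f) \<xi> = 2 * pi * \<i> * of_int (\<xi> $ j) * fourier_torus f \<xi>"
proof -
  have cont: "continuous_on UNIV f" and cont': "continuous_on UNIV (partial j f)"
    using f smooth_torus_partial[OF f] by (auto dest!: smooth_torusD(1) intro: smooth_continuous)
  have diff: "f differentiable_on UNIV"
    using smooth_foldr_differentiable[OF smooth_torusD(1)[OF f], of "[]"] by simp
  let ?g = "\<lambda>t x. cnj (wave \<xi> x) * f (x + t *\<^sub>R axis j 1)"
  let ?g' = "\<lambda>t x. cnj (wave \<xi> x) * partial j f (x + t *\<^sub>R axis j 1)"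
  have cg: "continuous_on A (?g t)" for t A
    by (intro continuous_intros continuous_on_compose2[OF cont]) auto
  have "((\<lambda>t. integral unit_cube (?g t)) has_vector_derivative integral unit_cube (?g' 0)) (at 0 within UNIV)"
  proof (rule leibniz_rule_vector_derivative)
    show "((\<lambda>t. ?g t x) has_vector_derivative ?g' t x) (at t within UNIV)" for t x
      by (intro has_vector_derivative_mult_right partial_has_vector_derivative diff)
    show "?g t integrable_on unit_cube" for t
      by (intro integrable_continuous cg)
    show "continuous_on (UNIV \<times> unit_cube) (\<lambda>(t, x). ?g' t x)"
      unfolding split_beta by (intro continuous_intros continuous_on_compose2[OF cont']) auto
  qed auto
  moreover have "integral unit_cube (?g t) = wave \<xi> (t *\<^sub>R axis j 1) * fourier_torus f \<xi>" for t
  proof -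
    have "integral unit_cube (?g t) = (LINT x:unit_cube|lborel. ?g t x)"
      by (rule set_borel_integral_eq_integral(2)[symmetric]) (intro continuous_set_integrable cg)
    then show ?thesis
      by (simp add: fourier_translate[OF cont smooth_torusD(2)[OF f]])
  qed
  moreover have "integral unit_cube (?g' 0) = fourier_torus (partial j f) \<xi>"
  proof -
    have "integral unit_cube (?g' 0) = (LINT x:unit_cube|lborel. ?g' 0 x)"
      by (rule set_borel_integral_eq_integral(2)[symmetric])
         (intro continuous_set_integrable continuous_intros continuous_on_compose2[OF cont'], auto)
    then show ?thesis by (simp add: fourier_torus_eq[OF cont'])
  qed
  ultimately have "((\<lambda>t. wave \<xi> (t *\<^sub>R axis j 1) * fourier_torus f \<xi>) has_vector_derivative fourier_torus (partial j f) \<xi>) (at 0)"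
    by simp
  moreover have "((\<lambda>t. wave \<xi> (t *\<^sub>R axis j 1) * fourier_torus f \<xi>) has_vector_derivative
      2 * pi * \<i> * of_int (\<xi> $ j) * fourier_torus f \<xi>) (at 0)"
    using has_vector_derivative_mult_left[OF wave_has_vector_derivative[of \<xi> 0 j], of "fourier_torus f \<xi>"]
    by simp
  ultimately show ?thesis by (rule vector_derivative_unique_at)
qed

lemma smooth_torus_funpow_partial: "f \<in> smooth_torus \<Longrightarrow> (partial j ^^ q) f \<in> smooth_torus"
  by (induction q) (simp_all add: smooth_torus_partial)

lemma fourier_funpow_partial:
  "f \<in> smooth_torus \<Longrightarrow> fourier_torus ((partial j ^^ q) f) \<xi> = (2 * pi * \<i> * of_int (\<xi> $ j)) ^ q * fourier_torus f \<xi>"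
  by (induction q) (simp_all add: fourier_partial smooth_torus_funpow_partial)

lemma fourier_bounded:
  assumes "continuous_on UNIV f"
  shows "cmod (fourier_torus f \<xi>) \<le> (LINT x:unit_cube|lborel. cmod (f x))"
proof -
  have "cmod (fourier_torus f \<xi>) \<le> (LINT x:unit_cube|lborel. cmod (cnj (wave \<xi> x) * f x))"
    unfolding fourier_torus_eq[OF assms] by (intro norm_set_integral_le continuous_intros assms)
  then show ?thesis by (simp add: norm_mult)
qed

lemma fourier_decay_axis:
  assumes "f \<in> smooth_torus"
  obtains C where "0 \<le> C" "\<And>\<xi>. \<bar>real_of_int (\<xi> $ j)\<bar> ^ q * cmod (fourier_torus f \<xi>) \<le> C"
proof
  let ?g = "(partial j ^^ q) f"
  have cont: "continuous_on UNIV ?g"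
    by (intro smooth_continuous smooth_torusD(1) smooth_torus_funpow_partial assms)
  show "0 \<le> (LINT x:unit_cube|lborel. cmod (?g x))"
    unfolding set_lebesgue_integral_def by (intro integral_nonneg_AE) auto
  fix \<xi>
  have "1 * \<bar>real_of_int (\<xi> $ j)\<bar> \<le> (2 * pi) * \<bar>real_of_int (\<xi> $ j)\<bar>"
    using pi_ge_two by (intro mult_right_mono) auto
  then have "\<bar>real_of_int (\<xi> $ j)\<bar> ^ q \<le> ((2 * pi) * \<bar>real_of_int (\<xi> $ j)\<bar>) ^ q"
    by (intro power_mono) auto
  then have "\<bar>real_of_int (\<xi> $ j)\<bar> ^ q * cmod (fourier_torus f \<xi>) \<le> ((2 * pi) * \<bar>real_of_int (\<xi> $ j)\<bar>) ^ q * cmod (fourier_torus f \<xi>)"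
    by (intro mult_right_mono) auto
  also have "\<dots> = cmod (fourier_torus ?g \<xi>)"
    by (simp add: fourier_funpow_partial[OF assms] norm_mult norm_power)
  also have "\<dots> \<le> (LINT x:unit_cube|lborel. cmod (?g x))"
    by (rule fourier_bounded[OF cont])
  finally show "\<bar>real_of_int (\<xi> $ j)\<bar> ^ q * cmod (fourier_torus f \<xi>) \<le> (LINT x:unit_cube|lborel. cmod (?g x))" .
qed

lemma fourier_decay:
  fixes f :: "real ^ 'n::finite \<Rightarrow> complex"
  assumes f: "f \<in> smooth_torus"
  obtains C where "0 \<le> C"
    "\<And>\<xi>. cmod (fourier_torus f \<xi>) \<le> C * (\<Prod>j\<in>UNIV. 1 / (1 + (real_of_int (\<xi> $ j))\<^sup>2))"
proof -
  let ?n = "CARD('n)"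
  have "\<exists>C. 0 \<le> C \<and> (\<forall>\<xi>. \<bar>real_of_int (\<xi> $ j)\<bar> ^ (2 * ?n) * cmod (fourier_torus f \<xi>) \<le> C)" for j
    using fourier_decay_axis[OF f, of j "2 * ?n"] by metis
  then obtain C1 where C1: "\<And>j. 0 \<le> C1 j" "\<And>j \<xi>. \<bar>real_of_int (\<xi> $ j)\<bar> ^ (2 * ?n) * cmod (fourier_torus f \<xi>) \<le> C1 j"
    by metis
  define C0 where "C0 = (LINT x:unit_cube|lborel. cmod (f x))"
  have C0: "0 \<le> C0"
    unfolding C0_def set_lebesgue_integral_def by (intro integral_nonneg_AE) auto
  define C where "C = 2 ^ ?n * (C0 + (\<Sum>j\<in>UNIV. C1 j))"
  show ?thesis
  proof
    show "0 \<le> C" using C0 C1(1) by (simp add: C_def sum_nonneg)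
    fix \<xi> :: "int ^ 'n"
    let ?a = "cmod (fourier_torus f \<xi>)" and ?x = "\<lambda>j. real_of_int (\<xi> $ j)"
    obtain i where i: "\<And>j. \<bar>?x j\<bar> \<le> \<bar>?x i\<bar>"
    proof -
      have "Max (range (\<lambda>j. \<bar>?x j\<bar>)) \<in> range (\<lambda>j. \<bar>?x j\<bar>)" by (rule Max_in) auto
      then obtain i where "Max (range (\<lambda>j. \<bar>?x j\<bar>)) = \<bar>?x i\<bar>" by blast
      then have "\<bar>?x j\<bar> \<le> \<bar>?x i\<bar>" for j
        using Max_ge[of "range (\<lambda>j. \<bar>?x j\<bar>)" "\<bar>?x j\<bar>"] by auto
      then show ?thesis by (rule that)
    qed
    have "(\<Prod>j\<in>UNIV. 1 + (?x j)\<^sup>2) \<le> (\<Prod>j\<in>(UNIV :: 'n set). 2 * (max 1 \<bar>?x i\<bar>)\<^sup>2)"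
    proof (rule prod_mono)
      fix j
      have "(?x j)\<^sup>2 \<le> (max 1 \<bar>?x i\<bar>)\<^sup>2"
        using i[of j] power_mono[of "\<bar>?x j\<bar>" "max 1 \<bar>?x i\<bar>" 2] by auto
      moreover have "1 \<le> (max 1 \<bar>?x i\<bar>)\<^sup>2" by (intro one_le_power) auto
      ultimately have "1 + (?x j)\<^sup>2 \<le> 2 * (max 1 \<bar>?x i\<bar>)\<^sup>2" by linarith
      then show "0 \<le> 1 + (?x j)\<^sup>2 \<and> 1 + (?x j)\<^sup>2 \<le> 2 * (max 1 \<bar>?x i\<bar>)\<^sup>2" by simp
    qed
    also have "\<dots> = 2 ^ ?n * (max 1 \<bar>?x i\<bar>) ^ (2 * ?n)"
      by (simp add: power_mult_distrib power_mult)
    also have "\<dots> \<le> 2 ^ ?n * (1 + \<bar>?x i\<bar> ^ (2 * ?n))"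
      by (intro mult_left_mono) (auto simp: max_def)
    finally have "(\<Prod>j\<in>UNIV. 1 + (?x j)\<^sup>2) * ?a \<le> 2 ^ ?n * (1 + \<bar>?x i\<bar> ^ (2 * ?n)) * ?a"
      by (rule mult_right_mono) simp
    also have "\<dots> = 2 ^ ?n * (?a + \<bar>?x i\<bar> ^ (2 * ?n) * ?a)"
      by (simp add: algebra_simps)
    also have "\<dots> \<le> 2 ^ ?n * (C0 + C1 i)"
      unfolding C0_def
      by (intro mult_left_mono add_mono C1(2) fourier_bounded smooth_continuous smooth_torusD(1) f) auto
    also have "\<dots> \<le> C"
      unfolding C_def using C1(1) by (intro mult_left_mono add_left_mono member_le_sum) auto
    finally have "(\<Prod>j\<in>UNIV. 1 + (?x j)\<^sup>2) * ?a \<le> C" .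
    moreover have "0 < (\<Prod>j\<in>UNIV. 1 + (?x j)\<^sup>2)"
      by (intro prod_pos) (auto intro: add_pos_nonneg)
    ultimately have "?a \<le> C / (\<Prod>j\<in>UNIV. 1 + (?x j)\<^sup>2)"
      by (simp add: pos_le_divide_eq mult.commute)
    then show "?a \<le> C * (\<Prod>j\<in>UNIV. 1 / (1 + (?x j)\<^sup>2))"
      by (simp add: prod_dividef)
  qed
qed

text \<open>
  The correction \<open>4 / (T + 1)\<close> makes the induction telescope.
\<close>
lemma sum_inverse_square_int: "(\<Sum>t\<in>{- int T..int T}. 1 / (1 + (real_of_int t)\<^sup>2)) \<le> 5 - 4 / (real T + 1)"
proof (induction T)
  case (Suc T)
  have "{- int (Suc T)..int (Suc T)} = insert (- int (Suc T)) (insert (int (Suc T)) {- int T..int T})"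
    by auto
  then have "(\<Sum>t\<in>{- int (Suc T)..int (Suc T)}. 1 / (1 + (real_of_int t)\<^sup>2))
      = 2 / (1 + (real T + 1)\<^sup>2) + (\<Sum>t\<in>{- int T..int T}. 1 / (1 + (real_of_int t)\<^sup>2))"
    using power2_minus[of "real T + 1"] by (simp add: add.commute)
  also have "\<dots> \<le> 2 / (1 + (real T + 1)\<^sup>2) + (5 - 4 / (real T + 1))"
    by (intro add_left_mono Suc)
  also have "\<dots> \<le> 5 - 4 / (real (Suc T) + 1)"
  proof -
    have "(real T + 1) * (real T + 2) \<le> 2 * (1 + (real T + 1)\<^sup>2)"
      by (simp add: power2_eq_square algebra_simps)
    then have "4 / (2 * (1 + (real T + 1)\<^sup>2)) \<le> 4 / ((real T + 1) * (real T + 2))"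
      by (intro divide_left_mono mult_pos_pos) (auto intro: add_pos_nonneg)
    moreover have "4 / (2 * a) = 2 / a" for a :: real by simp
    moreover have "4 / ((real T + 1) * (real T + 2)) = 4 / (real T + 1) - 4 / (real T + 2)"
      by (simp add: field_simps)
    ultimately have "2 / (1 + (real T + 1)\<^sup>2) \<le> 4 / (real T + 1) - 4 / (real T + 2)" by metis
    then show ?thesis by (simp add: add.commute)
  qed
  finally show ?case .
qed simp

lemma summable_product_decay:
  "(\<lambda>\<xi> :: int ^ 'n::finite. \<Prod>j\<in>UNIV. 1 / (1 + (real_of_int (\<xi> $ j))\<^sup>2)) summable_on UNIV"
proof (rule nonneg_bdd_above_summable_on)
  let ?h = "\<lambda>\<xi> :: int ^ 'n. \<Prod>j\<in>UNIV. 1 / (1 + (real_of_int (\<xi> $ j))\<^sup>2)"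
  show "0 \<le> ?h \<xi>" for \<xi> by (intro prod_nonneg) auto
  show "bdd_above (sum ?h ` {F. F \<subseteq> UNIV \<and> finite F})"
  proof (rule bdd_aboveI2)
    fix F :: "(int ^ 'n) set" assume "F \<in> {F. F \<subseteq> UNIV \<and> finite F}"
    then have F: "finite F" by simp
    define T where "T = nat (\<Sum>\<xi>\<in>F. \<Sum>j\<in>UNIV. \<bar>\<xi> $ j\<bar>)"
    let ?I = "{- int T..int T}"
    have "\<xi> $ j \<in> ?I" if "\<xi> \<in> F" for \<xi> j
    proof -
      have "\<bar>\<xi> $ j\<bar> \<le> (\<Sum>j\<in>UNIV. \<bar>\<xi> $ j\<bar>)" by (intro member_le_sum) auto
      also have "\<dots> \<le> (\<Sum>\<xi>\<in>F. \<Sum>j\<in>UNIV. \<bar>\<xi> $ j\<bar>)"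
        using that F by (intro member_le_sum[of \<xi> F "\<lambda>\<xi>. \<Sum>j\<in>UNIV. \<bar>\<xi> $ j\<bar>"]) (auto simp: sum_nonneg)
      also have "\<dots> \<le> int T" by (simp add: T_def)
      finally show ?thesis by (auto simp: abs_le_iff)
    qed
    then have sub: "vec_nth ` F \<subseteq> PiE (UNIV :: 'n set) (\<lambda>_. ?I)" by auto
    have "sum ?h F = (\<Sum>g\<in>vec_nth ` F. \<Prod>j\<in>UNIV. 1 / (1 + (real_of_int (g j))\<^sup>2))"
      by (subst sum.reindex) (auto simp: inj_on_def vec_nth_inject)
    also have "\<dots> \<le> (\<Sum>g\<in>PiE (UNIV :: 'n set) (\<lambda>_. ?I). \<Prod>j\<in>UNIV. 1 / (1 + (real_of_int (g j))\<^sup>2))"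
      by (rule sum_mono2[OF _ sub]) (auto intro!: prod_nonneg finite_PiE)
    also have "\<dots> = (\<Prod>j\<in>(UNIV :: 'n set). \<Sum>t\<in>?I. 1 / (1 + (real_of_int t)\<^sup>2))"
      by (rule prod_sum_PiE[symmetric]) auto
    also have "\<dots> \<le> (\<Prod>j\<in>(UNIV :: 'n set). 5)"
    proof (rule prod_mono)
      have "(\<Sum>t\<in>?I. 1 / (1 + (real_of_int t)\<^sup>2)) \<le> 5"
        by (rule order_trans[OF sum_inverse_square_int]) simp
      then show "0 \<le> (\<Sum>t\<in>?I. 1 / (1 + (real_of_int t)\<^sup>2)) \<and> (\<Sum>t\<in>?I. 1 / (1 + (real_of_int t)\<^sup>2)) \<le> 5"
        by (simp add: sum_nonneg)
    qed
    finally show "sum ?h F \<le> 5 ^ CARD('n)" by simp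
  qed
qed

definition symbol_term :: "(real ^ 'n::finite \<Rightarrow> int ^ 'n \<Rightarrow> complex) \<Rightarrow> (real ^ 'n \<Rightarrow> complex) \<Rightarrow> real ^ 'n \<Rightarrow> int ^ 'n \<Rightarrow> complex" where
  "symbol_term \<sigma> f x \<xi> = fourier_torus f \<xi> * wave \<xi> x * \<sigma> x \<xi>"

lemma toroidal_op_eq: "toroidal_op \<sigma> f x = (\<Sum>\<^sub>\<infinity>\<xi>. symbol_term \<sigma> f x \<xi>)"
  unfolding toroidal_op_def symbol_term_def
  by (rule infsum_cong) (simp add: wave_def cis_conv_exp)

lemma symbol_term_abs_summable:
  fixes \<sigma> :: "real ^ 'n::finite \<Rightarrow> int ^ 'n \<Rightarrow> complex"
  assumes \<sigma>: "\<sigma> \<in> symbol_class m \<rho> \<delta>" and m: "m \<le> 0" and f: "f \<in> smooth_torus"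
  shows "(\<lambda>\<xi>. cmod (symbol_term \<sigma> f x \<xi>)) summable_on UNIV"
proof -
  obtain C where C: "\<And>x \<xi>. cmod (multi_power partial (\<lambda>_. 0) (\<lambda>y. multi_power difference (\<lambda>_. 0) (\<sigma> y) \<xi>) x)
        \<le> C * japanese_bracket \<xi> powr (m - \<rho> * real (order_of (\<lambda>_ :: 'n. 0)) + \<delta> * real (order_of (\<lambda>_ :: 'n. 0)))"
    using \<sigma> unfolding symbol_class_def by fastforce
  have id: "foldr (\<lambda>j. id) js = id" for js :: "'n list" by (induction js) auto
  have \<sigma>C: "cmod (\<sigma> x \<xi>) \<le> \<bar>C\<bar>" for \<xi>
  proof -
    have "cmod (\<sigma> x \<xi>) \<le> C * japanese_bracket \<xi> powr m"
      using C[of \<xi> x] by (simp add: multi_power_def order_of_def id)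
    also have "\<dots> \<le> \<bar>C\<bar> * 1"
    proof (rule mult_mono)
      have "1 \<le> japanese_bracket \<xi>" by (simp add: japanese_bracket_def)
      then show "japanese_bracket \<xi> powr m \<le> 1" using powr_mono[OF m, of "japanese_bracket \<xi>"] by simp
    qed auto
    finally show ?thesis by simp
  qed
  obtain D where D: "0 \<le> D" "\<And>\<xi>. cmod (fourier_torus f \<xi>) \<le> D * (\<Prod>j\<in>UNIV. 1 / (1 + (real_of_int (\<xi> $ j))\<^sup>2))"
    using fourier_decay[OF f] by metis
  show ?thesis
  proof (rule summable_on_comparison_test)
    show "(\<lambda>\<xi> :: int ^ 'n. (D * \<bar>C\<bar>) * (\<Prod>j\<in>UNIV. 1 / (1 + (real_of_int (\<xi> $ j))\<^sup>2))) summable_on UNIV"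
      by (intro summable_on_cmult_right summable_product_decay)
    fix \<xi> :: "int ^ 'n"
    have "cmod (symbol_term \<sigma> f x \<xi>) = cmod (fourier_torus f \<xi>) * cmod (\<sigma> x \<xi>)"
      by (simp add: symbol_term_def norm_mult)
    also have "\<dots> \<le> (D * (\<Prod>j\<in>UNIV. 1 / (1 + (real_of_int (\<xi> $ j))\<^sup>2))) * \<bar>C\<bar>"
      using D by (intro mult_mono \<sigma>C) (auto intro!: mult_nonneg_nonneg prod_nonneg)
    finally show "cmod (symbol_term \<sigma> f x \<xi>) \<le> (D * \<bar>C\<bar>) * (\<Prod>j\<in>UNIV. 1 / (1 + (real_of_int (\<xi> $ j))\<^sup>2))"
      by (simp only: mult_ac)
  qed auto
qed

text \<open>
  The cutoffs up to order \<open>K\<close> add up to a function with values in \<open>[0, 1]\<close> that equals \<open>1\<close> where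
  all coordinates are at most \<open>2 ^ K\<close> in absolute value. The partial sums therefore differ from
  the sums over these cubes by at most a tail of an absolutely convergent series.
\<close>
lemma dyadic_sum_tendsto:
  fixes \<sigma> :: "real ^ 'n::finite \<Rightarrow> int ^ 'n \<Rightarrow> complex"
  assumes \<sigma>: "\<sigma> \<in> symbol_class m \<rho> \<delta>" and m: "m \<le> 0" and f: "f \<in> smooth_torus"
  shows "(\<lambda>K. \<Sum>k\<le>K. dyadic_piece N \<sigma> f k x) \<longlonglongrightarrow> toroidal_op \<sigma> f x"
proof -
  let ?a = "symbol_term \<sigma> f x"
  define F where "F K = {\<xi> :: int ^ 'n. \<forall>j. \<xi> $ j \<in> {- (2 ^ K)..2 ^ K}}" for K :: nat
  have finF: "finite (F K)" for K unfolding F_def by (rule lattice_box) simp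
  have sa: "(\<lambda>\<xi>. cmod (?a \<xi>)) summable_on UNIV" by (rule symbol_term_abs_summable[OF assms])
  have s: "?a summable_on UNIV" by (rule abs_summable_summable[OF sa])
  have lim: "filterlim F (finite_subsets_at_top UNIV) sequentially"
    unfolding filterlim_finite_subsets_at_top
  proof (intro allI impI)
    fix X :: "(int ^ 'n) set" assume "finite X \<and> X \<subseteq> UNIV"
    then have X: "finite X" by simp
    define T where "T = nat (\<Sum>\<xi>\<in>X. \<Sum>j\<in>UNIV. \<bar>\<xi> $ j\<bar>)"
    have "X \<subseteq> F K" if "T \<le> K" for K
    proof
      fix \<xi> assume \<xi>: "\<xi> \<in> X"
      have "\<bar>\<xi> $ j\<bar> \<le> 2 ^ K" for j
      proof -
        have "\<bar>\<xi> $ j\<bar> \<le> (\<Sum>j\<in>UNIV. \<bar>\<xi> $ j\<bar>)" by (intro member_le_sum) auto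
        also have "\<dots> \<le> (\<Sum>\<xi>\<in>X. \<Sum>j\<in>UNIV. \<bar>\<xi> $ j\<bar>)"
          using \<xi> X by (intro member_le_sum[of \<xi> X "\<lambda>\<xi>. \<Sum>j\<in>UNIV. \<bar>\<xi> $ j\<bar>"]) (auto simp: sum_nonneg)
        also have "\<dots> \<le> int T" by (simp add: T_def)
        also have "\<dots> \<le> int K" using that by simp
        also have "\<dots> \<le> int (2 ^ K)" by (simp only: of_nat_le_iff less_exp less_imp_le)
        finally show ?thesis by simp
      qed
      then show "\<xi> \<in> F K" by (simp add: F_def abs_le_iff minus_le_iff[of "\<xi> $ _"])
    qed
    then show "\<forall>\<^sub>F K in sequentially. finite (F K) \<and> X \<subseteq> F K \<and> F K \<subseteq> UNIV"
      using finF by (auto simp: eventually_sequentially)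
  qed
  have limF: "(\<lambda>K. sum ?a (F K)) \<longlonglongrightarrow> (\<Sum>\<^sub>\<infinity>\<xi>. ?a \<xi>)"
    using filterlim_compose[OF has_sum_infsum[OF s, unfolded has_sum_def] lim] .
  have limA: "(\<lambda>K. sum (\<lambda>\<xi>. cmod (?a \<xi>)) (F K)) \<longlonglongrightarrow> (\<Sum>\<^sub>\<infinity>\<xi>. cmod (?a \<xi>))"
    using filterlim_compose[OF has_sum_infsum[OF sa, unfolded has_sum_def] lim] .
  have close: "cmod ((\<Sum>k\<le>K. dyadic_piece N \<sigma> f k x) - sum ?a (F K))
      \<le> (\<Sum>\<^sub>\<infinity>\<xi>. cmod (?a \<xi>)) - sum (\<lambda>\<xi>. cmod (?a \<xi>)) (F K)" for K
  proof -
    define G where "G = (\<Union>k\<le>K. shell N k) \<union> F K"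
    have G: "finite G" "F K \<subseteq> G" using finF by (auto simp: G_def)
    have "dyadic_piece N \<sigma> f k x = (\<Sum>\<xi>\<in>G. shell_cutoff N k \<xi> * ?a \<xi>)" if "k \<le> K" for k
    proof -
      have "(\<Sum>\<xi>\<in>shell N k. shell_cutoff N k \<xi> * ?a \<xi>) = (\<Sum>\<xi>\<in>G. shell_cutoff N k \<xi> * ?a \<xi>)"
      proof (rule sum.mono_neutral_left[OF G(1)])
        show "\<forall>\<xi>\<in>G - shell N k. shell_cutoff N k \<xi> * ?a \<xi> = 0"
          using shell_cutoff_support[of N k _ _ 0] by (auto simp: axis_int_0[simplified])
      qed (use that in \<open>auto simp: G_def\<close>)
      then show ?thesis by (simp add: dyadic_piece_def symbol_term_def mult.assoc)
    qed
    then have "(\<Sum>k\<le>K. dyadic_piece N \<sigma> f k x) = (\<Sum>\<xi>\<in>G. (\<Sum>k\<le>K. shell_cutoff N k \<xi>) * ?a \<xi>)"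
      by (simp add: sum_distrib_right) (rule sum.swap)
    also have "\<dots> = (\<Sum>\<xi>\<in>G. ball_cutoff N K \<xi> * ?a \<xi>)"
      by (simp only: sum_shell_cutoff)
    also have "\<dots> = (\<Sum>\<xi>\<in>G - F K. ball_cutoff N K \<xi> * ?a \<xi>) + (\<Sum>\<xi>\<in>F K. ball_cutoff N K \<xi> * ?a \<xi>)"
      by (rule sum.subset_diff[OF G(2,1)])
    also have "(\<Sum>\<xi>\<in>F K. ball_cutoff N K \<xi> * ?a \<xi>) = sum ?a (F K)"
    proof (rule sum.cong[OF refl])
      fix \<xi> assume "\<xi> \<in> F K"
      then have "- (2 ^ K) \<le> \<xi> $ j \<and> \<xi> $ j \<le> 2 ^ K" for j by (simp add: F_def)
      then have "\<bar>\<xi> $ j\<bar> \<le> 2 ^ K" for j by (meson abs_leI minus_le_iff)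
      then show "ball_cutoff N K \<xi> * ?a \<xi> = ?a \<xi>" by (simp add: ball_cutoff_one)
    qed
    finally have "cmod ((\<Sum>k\<le>K. dyadic_piece N \<sigma> f k x) - sum ?a (F K)) = cmod (\<Sum>\<xi>\<in>G - F K. ball_cutoff N K \<xi> * ?a \<xi>)"
      by simp
    also have "\<dots> \<le> (\<Sum>\<xi>\<in>G - F K. cmod (ball_cutoff N K \<xi> * ?a \<xi>))" by (rule norm_sum)
    also have "\<dots> \<le> (\<Sum>\<xi>\<in>G - F K. cmod (?a \<xi>))"
      by (intro sum_mono) (simp add: norm_mult mult_left_le_one_le cmod_ball_cutoff)
    also have "\<dots> = sum (\<lambda>\<xi>. cmod (?a \<xi>)) G - sum (\<lambda>\<xi>. cmod (?a \<xi>)) (F K)"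
      using G finF by (simp add: sum_diff)
    also have "sum (\<lambda>\<xi>. cmod (?a \<xi>)) G \<le> (\<Sum>\<^sub>\<infinity>\<xi>. cmod (?a \<xi>))"
      using G by (intro finite_sum_le_infsum sa) auto
    finally show ?thesis by simp
  qed
  have "(\<lambda>K. (\<Sum>k\<le>K. dyadic_piece N \<sigma> f k x) - sum ?a (F K)) \<longlonglongrightarrow> 0"
  proof (rule Lim_null_comparison)
    show "\<forall>\<^sub>F K in sequentially. norm ((\<Sum>k\<le>K. dyadic_piece N \<sigma> f k x) - sum ?a (F K))
        \<le> (\<Sum>\<^sub>\<infinity>\<xi>. cmod (?a \<xi>)) - sum (\<lambda>\<xi>. cmod (?a \<xi>)) (F K)"
      using close by simp
    show "(\<lambda>K. (\<Sum>\<^sub>\<infinity>\<xi>. cmod (?a \<xi>)) - sum (\<lambda>\<xi>. cmod (?a \<xi>)) (F K)) \<longlonglongrightarrow> 0"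
      using tendsto_diff[OF tendsto_const limA, of "\<Sum>\<^sub>\<infinity>\<xi>. cmod (?a \<xi>)"] by simp
  qed
  from tendsto_add[OF this limF] show ?thesis by (simp add: toroidal_op_eq)
qed


section \<open>Dyadic pieces on a cube\<close>

lemma emeasure_cube:
  fixes a :: "real ^ 'n::finite"
  assumes "0 \<le> L"
  shows "emeasure lborel (cube a L) = ennreal (L ^ CARD('n))"
proof -
  have "(\<Prod>b\<in>Basis. (a + L *\<^sub>R One - a) \<bullet> (b :: real ^ 'n)) = (\<Prod>b\<in>(Basis :: (real ^ 'n) set). L)"
    by (rule prod.cong) auto
  then show ?thesis
    using assms by (simp add: emeasure_lborel_cbox_eq inner_add_left)
qed

lemma ennreal_cancel_right:
  assumes "X * ennreal a \<le> ennreal (b * a)" "0 < a" "0 \<le> b"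
  shows "X \<le> ennreal b"
proof -
  have "ennreal a * X \<le> ennreal a * ennreal b"
    using assms by (simp add: ennreal_mult mult.commute)
  then show ?thesis using assms by (simp add: ennreal_mult_le_mult_iff)
qed

text \<open>
  Pointwise, \<open>t powr r \<le> \<Lambda> powr r + \<Lambda> powr (r - 2) * t\<^sup>2\<close>.
\<close>
lemma Lr_le_L2:
  fixes g :: "real ^ 'n::finite \<Rightarrow> complex"
  assumes [measurable]: "g \<in> borel_measurable borel" "E \<in> sets borel"
    and mu: "emeasure lborel E = ennreal \<mu>" "0 \<le> \<mu>" and la: "0 \<le> \<Lambda>" and r: "1 < r" "r \<le> 2"
    and L2: "L2_mass g E \<le> ennreal (\<Lambda>\<^sup>2 * \<mu>)"
  shows "Lr_mass r g E \<le> ennreal (2 * \<Lambda> powr r * \<mu>)"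
proof (cases "\<Lambda> = 0")
  case True
  then have "L2_mass g E = 0" using L2 by simp
  then have "AE x in lborel. ennreal ((cmod (g x))\<^sup>2) * indicator E x = 0"
    by (subst (asm) nn_integral_0_iff_AE) auto
  then have "AE x in lborel. ennreal (cmod (g x) powr r) * indicator E x = 0"
    by eventually_elim (auto simp: indicator_def)
  then have "Lr_mass r g E = 0"
    by (subst nn_integral_0_iff_AE) auto
  then show ?thesis by simp
next
  case False
  with la have la: "0 < \<Lambda>" by simp
  have pt: "t powr r \<le> \<Lambda> powr r + \<Lambda> powr (r - 2) * t\<^sup>2" if "0 \<le> t" for t
  proof (cases "t \<le> \<Lambda>")
    case True
    then have "t powr r \<le> \<Lambda> powr r" using that r by (intro powr_mono2) auto
    then show ?thesis by (simp add: add_increasing2)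
  next
    case False
    then have t: "0 < t" "\<Lambda> \<le> t" using la by auto
    have "t powr r = t powr (r - 2) * t\<^sup>2"
      using t powr_add[of t "r - 2" 2] by simp
    also have "\<dots> \<le> \<Lambda> powr (r - 2) * t\<^sup>2"
      using t la r by (intro mult_right_mono powr_mono2') auto
    finally show ?thesis by (simp add: add_increasing)
  qed
  have "Lr_mass r g E
    \<le> (\<integral>\<^sup>+x. ennreal (\<Lambda> powr r) * indicator E x + ennreal (\<Lambda> powr (r - 2)) * (ennreal ((cmod (g x))\<^sup>2) * indicator E x) \<partial>lborel)"
  proof (rule nn_integral_mono)
    fix x
    have "ennreal (cmod (g x) powr r) \<le> ennreal (\<Lambda> powr r + \<Lambda> powr (r - 2) * (cmod (g x))\<^sup>2)"
      by (intro ennreal_leI pt) simp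
    also have "\<dots> = ennreal (\<Lambda> powr r) + ennreal (\<Lambda> powr (r - 2)) * ennreal ((cmod (g x))\<^sup>2)"
      by (simp add: ennreal_plus ennreal_mult)
    finally show "ennreal (cmod (g x) powr r) * indicator E x
      \<le> ennreal (\<Lambda> powr r) * indicator E x + ennreal (\<Lambda> powr (r - 2)) * (ennreal ((cmod (g x))\<^sup>2) * indicator E x)"
      by (auto simp: indicator_def)
  qed
  also have "\<dots> = (\<integral>\<^sup>+x. ennreal (\<Lambda> powr r) * indicator E x \<partial>lborel)
      + (\<integral>\<^sup>+x. ennreal (\<Lambda> powr (r - 2)) * (ennreal ((cmod (g x))\<^sup>2) * indicator E x) \<partial>lborel)"
    by (rule nn_integral_add) measurable
  also have "(\<integral>\<^sup>+x. ennreal (\<Lambda> powr r) * indicator E x \<partial>lborel) = ennreal (\<Lambda> powr r) * ennreal \<mu>"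
    by (subst nn_integral_cmult_indicator) (simp_all add: mu)
  also have "(\<integral>\<^sup>+x. ennreal (\<Lambda> powr (r - 2)) * (ennreal ((cmod (g x))\<^sup>2) * indicator E x) \<partial>lborel)
      = ennreal (\<Lambda> powr (r - 2)) * L2_mass g E"
    by (rule nn_integral_cmult) measurable
  also have "ennreal (\<Lambda> powr r) * ennreal \<mu> + ennreal (\<Lambda> powr (r - 2)) * L2_mass g E
      \<le> ennreal (\<Lambda> powr r) * ennreal \<mu> + ennreal (\<Lambda> powr (r - 2)) * ennreal (\<Lambda>\<^sup>2 * \<mu>)"
    by (intro add_left_mono mult_left_mono L2) auto
  also have "\<dots> = ennreal (\<Lambda> powr r * \<mu> + \<Lambda> powr (r - 2) * (\<Lambda>\<^sup>2 * \<mu>))"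
    using mu by (subst ennreal_plus) (auto simp: ennreal_mult)
  also have "\<Lambda> powr r * \<mu> + \<Lambda> powr (r - 2) * (\<Lambda>\<^sup>2 * \<mu>) = 2 * \<Lambda> powr r * \<mu>"
  proof -
    have "\<Lambda> powr (r - 2) * \<Lambda>\<^sup>2 = \<Lambda> powr r"
      using la powr_add[of \<Lambda> "r - 2" 2] by simp
    then show ?thesis by (simp add: mult.assoc[symmetric])
  qed
  finally show ?thesis .
qed

text \<open>
  Every \<open>y\<close> lies in \<open>cube b s\<close> for a set of points \<open>b\<close> of measure \<open>s ^ n\<close>, and if \<open>y\<close> is in the
  given cube then all these points lie in the larger cube on the right.
\<close>
lemma cube_averaging:
  fixes g :: "real ^ 'n::finite \<Rightarrow> ennreal"
  assumes g [measurable]: "g \<in> borel_measurable borel" and s: "0 < s" and l: "0 < l"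
  shows "(\<integral>\<^sup>+y\<in>cube q l. g y \<partial>lborel) * ennreal (s ^ CARD('n))
    \<le> (\<integral>\<^sup>+b\<in>cube (q - s *\<^sub>R One) (l + s). (\<integral>\<^sup>+y\<in>cube b s. g y \<partial>lborel) \<partial>lborel)"
proof -
  let ?Q = "cube q l" and ?Q' = "cube (q - s *\<^sub>R One) (l + s)"
  let ?C = "cbox 0 (s *\<^sub>R One) :: (real ^ 'n) set"
  let ?F = "\<lambda>y b. g y * indicator ?Q y * indicator ?C (y - b)"
  have meas: "case_prod ?F \<in> borel_measurable borel"
  proof -
    have d: "(\<lambda>p :: (real ^ 'n) \<times> (real ^ 'n). fst p - snd p) \<in> borel_measurable borel"
      by (intro continuous_borel_measurable continuous_intros)
    have [measurable]: "(\<lambda>p. indicator ?C (fst p - snd p) :: ennreal) \<in> borel_measurable (borel :: ((real ^ 'n) \<times> (real ^ 'n)) measure)"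
      using measurable_compose[OF d, of "indicator ?C :: _ \<Rightarrow> ennreal" borel] by simp
    have [measurable]: "(\<lambda>p. indicator ?Q (fst p) :: ennreal) \<in> borel_measurable (borel :: ((real ^ 'n) \<times> (real ^ 'n)) measure)"
      "(\<lambda>p. g (fst p)) \<in> borel_measurable (borel :: ((real ^ 'n) \<times> (real ^ 'n)) measure)"
      by (auto simp flip: borel_prod intro!: measurable_compose[OF measurable_fst])
    show ?thesis unfolding split_beta by measurable
  qed
  have "(\<integral>\<^sup>+y\<in>?Q. g y \<partial>lborel) * ennreal (s ^ CARD('n)) = (\<integral>\<^sup>+y. g y * indicator ?Q y * ennreal (s ^ CARD('n)) \<partial>lborel)"
    by (rule nn_integral_multc[symmetric]) measurable
  also have "\<dots> = (\<integral>\<^sup>+y. (\<integral>\<^sup>+b. ?F y b \<partial>lborel) \<partial>lborel)"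
  proof (rule nn_integral_cong)
    fix y
    have "(\<integral>\<^sup>+b. ?F y b \<partial>lborel) = (\<integral>\<^sup>+b. (g y * indicator ?Q y) * indicator (cube (y - s *\<^sub>R One) s) b \<partial>lborel)"
    proof (rule nn_integral_cong)
      fix b
      have "y - b \<in> ?C \<longleftrightarrow> b \<in> cube (y - s *\<^sub>R One) s"
        by (auto simp: mem_box_cart algebra_simps)
      then show "?F y b = (g y * indicator ?Q y) * indicator (cube (y - s *\<^sub>R One) s) b"
        by (simp add: indicator_def)
    qed
    also have "\<dots> = g y * indicator ?Q y * ennreal (s ^ CARD('n))"
      using s by (subst nn_integral_cmult_indicator) (simp_all only: emeasure_cube less_imp_le, simp)
    finally show "g y * indicator ?Q y * ennreal (s ^ CARD('n)) = (\<integral>\<^sup>+b. ?F y b \<partial>lborel)" by simp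
  qed
  also have "\<dots> = (\<integral>\<^sup>+b. (\<integral>\<^sup>+y. ?F y b \<partial>lborel) \<partial>lborel)"
    by (rule lborel_Fubini[symmetric, OF meas])
  also have "\<dots> \<le> (\<integral>\<^sup>+b\<in>?Q'. (\<integral>\<^sup>+y\<in>cube b s. g y \<partial>lborel) \<partial>lborel)"
  proof (rule nn_integral_mono)
    fix b
    show "(\<integral>\<^sup>+y. ?F y b \<partial>lborel) \<le> (\<integral>\<^sup>+y\<in>cube b s. g y \<partial>lborel) * indicator ?Q' b"
    proof (cases "b \<in> ?Q'")
      case True
      have "(\<integral>\<^sup>+y. ?F y b \<partial>lborel) \<le> (\<integral>\<^sup>+y\<in>cube b s. g y \<partial>lborel)"
      proof (rule nn_integral_mono)
        fix y
        have "y - b \<in> ?C \<longleftrightarrow> y \<in> cube b s"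
          by (auto simp: mem_box_cart algebra_simps)
        then show "?F y b \<le> g y * indicator (cube b s) y"
          by (simp add: indicator_def)
      qed
      then show ?thesis using True by simp
    next
      case False
      have zero: "?F y b = 0" for y
      proof (rule ccontr)
        assume "?F y b \<noteq> 0"
        then have y: "y \<in> ?Q" "y - b \<in> ?C" by (auto simp: indicator_def split: if_splits)
        have "b \<in> ?Q'"
          unfolding mem_box_cart
        proof
          fix j
          have "q $ j \<le> y $ j" "y $ j \<le> q $ j + l" "b $ j \<le> y $ j" "y $ j - b $ j \<le> s"
            using y by (auto simp: mem_box_cart)
          then show "(q - s *\<^sub>R One) $ j \<le> b $ j \<and> b $ j \<le> (q - s *\<^sub>R One + (l + s) *\<^sub>R One) $ j"
            by simp
        qed
        then show False using False by simp
      qed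
      show ?thesis by (simp only: zero) simp
    qed
  qed
  finally show ?thesis .
qed

lemma weighted_mass_eq:
  assumes "continuous_on UNIV f" "0 < s" "0 < r"
  shows "weighted_mass N s r f c = ennreal (weighted_mass_real N s r f c)"
  unfolding weighted_mass_def weighted_mass_real_def
  by (rule nn_integral_cube_eq) (intro continuous_on_cmod_powr continuous_weighted_part assms, simp)

lemma weighted_mass_measurable:
  fixes f :: "real ^ 'n::finite \<Rightarrow> complex"
  assumes cont: "continuous_on UNIV f" and s: "0 < s"
  shows "weighted_mass N s r f \<in> borel_measurable borel"
proof -
  have W: "weight N s c y \<noteq> 0" for c y :: "real ^ 'n" using weight_ge_1[OF s, of N c y] by auto
  have c: "continuous_on UNIV (\<lambda>p :: (real ^ 'n) \<times> (real ^ 'n). weighted_part N s (fst p) f (snd p))"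
    unfolding weighted_part_def
    by (intro continuous_intros continuous_on_compose2[OF cont]) (auto simp: W)
  have [measurable]: "(\<lambda>p. weighted_part N s (fst p) f (snd p)) \<in> borel_measurable (lborel \<Otimes>\<^sub>M lborel)"
    using continuous_borel_measurable[OF c] by (simp add: lborel_prod)
  have "(\<lambda>c. \<integral>\<^sup>+y. ennreal (cmod (weighted_part N s (fst (c, y)) f (snd (c, y))) powr r) * indicator unit_cube (snd (c, y)) \<partial>lborel) \<in> borel_measurable lborel"
    by measurable
  then show ?thesis by (simp add: weighted_mass_def[abs_def])
qed

text \<open>
  A bound in terms of the weighted mass at \<open>c\<close> is averaged over \<open>c\<close>.
\<close>
lemma average_mass_bound:
  fixes f :: "real ^ 'n::finite \<Rightarrow> complex"
  assumes cont: "continuous_on UNIV f" and per: "periodic1 f" and s: "0 < s" "s \<le> 1" and r: "1 < r"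
    and avg: "cube_means_le r f x m"
    and m: "0 \<le> m" and x: "x \<in> cube q s" and \<kappa>: "0 \<le> \<kappa>"
    and bound: "\<And>c. c \<in> cube q s \<Longrightarrow> X \<le> ennreal (\<kappa> * (weighted_mass_real (4 * CARD('n)) s r f c / s ^ CARD('n)))"
  shows "X \<le> ennreal (\<kappa> * ((48 * pi) ^ CARD('n) * m))"
proof -
  let ?n = "CARD('n)" and ?B = "cube q s"
  let ?h = "weighted_mass (4 * ?n) s r f"
  have sn: "0 < s ^ ?n" using s by simp
  have "X * ennreal (s ^ ?n) = (\<integral>\<^sup>+c. X * indicator ?B c \<partial>lborel)"
    using s by (subst nn_integral_cmult_indicator) (simp_all only: emeasure_cube less_imp_le, simp)
  also have "\<dots> \<le> (\<integral>\<^sup>+c. ennreal (\<kappa> / s ^ ?n) * (?h c * indicator ?B c) \<partial>lborel)"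
  proof (rule nn_integral_mono)
    fix c
    have "ennreal (\<kappa> * (weighted_mass_real (4 * ?n) s r f c / s ^ ?n)) = ennreal (\<kappa> / s ^ ?n) * ?h c"
      using \<kappa> s r weighted_mass_real_nonneg[of "4 * ?n" s r f c]
      by (subst weighted_mass_eq[OF cont]) (auto simp flip: ennreal_mult)
    then show "X * indicator ?B c \<le> ennreal (\<kappa> / s ^ ?n) * (?h c * indicator ?B c)"
      using bound[of c] by (auto simp: indicator_def)
  qed
  also have "\<dots> = ennreal (\<kappa> / s ^ ?n) * (\<integral>\<^sup>+c\<in>?B. ?h c \<partial>lborel)"
    using weighted_mass_measurable[OF cont s(1)] by (intro nn_integral_cmult) simp
  also have "\<dots> \<le> ennreal (\<kappa> / s ^ ?n) * ennreal ((48 * pi) ^ ?n * (s ^ ?n * s ^ ?n * m))"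
    using s by (intro mult_left_mono weighted_mass_average[OF cont per s(1) order_refl _ r avg m x]) auto
  also have "\<dots> = ennreal (\<kappa> / s ^ ?n * ((48 * pi) ^ ?n * (s ^ ?n * s ^ ?n * m)))"
    by (rule ennreal_mult[symmetric]) (use \<kappa> s m in auto)
  also have "\<kappa> / s ^ ?n * ((48 * pi) ^ ?n * (s ^ ?n * s ^ ?n * m)) = (\<kappa> * ((48 * pi) ^ ?n * m)) * s ^ ?n"
    using sn by simp
  finally show ?thesis
    by (rule ennreal_cancel_right) (use sn \<kappa> m in auto)
qed

lemma continuous_dyadic_piece:
  assumes "\<sigma> \<in> symbol_class m \<rho> \<delta>"
  shows "continuous_on UNIV (dyadic_piece N \<sigma> f k)"
  unfolding dyadic_piece_def[abs_def]
  by (intro continuous_intros smooth_continuous symbol_smooth[OF assms])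

text \<open>
  The mean square estimate is converted into one for the power \<open>r\<close> on a cube of side \<open>y\<close> that
  lies in a cube of side \<open>s\<close>; here \<open>y = l\<close> if \<open>l \<le> s\<close>, and \<open>y = s\<close> otherwise. In the first case
  the bound holds for all \<open>c\<close> in the larger cube and is averaged over \<open>c\<close>; in the second case the
  given cube is averaged over cubes of side \<open>s\<close>.
\<close>
lemma dyadic_piece_Lr:
  fixes \<sigma> :: "real ^ 'n::finite \<Rightarrow> int ^ 'n \<Rightarrow> complex" and r \<rho> m :: real
  assumes r: "1 < r" "r \<le> 2" and \<rho>: "0 < \<rho>" "\<rho> < 1" and m: "m \<le> - real CARD('n) * (1 - \<rho>) / r"
    and \<sigma>: "\<sigma> \<in> symbol_class m \<rho> \<rho>"
  defines "N \<equiv> 4 * CARD('n)"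
  obtains K where "0 \<le> K"
    "\<And>f k q l x M. continuous_on UNIV f \<Longrightarrow> periodic1 f \<Longrightarrow> 0 < l \<Longrightarrow> l \<le> 1 \<Longrightarrow> x \<in> cube q l \<Longrightarrow> 0 \<le> M \<Longrightarrow>
      cube_means_le r f x M \<Longrightarrow>
      Lr_mass r (dyadic_piece N \<sigma> f k) (cube q l)
      \<le> ennreal (K * (l ^ CARD('n) * M * ((2 ^ k * l) powr (- (real CARD('n) * r / 2)) + (2 ^ k * dyadic_scale \<rho> k) powr (- (real CARD('n) * r / 2)))))"
proof -
  let ?n = "CARD('n)"
  obtain C where C: "0 \<le> C" "\<And>f k b c. continuous_on UNIV f \<Longrightarrow> c \<in> cube b (dyadic_scale \<rho> k) \<Longrightarrow>
      L2_mass (dyadic_piece N \<sigma> f k) (cube b (dyadic_scale \<rho> k))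
      \<le> ennreal (C * ((1 / 2 ^ k) ^ ?n * (weighted_mass_real N (dyadic_scale \<rho> k) r f c / dyadic_scale \<rho> k ^ ?n) powr (2 / r)))"
    by (rule dyadic_piece_local_L2[OF r \<rho> m \<sigma>, folded N_def]) (rule that; blast)
  define K1 where "K1 = 2 * C powr (r / 2)"
  have K1: "0 \<le> K1" by (simp add: K1_def)
  define e where "e = - (real ?n * r / 2)"
  have small: "Lr_mass r (dyadic_piece N \<sigma> f k) (cube b' y)
      \<le> ennreal ((K1 * (y ^ ?n * (2 ^ k * y) powr e)) * (weighted_mass_real N (dyadic_scale \<rho> k) r f c / dyadic_scale \<rho> k ^ ?n))"
    if f: "continuous_on UNIV f" and c: "c \<in> cube b (dyadic_scale \<rho> k)" and y: "0 < y"
      and sub: "cube b' y \<subseteq> cube b (dyadic_scale \<rho> k)" for f k b b' c y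
  proof -
    define h where "h = weighted_mass_real N (dyadic_scale \<rho> k) r f c / dyadic_scale \<rho> k ^ ?n"
    have h: "0 \<le> h" unfolding h_def using weighted_mass_real_nonneg dyadic_scale_pos by (intro divide_nonneg_nonneg) (auto simp: less_imp_le)
    let ?P = "(2::real) ^ k"
    \<comment> \<open>\<open>\<Lambda>\<^sup>2\<close> is the bound for the mean square on the cube of side \<open>y\<close>.\<close>
    define \<Lambda> where "\<Lambda> = sqrt (C * ((1 / ?P) ^ ?n * h powr (2 / r)) / y ^ ?n)"
    have la2: "\<Lambda>\<^sup>2 = C * ((1 / ?P) ^ ?n * h powr (2 / r)) / y ^ ?n"
      unfolding \<Lambda>_def using C y by (intro real_sqrt_pow2) auto
    have la: "0 \<le> \<Lambda>" unfolding \<Lambda>_def using C y by auto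
    have "L2_mass (dyadic_piece N \<sigma> f k) (cube b' y)
       \<le> L2_mass (dyadic_piece N \<sigma> f k) (cube b (dyadic_scale \<rho> k))"
      using sub by (intro nn_integral_mono) (auto simp: indicator_def)
    also have "\<dots> \<le> ennreal (\<Lambda>\<^sup>2 * y ^ ?n)"
      using C(2)[OF f c] y by (simp add: la2 h_def)
    finally have "L2_mass (dyadic_piece N \<sigma> f k) (cube b' y) \<le> ennreal (\<Lambda>\<^sup>2 * y ^ ?n)" .
    then have "Lr_mass r (dyadic_piece N \<sigma> f k) (cube b' y) \<le> ennreal (2 * \<Lambda> powr r * y ^ ?n)"
      using y la r
      by (intro Lr_le_L2 continuous_borel_measurable[OF continuous_dyadic_piece[OF \<sigma>]]) (auto simp: emeasure_cube)
    also have "2 * \<Lambda> powr r * y ^ ?n = (K1 * (y ^ ?n * (?P * y) powr e)) * h"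
    proof -
      have "\<Lambda> powr r = (\<Lambda>\<^sup>2) powr (r / 2)"
        using la by (simp add: powr_powr flip: powr_numeral)
      also have "\<dots> = (C * (h powr (2 / r) * (1 / (?P * y)) ^ ?n)) powr (r / 2)"
        unfolding la2 by (simp add: power_divide power_mult_distrib mult_ac)
      also have "\<dots> = C powr (r / 2) * ((h powr (2 / r)) powr (r / 2) * ((1 / (?P * y)) ^ ?n) powr (r / 2))"
        using C y by (simp add: powr_mult)
      also have "(h powr (2 / r)) powr (r / 2) = h"
        using h r by (simp add: powr_powr)
      also have "((1 / (?P * y)) ^ ?n) powr (r / 2) = (?P * y) powr e"
      proof -
        have "(1 / (?P * y)) ^ ?n = (?P * y) powr (- real ?n)"
          using y by (simp add: powr_minus_divide powr_realpow power_divide)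
        then show ?thesis by (simp add: powr_powr e_def)
      qed
      finally show ?thesis by (simp add: K1_def mult_ac)
    qed
    finally show ?thesis by (simp only: h_def)
  qed
  show ?thesis
  proof
    show "0 \<le> K1 * (96 * pi) ^ ?n" using K1 by simp
    fix f :: "real ^ 'n \<Rightarrow> complex" and k :: nat and q x :: "real ^ 'n" and l M :: real
    assume f: "continuous_on UNIV f" and per: "periodic1 f" and l: "0 < l" "l \<le> 1"
      and x: "x \<in> cube q l" and M: "0 \<le> M"
      and avg: "cube_means_le r f x M"
    define s where "s = dyadic_scale \<rho> k"
    have s: "0 < s" "s \<le> 1" using dyadic_scale_pos[of \<rho> k] dyadic_scale_le_1[of \<rho> k] \<rho> by (auto simp: s_def)
    let ?X = "\<integral>\<^sup>+y\<in>cube q l. ennreal (cmod (dyadic_piece N \<sigma> f k y) powr r) \<partial>lborel"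
    have xj: "q $ j \<le> x $ j" "x $ j \<le> q $ j + l" for j using x by (auto simp: mem_box_cart)
    let ?g = "\<lambda>z. (2 ^ k * z) powr e"
    show "?X \<le> ennreal (K1 * (96 * pi) ^ ?n * (l ^ ?n * M * ((2 ^ k * l) powr (- (real ?n * r / 2)) + (2 ^ k * dyadic_scale \<rho> k) powr (- (real ?n * r / 2)))))"
      unfolding e_def[symmetric] s_def[symmetric]
    proof (cases "l \<le> s")
      case True
      have sub: "cube q l \<subseteq> cube q s"
        using True by (intro subset_box_imp) (auto simp: inner_add_left)
      have "?X \<le> ennreal ((K1 * (l ^ ?n * ?g l)) * ((48 * pi) ^ ?n * M))"
      proof (rule average_mass_bound[OF f per s r(1) avg M])
        show "x \<in> cube q s" using x sub by blast
        show "?X \<le> ennreal ((K1 * (l ^ ?n * ?g l)) * (weighted_mass_real (4 * ?n) s r f c / s ^ ?n))"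
          if "c \<in> cube q s" for c
          using small[of f c q k l q] f that l sub by (simp add: s_def N_def)
      qed (use K1 l in auto)
      also have "\<dots> \<le> ennreal (K1 * (96 * pi) ^ ?n * (l ^ ?n * M * (?g l + ?g s)))"
      proof (rule ennreal_leI)
        have "(48 * pi) ^ ?n * (?g l) \<le> (96 * pi) ^ ?n * (?g l + ?g s)"
          by (intro mult_mono power_mono) auto
        then have "(K1 * (l ^ ?n * M)) * ((48 * pi) ^ ?n * (?g l)) \<le> (K1 * (l ^ ?n * M)) * ((96 * pi) ^ ?n * (?g l + ?g s))"
          using K1 l M by (intro mult_left_mono) auto
        then show "(K1 * (l ^ ?n * ?g l)) * ((48 * pi) ^ ?n * M) \<le> K1 * (96 * pi) ^ ?n * (l ^ ?n * M * (?g l + ?g s))"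
          by (simp only: mult_ac)
      qed
      finally show "?X \<le> ennreal (K1 * (96 * pi) ^ ?n * (l ^ ?n * M * (?g l + ?g s)))" .
    next
      case False
      then have ls: "s < l" by simp
      let ?q = "q - s *\<^sub>R One"
      let ?Q = "cube ?q (l + s)"
      have "?X * ennreal (s ^ ?n) \<le> (\<integral>\<^sup>+b\<in>?Q. Lr_mass r (dyadic_piece N \<sigma> f k) (cube b s) \<partial>lborel)"
        using s l continuous_borel_measurable[OF continuous_dyadic_piece[OF \<sigma>]] by (intro cube_averaging) simp_all
      also have "\<dots> \<le> (\<integral>\<^sup>+b. ennreal (K1 * ?g s) * (weighted_mass N s r f b * indicator ?Q b) \<partial>lborel)"
      proof (rule nn_integral_mono)
        fix b
        have "Lr_mass r (dyadic_piece N \<sigma> f k) (cube b s)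
          \<le> ennreal ((K1 * (s ^ ?n * ?g s)) * (weighted_mass_real N s r f b / s ^ ?n))"
          using small[of f b b k s b] f s by (simp add: s_def mem_box_cart)
        also have "(K1 * (s ^ ?n * ?g s)) * (weighted_mass_real N s r f b / s ^ ?n) = K1 * ?g s * weighted_mass_real N s r f b"
          using s by simp
        also have "ennreal (K1 * ?g s * weighted_mass_real N s r f b) = ennreal (K1 * ?g s) * weighted_mass N s r f b"
          using K1 s r weighted_mass_real_nonneg[of N s r f b]
          by (subst weighted_mass_eq[OF f]) (auto simp flip: ennreal_mult)
        finally show "Lr_mass r (dyadic_piece N \<sigma> f k) (cube b s) * indicator ?Q b
          \<le> ennreal (K1 * ?g s) * (weighted_mass N s r f b * indicator ?Q b)"
          by (auto simp: indicator_def)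
      qed
      also have "\<dots> = ennreal (K1 * ?g s) * (\<integral>\<^sup>+b\<in>?Q. weighted_mass N s r f b \<partial>lborel)"
        using weighted_mass_measurable[OF f s(1)] by (intro nn_integral_cmult) simp
      also have "\<dots> \<le> ennreal (K1 * ?g s) * ennreal ((48 * pi) ^ ?n * (s ^ ?n * (l + s) ^ ?n * M))"
        unfolding N_def
      proof (intro mult_left_mono weighted_mass_average[OF f per s(1) _ _ r(1) avg M])
        show "x \<in> ?Q"
          unfolding mem_box_cart
        proof
          fix j show "?q $ j \<le> x $ j \<and> x $ j \<le> (?q + (l + s) *\<^sub>R One) $ j"
            using xj[of j] s by simp
        qed
      qed (use ls s l in auto)
      also have "\<dots> = ennreal (K1 * ?g s * ((48 * pi) ^ ?n * (s ^ ?n * (l + s) ^ ?n * M)))"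
        by (rule ennreal_mult[symmetric]) (use K1 s l M in auto)
      also have "K1 * ?g s * ((48 * pi) ^ ?n * (s ^ ?n * (l + s) ^ ?n * M)) = (K1 * ?g s * ((48 * pi) ^ ?n * ((l + s) ^ ?n * M))) * s ^ ?n"
        by simp
      finally have "?X \<le> ennreal (K1 * ?g s * ((48 * pi) ^ ?n * ((l + s) ^ ?n * M)))"
        by (rule ennreal_cancel_right) (use s l K1 M in auto)
      also have "\<dots> \<le> ennreal (K1 * (96 * pi) ^ ?n * (l ^ ?n * M * (?g l + ?g s)))"
      proof (rule ennreal_leI)
        have "(l + s) ^ ?n \<le> (2 * l) ^ ?n" using ls s by (intro power_mono) auto
        then have "(48 * pi) ^ ?n * (l + s) ^ ?n \<le> (48 * pi) ^ ?n * (2 * l) ^ ?n"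
          by (intro mult_left_mono) auto
        also have "\<dots> = (96 * pi) ^ ?n * l ^ ?n"
          by (simp only: power_mult_distrib[symmetric] mult_ac) simp
        finally have "((48 * pi) ^ ?n * (l + s) ^ ?n) * ?g s \<le> ((96 * pi) ^ ?n * l ^ ?n) * (?g l + ?g s)"
          by (rule mult_mono) (use l s in auto)
        then have "(K1 * M) * (((48 * pi) ^ ?n * (l + s) ^ ?n) * ?g s) \<le> (K1 * M) * (((96 * pi) ^ ?n * l ^ ?n) * (?g l + ?g s))"
          using K1 M by (intro mult_left_mono) auto
        then show "K1 * ?g s * ((48 * pi) ^ ?n * ((l + s) ^ ?n * M)) \<le> K1 * (96 * pi) ^ ?n * (l ^ ?n * M * (?g l + ?g s))"
          by (simp only: mult_ac)
      qed
      finally show "?X \<le> ennreal (K1 * (96 * pi) ^ ?n * (l ^ ?n * M * (?g l + ?g s)))" .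
    qed
  qed
qed

lemma lipschitz_from_partials:
  fixes F :: "real ^ 'n::finite \<Rightarrow> complex"
  assumes diff: "F differentiable_on UNIV" and S: "convex S" "x \<in> S" "y \<in> S"
    and bound: "\<And>z i. z \<in> S \<Longrightarrow> cmod (partial i F z) \<le> G" and G: "0 \<le> G"
  shows "cmod (F y - F x) \<le> real CARD('n) * G * norm (y - x)"
proof (rule differentiable_bound[OF S(1) _ _ S(3,2)])
  let ?D = "\<lambda>z. frechet_derivative F (at z)"
  have D: "(F has_derivative ?D z) (at z)" for z
    using diff by (simp add: differentiable_on_def frechet_derivative_works)
  show "(F has_derivative ?D z) (at z within S)" if "z \<in> S" for z
    using D by (rule has_derivative_at_withinI)
  have part: "?D z (axis i 1) = partial i F z" for z i
  proof -
    have "((\<lambda>t. F (z + t *\<^sub>R axis i 1)) has_derivative (\<lambda>t. ?D z (t *\<^sub>R axis i 1))) (at 0)"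
      by (rule has_derivative_compose[of "\<lambda>t. z + t *\<^sub>R axis i 1" "\<lambda>t. t *\<^sub>R axis i 1" 0 UNIV F "?D z", simplified])
         (auto intro!: derivative_eq_intros D)
    moreover have "?D z (t *\<^sub>R axis i 1) = t *\<^sub>R ?D z (axis i 1)" for t
      by (rule linear_scale[OF has_derivative_linear[OF D]])
    ultimately have "((\<lambda>t. F (z + t *\<^sub>R axis i 1)) has_vector_derivative ?D z (axis i 1)) (at 0)"
      by (simp add: has_vector_derivative_def)
    then show ?thesis by (rule partial_eqI[symmetric])
  qed
  show "onorm (?D z) \<le> real CARD('n) * G" if z: "z \<in> S" for z
  proof (rule onorm_le)
    fix v :: "real ^ 'n"
    have lin: "linear (?D z)" by (rule has_derivative_linear[OF D])
    have "v = (\<Sum>i\<in>UNIV. v $ i *\<^sub>R axis i 1)"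
      by (simp add: vec_eq_iff axis_def if_distrib cong: if_cong)
    then have "?D z v = ?D z (\<Sum>i\<in>UNIV. v $ i *\<^sub>R axis i 1)" by simp
    also have "\<dots> = (\<Sum>i\<in>UNIV. v $ i *\<^sub>R partial i F z)"
      by (simp add: linear_sum[OF lin] linear_scale[OF lin] part)
    finally have "norm (?D z v) \<le> (\<Sum>i\<in>UNIV. \<bar>v $ i\<bar> * cmod (partial i F z))"
      by (simp add: order_trans[OF norm_sum])
    also have "\<dots> \<le> (\<Sum>i\<in>(UNIV :: 'n set). norm v * G)"
      using bound[OF z] by (intro sum_mono mult_mono component_le_norm_cart) auto
    finally show "norm (?D z v) \<le> real CARD('n) * G * norm v" by (simp add: mult_ac)
  qed
qed

lemma dyadic_piece_differentiable:
  assumes "\<sigma> \<in> symbol_class m \<rho> \<delta>"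
  shows "dyadic_piece N \<sigma> f k differentiable_on UNIV"
proof -
  have "(\<lambda>x. \<sigma> x \<xi>) differentiable_on UNIV" for \<xi>
    using smooth_foldr_differentiable[OF symbol_smooth[OF assms], of "[]"] by simp
  then show ?thesis
    unfolding dyadic_piece_def[abs_def] differentiable_on_def
    using wave_differentiable unfolding differentiable_on_def
    by (intro ballI differentiable_sum differentiable_mult differentiable_const) auto
qed

text \<open>
  Since \<open>2 ^ k * l \<le> 1\<close> forces \<open>l \<le> s\<close>, the gradient estimate holds on the whole cube for all \<open>c\<close>
  in a cube of side \<open>s\<close>, and can be averaged over \<open>c\<close>.
\<close>
lemma dyadic_piece_oscillation:
  fixes \<sigma> :: "real ^ 'n::finite \<Rightarrow> int ^ 'n \<Rightarrow> complex" and r \<rho> m :: real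
  assumes r: "1 < r" "r \<le> 2" and \<rho>: "0 < \<rho>" "\<rho> < 1" and m: "m \<le> - real CARD('n) * (1 - \<rho>) / r"
    and \<sigma>: "\<sigma> \<in> symbol_class m \<rho> \<rho>"
  defines "N \<equiv> 4 * CARD('n)"
  obtains G where "0 \<le> G"
    "\<And>f k q l x y M. continuous_on UNIV f \<Longrightarrow> periodic1 f \<Longrightarrow> 0 < l \<Longrightarrow> 2 ^ k * l \<le> 1 \<Longrightarrow>
      x \<in> cube q l \<Longrightarrow> y \<in> cube q l \<Longrightarrow> 0 \<le> M \<Longrightarrow>
      cube_means_le r f x M \<Longrightarrow>
      cmod (dyadic_piece N \<sigma> f k y - dyadic_piece N \<sigma> f k x) \<le> G * (2 ^ k * l) * M powr (1 / r)"
proof -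
  let ?n = "CARD('n)"
  obtain C where C: "0 \<le> C" "\<And>f k z c i. continuous_on UNIV f \<Longrightarrow> (\<And>j. \<bar>z $ j - c $ j\<bar> \<le> dyadic_scale \<rho> k) \<Longrightarrow>
      cmod (partial i (dyadic_piece N \<sigma> f k) z)
      \<le> C * (2 ^ k * (weighted_mass_real N (dyadic_scale \<rho> k) r f c / dyadic_scale \<rho> k ^ ?n) powr (1 / r))"
    by (rule dyadic_piece_gradient[OF r \<rho> m \<sigma>, folded N_def]) (rule that; blast)
  define A where "A = C * ((48 * pi) ^ ?n) powr (1 / r)"
  have A: "0 \<le> A" using C by (simp add: A_def)
  show ?thesis
  proof
    show "0 \<le> real ?n * A * real ?n" using A by simp
    fix f :: "real ^ 'n \<Rightarrow> complex" and k :: nat and q x y :: "real ^ 'n" and l M :: real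
    assume f: "continuous_on UNIV f" and per: "periodic1 f" and l: "0 < l" "2 ^ k * l \<le> 1"
      and x: "x \<in> cube q l" and y: "y \<in> cube q l" and M: "0 \<le> M"
      and avg: "cube_means_le r f x M"
    define s where "s = dyadic_scale \<rho> k"
    have s: "0 < s" "s \<le> 1" using dyadic_scale_pos[of \<rho> k] dyadic_scale_le_1[of \<rho> k] \<rho> by (auto simp: s_def)
    have "l \<le> 1 / 2 ^ k" using l by (simp add: field_simps)
    also have "\<dots> \<le> s" unfolding s_def by (rule inverse_le_dyadic_scale) (use \<rho> in simp)
    finally have ls: "l \<le> s" .
    have sub: "cube q l \<subseteq> cube q s"
      using ls by (intro subset_box_imp) (auto simp: inner_add_left)
    have grad: "cmod (partial i (dyadic_piece N \<sigma> f k) z) \<le> A * 2 ^ k * M powr (1 / r)"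
      if z: "z \<in> cube q l" for z i
    proof -
      let ?d = "cmod (partial i (dyadic_piece N \<sigma> f k) z)"
      have "ennreal (?d powr r) \<le> ennreal ((C * 2 ^ k) powr r * ((48 * pi) ^ ?n * M))"
      proof (rule average_mass_bound[OF f per s r(1) avg M])
        show "x \<in> cube q s" using x sub by blast
        fix c assume c: "c \<in> cube q s"
        define h where "h = weighted_mass_real N s r f c / s ^ ?n"
        have h: "0 \<le> h" unfolding h_def using weighted_mass_real_nonneg s by (intro divide_nonneg_nonneg) auto
        have "\<bar>z $ j - c $ j\<bar> \<le> s" for j
        proof -
          have "z \<in> cube q s" using z sub by blast
          then have "q $ j \<le> z $ j \<and> z $ j \<le> q $ j + s" "q $ j \<le> c $ j \<and> c $ j \<le> q $ j + s"
            using c by (auto simp: mem_box_cart)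
          then show ?thesis by linarith
        qed
        then have "?d \<le> (C * 2 ^ k) * h powr (1 / r)"
          using C(2)[OF f, of z c k i] by (simp add: s_def h_def mult.assoc)
        then have "?d powr r \<le> ((C * 2 ^ k) * h powr (1 / r)) powr r"
          using r by (intro powr_mono2) auto
        also have "\<dots> = (C * 2 ^ k) powr r * h"
          using C h r by (simp add: powr_mult powr_powr)
        finally show "ennreal (?d powr r) \<le> ennreal ((C * 2 ^ k) powr r * (weighted_mass_real (4 * ?n) s r f c / s ^ ?n))"
          unfolding h_def N_def by (rule ennreal_leI)
      qed auto
      then have "?d powr r \<le> (C * 2 ^ k) powr r * ((48 * pi) ^ ?n * M)"
        using M by (simp add: ennreal_le_iff)
      then have "(?d powr r) powr (1 / r) \<le> ((C * 2 ^ k) powr r * ((48 * pi) ^ ?n * M)) powr (1 / r)"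
        using r by (intro powr_mono2) auto
      also have "\<dots> = (C * 2 ^ k) * (((48 * pi) ^ ?n) powr (1 / r) * M powr (1 / r))"
        using C M r by (simp add: powr_mult powr_powr)
      finally show ?thesis using r by (simp add: powr_powr A_def mult_ac)
    qed
    have nrm: "norm (y - x) \<le> real ?n * l"
    proof -
      have "norm (y - x) \<le> (\<Sum>j\<in>UNIV. \<bar>(y - x) $ j\<bar>)" by (rule norm_le_l1_cart)
      also have "\<dots> \<le> (\<Sum>j\<in>(UNIV :: 'n set). l)"
      proof (rule sum_mono)
        fix j
        have "q $ j \<le> x $ j \<and> x $ j \<le> q $ j + l" "q $ j \<le> y $ j \<and> y $ j \<le> q $ j + l"
          using x y by (auto simp: mem_box_cart)
        then show "\<bar>(y - x) $ j\<bar> \<le> l"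
          unfolding vector_minus_component abs_le_iff by linarith
      qed
      finally show ?thesis by simp
    qed
    have "cmod (dyadic_piece N \<sigma> f k y - dyadic_piece N \<sigma> f k x) \<le> real ?n * (A * 2 ^ k * M powr (1 / r)) * norm (y - x)"
      by (rule lipschitz_from_partials[OF dyadic_piece_differentiable[OF \<sigma>] convex_box(1) x y grad])
         (use A in auto)
    also have "\<dots> \<le> real ?n * (A * 2 ^ k * M powr (1 / r)) * (real ?n * l)"
      using A by (intro mult_left_mono nrm) auto
    finally show "cmod (dyadic_piece N \<sigma> f k y - dyadic_piece N \<sigma> f k x) \<le> real ?n * A * real ?n * (2 ^ k * l) * M powr (1 / r)"
      by (simp only: mult_ac)
  qed
qed


section \<open>The sharp function estimate\<close>

text \<open>
  If \<open>A\<close> denotes the sum on the right, then \<open>a i \<le> p ^ i * A powr (1 / r)\<close> for every \<open>i\<close>. This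
  takes the place of Minkowski's inequality.
\<close>
lemma sum_powr_geometric:
  fixes a :: "nat \<Rightarrow> real"
  assumes p: "0 < p" "p < 1" and r: "0 < r" and a: "\<And>i. 0 \<le> a i"
  shows "(\<Sum>i<I. a i) powr r \<le> (1 / (1 - p)) powr r * (\<Sum>i<I. (a i / p ^ i) powr r)"
proof -
  define A where "A = (\<Sum>i<I. (a i / p ^ i) powr r)"
  have A: "0 \<le> A" by (simp add: A_def sum_nonneg)
  have ai: "a i \<le> p ^ i * A powr (1 / r)" if "i < I" for i
  proof -
    have "(a i / p ^ i) powr r \<le> A"
      unfolding A_def using that by (intro member_le_sum) auto
    then have "((a i / p ^ i) powr r) powr (1 / r) \<le> A powr (1 / r)"
      using r by (intro powr_mono2) auto
    then have "a i / p ^ i \<le> A powr (1 / r)"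
      using r a[of i] p by (simp add: powr_powr)
    then show ?thesis using p by (simp add: field_simps)
  qed
  have "(\<Sum>i<I. a i) \<le> (\<Sum>i<I. p ^ i * A powr (1 / r))"
    by (intro sum_mono ai) auto
  also have "\<dots> = (\<Sum>i<I. p ^ i) * A powr (1 / r)" by (simp add: sum_distrib_right)
  also have "\<dots> \<le> (1 / (1 - p)) * A powr (1 / r)"
    using p by (intro mult_right_mono) (auto simp: sum_gp_strict divide_right_mono)
  finally have "(\<Sum>i<I. a i) powr r \<le> ((1 / (1 - p)) * A powr (1 / r)) powr r"
    using r a by (intro powr_mono2) (auto simp: sum_nonneg)
  also have "\<dots> = (1 / (1 - p)) powr r * A"
    using p r A by (subst powr_mult) (simp_all add: powr_powr)
  finally show ?thesis by (simp only: A_def)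
qed

lemma add_powr_le:
  fixes u v r :: real
  assumes "0 \<le> u" "0 \<le> v" "0 < r"
  shows "(u + v) powr r \<le> 2 powr r * (u powr r + v powr r)"
proof -
  have "(u + v) powr r \<le> (2 * max u v) powr r"
    using assms by (intro powr_mono2) auto
  also have "\<dots> = 2 powr r * (max u v) powr r"
    using assms by (simp add: powr_mult)
  also have "\<dots> \<le> 2 powr r * (u powr r + v powr r)"
    by (intro mult_left_mono) (auto simp: max_def)
  finally show ?thesis .
qed

text \<open>
  The constant subtracted on the cube is the value at \<open>x\<close> of the sum of the pieces with
  frequencies up to \<open>1 / l\<close>. For the partial sums of the series the estimate follows from the
  previous lemmas, and Fatou's lemma extends it to the limit.
\<close>
lemma sharp_estimate:
  fixes \<sigma> :: "real ^ 'n::finite \<Rightarrow> int ^ 'n \<Rightarrow> complex" and r \<rho> m :: real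
  assumes r: "1 < r" "r \<le> 2" and \<rho>: "0 < \<rho>" "\<rho> < 1" and m: "m \<le> - real CARD('n) * (1 - \<rho>) / r"
    and \<sigma>: "\<sigma> \<in> symbol_class m \<rho> \<rho>"
  obtains C where "0 \<le> C"
    "\<And>f q l x M. f \<in> smooth_torus \<Longrightarrow> 0 < l \<Longrightarrow> l \<le> 1 \<Longrightarrow> x \<in> cube q l \<Longrightarrow> 0 \<le> M \<Longrightarrow>
      cube_means_le r f x M \<Longrightarrow>
      \<exists>c. (\<integral>\<^sup>+y\<in>cube q l. ennreal (cmod (toroidal_op \<sigma> f y - c) powr r) \<partial>lborel) \<le> ennreal (C * (l ^ CARD('n) * M))"
proof -
  let ?n = "CARD('n)"
  define N where "N = 4 * CARD('n)"
  obtain K where K: "0 \<le> K" "\<And>f k q l x M. continuous_on UNIV f \<Longrightarrow> periodic1 f \<Longrightarrow> 0 < l \<Longrightarrow> l \<le> 1 \<Longrightarrow> x \<in> cube q l \<Longrightarrow> 0 \<le> M \<Longrightarrow>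
      cube_means_le r f x M \<Longrightarrow>
      Lr_mass r (dyadic_piece N \<sigma> f k) (cube q l)
      \<le> ennreal (K * (l ^ ?n * M * ((2 ^ k * l) powr (- (real ?n * r / 2)) + (2 ^ k * dyadic_scale \<rho> k) powr (- (real ?n * r / 2)))))"
    by (rule dyadic_piece_Lr[OF r \<rho> m \<sigma>, folded N_def]) (rule that; blast)
  obtain G where G: "0 \<le> G" "\<And>f k q l x y M. continuous_on UNIV f \<Longrightarrow> periodic1 f \<Longrightarrow> 0 < l \<Longrightarrow> 2 ^ k * l \<le> 1 \<Longrightarrow>
      x \<in> cube q l \<Longrightarrow> y \<in> cube q l \<Longrightarrow> 0 \<le> M \<Longrightarrow>
      cube_means_le r f x M \<Longrightarrow>
      cmod (dyadic_piece N \<sigma> f k y - dyadic_piece N \<sigma> f k x) \<le> G * (2 ^ k * l) * M powr (1 / r)"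
    by (rule dyadic_piece_oscillation[OF r \<rho> m \<sigma>, folded N_def]) (rule that; blast)
  \<comment> \<open>\<open>p\<^sup>2\<close> is the rate of decay of the pieces; one factor \<open>p\<close> is reserved for the summation.\<close>
  define p :: real where "p = 2 powr (- ((1 - \<rho>) * real ?n / 4))"
  have p: "0 < p" "p < 1"
    using \<rho> powr_less_mono[of "- ((1 - \<rho>) * real ?n / 4)" 0 2] by (simp_all add: p_def)
  define W where "W = 1 / (1 - p)"
  have W: "0 < W" using p by (simp add: W_def)
  define C where "C = 2 powr r * ((2 * G) powr r + W powr r * (2 * K * W))"
  have m0: "m \<le> 0"
  proof -
    have "- real ?n * (1 - \<rho>) / r \<le> 0" using \<rho> r by (simp add: divide_nonpos_pos mult_nonneg_nonneg)
    then show ?thesis using m by linarith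
  qed
  show ?thesis
  proof
    show "0 \<le> C" using G K W by (simp add: C_def)
    fix f :: "real ^ 'n \<Rightarrow> complex" and q x :: "real ^ 'n" and l M :: real
    assume f: "f \<in> smooth_torus" and l: "0 < l" "l \<le> 1"
      and x: "x \<in> cube q l" and M: "0 \<le> M"
      and avg: "cube_means_le r f x M"
    let ?Q = "cube q l"
    have fc: "continuous_on UNIV f" and per: "periodic1 f"
      using smooth_continuous[OF smooth_torusD(1)[OF f]] smooth_torusD(2)[OF f] by auto
    define T where "T = dyadic_piece N \<sigma> f"
    have Tm [measurable]: "T k \<in> borel_measurable borel" for k
      unfolding T_def by (rule continuous_borel_measurable[OF continuous_dyadic_piece[OF \<sigma>]])
    have Qm [measurable]: "?Q \<in> sets borel" by simp
    \<comment> \<open>The first piece whose frequencies exceed \<open>1 / l\<close>.\<close>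
    define k0 where "k0 = (LEAST k. 1 < 2 ^ k * l)"
    have "\<exists>k. 1 < 2 ^ k * l"
    proof -
      obtain k where "1 / l < 2 ^ k" using real_arch_pow[of 2 "1 / l"] by auto
      then show ?thesis using l by (auto simp: field_simps)
    qed
    then have k0: "1 < 2 ^ k0 * l" unfolding k0_def by (rule LeastI_ex)
    have low: "2 ^ k * l \<le> 1" if "k < k0" for k
      using not_less_Least[of k "\<lambda>k. 1 < 2 ^ k * l"] that by (simp add: k0_def)
    define c where "c = (\<Sum>k<k0. T k x)"
    have low_sum: "(\<Sum>k<k0. cmod (T k y - T k x)) \<le> 2 * G * M powr (1 / r)" if y: "y \<in> ?Q" for y
    proof -
      have "(\<Sum>k<k0. cmod (T k y - T k x)) \<le> (\<Sum>k<k0. G * (2 ^ k * l) * M powr (1 / r))"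
        unfolding T_def by (intro sum_mono G(2)[OF fc per l(1) low x y M avg]) auto
      also have "\<dots> = G * ((\<Sum>k<k0. 2 ^ k) * l) * M powr (1 / r)"
        by (simp add: sum_distrib_left sum_distrib_right)
      also have "\<dots> \<le> G * 2 * M powr (1 / r)"
      proof (intro mult_right_mono mult_left_mono)
        show "(\<Sum>k<k0. 2 ^ k) * l \<le> 2"
        proof (cases k0)
          case (Suc k)
          have "(\<Sum>k<k0. (2::real) ^ k) = 2 ^ k0 - 1"
            using sum_gp_strict[of "2::real" k0] by simp
          then have "(\<Sum>k<k0. (2::real) ^ k) * l \<le> 2 ^ k0 * l" using l by (intro mult_right_mono) auto
          also have "\<dots> = 2 * (2 ^ k * l)" by (simp add: Suc)
          also have "\<dots> \<le> 2" using low[of k] Suc by simp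
          finally show ?thesis .
        qed simp
      qed (use G in auto)
      finally show ?thesis by (simp add: mult_ac)
    qed
    have piece: "Lr_mass r (T (k0 + i)) ?Q \<le> ennreal (2 * K * (l ^ ?n * M) * (p ^ i) powr (2 * r))" for i
    proof -
      let ?e = "- (real ?n * r / 2)"
      have pi: "(p ^ i) powr (2 * r) = (2 ^ i) powr ((1 - \<rho>) * ?e)"
        using powr_realpow[of 2 i] by (simp add: p_def powr_power powr_powr flip: powr_realpow) (simp add: field_simps)
      have e: "?e \<le> 0" using r by simp
      have 1: "(2 ^ (k0 + i) * l) powr ?e \<le> (p ^ i) powr (2 * r)"
      proof -
        have "2 ^ i * 1 \<le> 2 ^ i * (2 ^ k0 * l)" using k0 by (intro mult_left_mono) auto
        then have "(2 ^ (k0 + i) * l) powr ?e \<le> (2 ^ i) powr ?e"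
          using e by (intro powr_mono2') (auto simp: power_add mult_ac)
        also have "\<dots> \<le> (2 ^ i) powr ((1 - \<rho>) * ?e)"
        proof (intro powr_mono)
          have "t \<le> (1 - \<rho>) * t" if "t \<le> 0" for t
            using mult_nonneg_nonpos[of \<rho> t] that \<rho> by (simp add: left_diff_distrib)
          then show "?e \<le> (1 - \<rho>) * ?e" using e .
        qed simp
        finally show ?thesis by (simp only: pi)
      qed
      have 2: "(2 ^ (k0 + i) * dyadic_scale \<rho> (k0 + i)) powr ?e \<le> (p ^ i) powr (2 * r)"
      proof -
        have "(2 ^ (k0 + i) * dyadic_scale \<rho> (k0 + i)) = (2 ^ (k0 + i)) powr (1 - \<rho>)"
          by (simp add: dyadic_scale_def powr_diff powr_minus_divide)
        then have "(2 ^ (k0 + i) * dyadic_scale \<rho> (k0 + i)) powr ?e = (2 ^ (k0 + i)) powr ((1 - \<rho>) * ?e)"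
          by (simp only: powr_powr)
        also have "\<dots> \<le> (2 ^ i) powr ((1 - \<rho>) * ?e)"
          using e \<rho> by (intro powr_mono2') (auto intro!: mult_nonneg_nonpos power_increasing)
        finally show ?thesis by (simp only: pi)
      qed
      have "Lr_mass r (T (k0 + i)) ?Q
        \<le> ennreal (K * (l ^ ?n * M * ((2 ^ (k0 + i) * l) powr ?e + (2 ^ (k0 + i) * dyadic_scale \<rho> (k0 + i)) powr ?e)))"
        unfolding T_def by (rule K(2)[OF fc per l x M avg])
      also have "\<dots> \<le> ennreal (K * (l ^ ?n * M * ((p ^ i) powr (2 * r) + (p ^ i) powr (2 * r))))"
        using K l M by (intro ennreal_leI mult_left_mono add_mono 1 2) auto
      also have "K * (l ^ ?n * M * ((p ^ i) powr (2 * r) + (p ^ i) powr (2 * r))) = 2 * K * (l ^ ?n * M) * (p ^ i) powr (2 * r)"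
        by simp
      finally show ?thesis .
    qed
    define S where "S I y = (\<Sum>k<k0. T k y - T k x) + (\<Sum>i<I. T (k0 + i) y)" for I y
    have Sm [measurable]: "S I \<in> borel_measurable borel" for I
      unfolding S_def[abs_def] by measurable
    have S_eq: "S I y = (\<Sum>k<k0 + I. T k y) - c" for I y
      by (induction I) (simp_all add: S_def c_def sum_subtractf)
    have S_bound: "cmod (S I y) powr r \<le> 2 powr r * ((2 * G) powr r * M + W powr r * (\<Sum>i<I. (cmod (T (k0 + i) y) / p ^ i) powr r))"
      if y: "y \<in> ?Q" for I y
    proof -
      let ?u = "\<Sum>k<k0. cmod (T k y - T k x)" and ?v = "\<Sum>i<I. cmod (T (k0 + i) y)"
      have "cmod (S I y) \<le> ?u + ?v"
        unfolding S_def by (rule norm_triangle_mono) (rule norm_sum)+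
      then have "cmod (S I y) powr r \<le> (?u + ?v) powr r"
        using r by (intro powr_mono2) auto
      also have "\<dots> \<le> 2 powr r * (?u powr r + ?v powr r)"
        using r by (intro add_powr_le) (auto simp: sum_nonneg)
      also have "\<dots> \<le> 2 powr r * ((2 * G) powr r * M + W powr r * (\<Sum>i<I. (cmod (T (k0 + i) y) / p ^ i) powr r))"
      proof (intro mult_left_mono add_mono)
        have "?u powr r \<le> (2 * G * M powr (1 / r)) powr r"
          using low_sum[OF y] r by (intro powr_mono2) (auto simp: sum_nonneg)
        also have "\<dots> = (2 * G) powr r * M"
          using G M r by (simp add: powr_mult powr_powr)
        finally show "?u powr r \<le> (2 * G) powr r * M" .
        show "?v powr r \<le> W powr r * (\<Sum>i<I. (cmod (T (k0 + i) y) / p ^ i) powr r)"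
          unfolding W_def using r by (intro sum_powr_geometric p) auto
      qed auto
      finally show ?thesis .
    qed
    have sum_int: "(\<integral>\<^sup>+y. (\<Sum>i<I. ennreal ((cmod (T (k0 + i) y) / p ^ i) powr r) * indicator ?Q y) \<partial>lborel)
        \<le> ennreal (2 * K * (l ^ ?n * M) * W)" for I
    proof -
      have one: "(\<integral>\<^sup>+y\<in>?Q. ennreal ((cmod (T (k0 + i) y) / p ^ i) powr r) \<partial>lborel) \<le> ennreal (2 * K * (l ^ ?n * M) * p ^ i)" for i
      proof -
        have pi: "0 < p ^ i" "p ^ i \<le> 1" using p by (auto intro: power_le_one)
        have "(\<integral>\<^sup>+y\<in>?Q. ennreal ((cmod (T (k0 + i) y) / p ^ i) powr r) \<partial>lborel)
          = (\<integral>\<^sup>+y. ennreal ((p ^ i) powr (- r)) * (ennreal (cmod (T (k0 + i) y) powr r) * indicator ?Q y) \<partial>lborel)"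
        proof (rule nn_integral_cong)
          fix y
          have "(cmod (T (k0 + i) y) / p ^ i) powr r = (p ^ i) powr (- r) * cmod (T (k0 + i) y) powr r"
            using pi by (simp add: powr_divide powr_minus_divide)
          then show "ennreal ((cmod (T (k0 + i) y) / p ^ i) powr r) * indicator ?Q y
            = ennreal ((p ^ i) powr (- r)) * (ennreal (cmod (T (k0 + i) y) powr r) * indicator ?Q y)"
            by (simp add: ennreal_mult mult.assoc)
        qed
        also have "\<dots> = ennreal ((p ^ i) powr (- r)) * Lr_mass r (T (k0 + i)) ?Q"
          by (rule nn_integral_cmult) measurable
        also have "\<dots> \<le> ennreal ((p ^ i) powr (- r)) * ennreal (2 * K * (l ^ ?n * M) * (p ^ i) powr (2 * r))"
          by (intro mult_left_mono piece) auto
        also have "\<dots> = ennreal ((p ^ i) powr (- r) * (2 * K * (l ^ ?n * M) * (p ^ i) powr (2 * r)))"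
          by (rule ennreal_mult[symmetric]) (use K l M in auto)
        also have "(p ^ i) powr (- r) * (2 * K * (l ^ ?n * M) * (p ^ i) powr (2 * r)) = 2 * K * (l ^ ?n * M) * (p ^ i) powr r"
        proof -
          have "(p ^ i) powr (- r) * (p ^ i) powr (2 * r) = (p ^ i) powr r"
            by (simp only: powr_add[symmetric]) simp
          then show ?thesis by (simp only: mult_ac)
        qed
        also have "ennreal (2 * K * (l ^ ?n * M) * (p ^ i) powr r) \<le> ennreal (2 * K * (l ^ ?n * M) * p ^ i)"
        proof (intro ennreal_leI mult_left_mono)
          show "(p ^ i) powr r \<le> p ^ i"
            using pi r powr_mono'[of 1 r "p ^ i"] by simp
        qed (use K l M in auto)
        finally show ?thesis .
      qed
      have "(\<integral>\<^sup>+y. (\<Sum>i<I. ennreal ((cmod (T (k0 + i) y) / p ^ i) powr r) * indicator ?Q y) \<partial>lborel)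
        = (\<Sum>i<I. (\<integral>\<^sup>+y\<in>?Q. ennreal ((cmod (T (k0 + i) y) / p ^ i) powr r) \<partial>lborel))"
        by (rule nn_integral_sum) measurable
      also have "\<dots> \<le> (\<Sum>i<I. ennreal (2 * K * (l ^ ?n * M) * p ^ i))"
        by (intro sum_mono one)
      also have "\<dots> = ennreal (2 * K * (l ^ ?n * M) * (\<Sum>i<I. p ^ i))"
        using K l M p by (subst sum_ennreal) (auto simp: sum_distrib_left)
      also have "\<dots> \<le> ennreal (2 * K * (l ^ ?n * M) * W)"
        using K l M p by (intro ennreal_leI mult_left_mono) (auto simp: W_def sum_gp_strict divide_right_mono)
      finally show ?thesis .
    qed
    have S_int: "Lr_mass r (S I) ?Q \<le> ennreal (C * (l ^ ?n * M))" for I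
    proof -
      let ?A = "2 powr r * ((2 * G) powr r * M)" and ?B = "2 powr r * W powr r"
      let ?q = "\<lambda>y. \<Sum>i<I. ennreal ((cmod (T (k0 + i) y) / p ^ i) powr r) * indicator ?Q y"
      have "Lr_mass r (S I) ?Q
        \<le> (\<integral>\<^sup>+y. ennreal ?A * indicator ?Q y + ennreal ?B * ?q y \<partial>lborel)"
      proof (rule nn_integral_mono)
        fix y
        show "ennreal (cmod (S I y) powr r) * indicator ?Q y \<le> ennreal ?A * indicator ?Q y + ennreal ?B * ?q y"
        proof (cases "y \<in> ?Q")
          case True
          let ?z = "\<Sum>i<I. (cmod (T (k0 + i) y) / p ^ i) powr r"
          have "ennreal (cmod (S I y) powr r) \<le> ennreal (?A + ?B * ?z)"
            using S_bound[OF True, of I] by (intro ennreal_leI) (simp add: algebra_simps)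
          also have "\<dots> = ennreal ?A + ennreal (?B * ?z)"
            using M by (intro ennreal_plus) (auto simp: sum_nonneg)
          also have "ennreal (?B * ?z) = ennreal ?B * ennreal ?z"
            by (rule ennreal_mult) (auto simp: sum_nonneg)
          also have "ennreal ?z = (\<Sum>i<I. ennreal ((cmod (T (k0 + i) y) / p ^ i) powr r))"
            by (rule sum_ennreal[symmetric]) auto
          finally show ?thesis using True by simp
        qed simp
      qed
      also have "\<dots> = (\<integral>\<^sup>+y. ennreal ?A * indicator ?Q y \<partial>lborel) + (\<integral>\<^sup>+y. ennreal ?B * ?q y \<partial>lborel)"
        by (rule nn_integral_add) measurable
      also have "(\<integral>\<^sup>+y. ennreal ?A * indicator ?Q y \<partial>lborel) = ennreal ?A * ennreal (l ^ ?n)"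
        using l by (subst nn_integral_cmult_indicator) (simp_all only: emeasure_cube less_imp_le, simp)
      also have "(\<integral>\<^sup>+y. ennreal ?B * ?q y \<partial>lborel) = ennreal ?B * (\<integral>\<^sup>+y. ?q y \<partial>lborel)"
        by (rule nn_integral_cmult) measurable
      also have "ennreal ?A * ennreal (l ^ ?n) + ennreal ?B * (\<integral>\<^sup>+y. ?q y \<partial>lborel)
         \<le> ennreal ?A * ennreal (l ^ ?n) + ennreal ?B * ennreal (2 * K * (l ^ ?n * M) * W)"
        by (intro add_left_mono mult_left_mono sum_int) auto
      also have "\<dots> = ennreal (?A * l ^ ?n + ?B * (2 * K * (l ^ ?n * M) * W))"
        using K l M W by (subst ennreal_plus) (auto simp: ennreal_mult)
      also have "?A * l ^ ?n + ?B * (2 * K * (l ^ ?n * M) * W) = C * (l ^ ?n * M)"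
        by (simp add: C_def algebra_simps)
      finally show ?thesis .
    qed
    have lim: "(\<lambda>I. S I y) \<longlonglongrightarrow> toroidal_op \<sigma> f y - c" for y
    proof -
      have "(\<lambda>J. \<Sum>k<Suc J. T k y) \<longlonglongrightarrow> toroidal_op \<sigma> f y"
        using dyadic_sum_tendsto[OF \<sigma> m0 f, of N y] by (simp add: T_def lessThan_Suc_atMost)
      then have "(\<lambda>J. \<Sum>k<J. T k y) \<longlonglongrightarrow> toroidal_op \<sigma> f y"
        by (rule LIMSEQ_imp_Suc)
      then have "(\<lambda>I. \<Sum>k<I + k0. T k y) \<longlonglongrightarrow> toroidal_op \<sigma> f y"
        by (rule LIMSEQ_ignore_initial_segment)
      then show ?thesis
        unfolding S_eq by (intro tendsto_diff tendsto_const) (simp add: add.commute)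
    qed
    have "(\<integral>\<^sup>+y\<in>?Q. ennreal (cmod (toroidal_op \<sigma> f y - c) powr r) \<partial>lborel)
      = (\<integral>\<^sup>+y. liminf (\<lambda>I. ennreal (cmod (S I y) powr r) * indicator ?Q y) \<partial>lborel)"
    proof (rule nn_integral_cong)
      fix y
      have "(\<lambda>I. cmod (S I y) powr r) \<longlonglongrightarrow> cmod (toroidal_op \<sigma> f y - c) powr r"
        using r by (intro tendsto_powr' tendsto_norm lim tendsto_const) auto
      then have "(\<lambda>I. ennreal (cmod (S I y) powr r) * indicator ?Q y)
          \<longlonglongrightarrow> ennreal (cmod (toroidal_op \<sigma> f y - c) powr r) * indicator ?Q y"
        by (cases "y \<in> ?Q") (auto intro!: tendsto_ennrealI)
      then show "ennreal (cmod (toroidal_op \<sigma> f y - c) powr r) * indicator ?Q y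
          = liminf (\<lambda>I. ennreal (cmod (S I y) powr r) * indicator ?Q y)"
        by (rule lim_imp_Liminf[OF sequentially_bot, symmetric])
    qed
    also have "\<dots> \<le> liminf (\<lambda>I. \<integral>\<^sup>+y\<in>?Q. ennreal (cmod (S I y) powr r) \<partial>lborel)"
      by (rule nn_integral_liminf) measurable
    also have "\<dots> \<le> liminf (\<lambda>I :: nat. ennreal (C * (l ^ ?n * M)))"
      by (intro Liminf_mono always_eventually allI S_int)
    also have "\<dots> = ennreal (C * (l ^ ?n * M))"
      by (rule Liminf_const) simp
    finally show "\<exists>c. (\<integral>\<^sup>+y\<in>?Q. ennreal (cmod (toroidal_op \<sigma> f y - c) powr r) \<partial>lborel) \<le> ennreal (C * (l ^ ?n * M))"
      by blast
  qed
qed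

lemma Lr_average_cube:
  fixes f :: "real ^ 'n::finite \<Rightarrow> complex"
  assumes "0 < L"
  shows "Lr_average r (cube a L) f = ennreal_power
     (Lr_mass r f (cube a L) / ennreal (L ^ CARD('n))) (1 / r)"
  unfolding Lr_average_def nn_integral_completion
  using assms by (simp add: emeasure_cube)

lemma integral_le_of_Lr_average:
  fixes f :: "real ^ 'n::finite \<Rightarrow> complex"
  assumes L: "0 < L" and r: "0 < r" and M: "0 \<le> M"
    and le: "Lr_average r (cube a L) f \<le> ennreal M"
  shows "Lr_mass r f (cube a L) \<le> ennreal (L ^ CARD('n) * M powr r)"
proof -
  let ?X = "\<integral>\<^sup>+y\<in>cube a L. ennreal (cmod (f y) powr r) \<partial>lborel"
  have Ln: "0 < L ^ CARD('n)" using L by simp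
  show ?thesis
  proof (cases ?X)
    case (real v)
    have "?X / ennreal (L ^ CARD('n)) = ennreal (v / L ^ CARD('n))"
      using real Ln by (simp add: divide_ennreal)
    then have "ennreal ((v / L ^ CARD('n)) powr (1 / r)) \<le> ennreal M"
      using le real Ln by (simp add: Lr_average_cube[OF L] ennreal_power_def)
    then have "(v / L ^ CARD('n)) powr (1 / r) \<le> M" using M by (simp add: ennreal_le_iff)
    then have "((v / L ^ CARD('n)) powr (1 / r)) powr r \<le> M powr r"
      using r by (intro powr_mono2) auto
    then have "v / L ^ CARD('n) \<le> M powr r"
      using real r Ln by (simp add: powr_powr)
    then have "v \<le> L ^ CARD('n) * M powr r" using Ln by (simp add: field_simps)
    then show ?thesis using real by (simp add: ennreal_leI)
  next
    case top
    then have "?X / ennreal (L ^ CARD('n)) = top" by (simp add: ennreal_top_divide)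
    then have "top \<le> ennreal M"
      using le by (simp add: Lr_average_cube[OF L] ennreal_power_def)
    then show ?thesis by (simp add: top_unique)
  qed
qed

lemma Lr_average_le_of_integral:
  fixes g :: "real ^ 'n::finite \<Rightarrow> complex"
  assumes L: "0 < L" and r: "0 < r" and M: "0 \<le> M"
    and le: "Lr_mass r g (cube a L) \<le> ennreal (L ^ CARD('n) * M)"
  shows "Lr_average r (cube a L) g \<le> ennreal (M powr (1 / r))"
proof -
  let ?X = "\<integral>\<^sup>+y\<in>cube a L. ennreal (cmod (g y) powr r) \<partial>lborel"
  have Ln: "0 < L ^ CARD('n)" using L by simp
  obtain v where v: "0 \<le> v" "?X = ennreal v"
    using le by (cases ?X) (auto simp: top_unique)
  have "v \<le> L ^ CARD('n) * M" using le v Ln M by (simp add: ennreal_le_iff)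
  then have "v / L ^ CARD('n) \<le> M" using Ln by (simp add: field_simps)
  then have "(v / L ^ CARD('n)) powr (1 / r) \<le> M powr (1 / r)"
    using r v Ln by (intro powr_mono2) auto
  then show ?thesis
    using v Ln by (simp add: Lr_average_cube[OF L] ennreal_power_def divide_ennreal ennreal_leI)
qed

theorem theorem1p3:
  fixes r \<rho> m :: real and \<sigma> :: "real ^ 'n::finite \<Rightarrow> int ^ 'n \<Rightarrow> complex"
  assumes "1 < r" and "r \<le> 2"
    and "0 < \<rho>" and "\<rho> < 1"
    and "m \<le> - real CARD('n) * (1 - \<rho>) / r"
    and "\<sigma> \<in> symbol_class m \<rho> \<rho>"
  shows "\<exists>C::real. C > 0 \<and>
    (\<forall>f \<in> smooth_torus. \<forall>x.
       sharp_maximal r (toroidal_op \<sigma> f) x \<le> ennreal C * maximal r f x)"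
proof -
  obtain C where C: "0 \<le> C" "\<And>f q l x M. f \<in> smooth_torus \<Longrightarrow> 0 < l \<Longrightarrow> l \<le> 1 \<Longrightarrow> x \<in> cube q l \<Longrightarrow> 0 \<le> M \<Longrightarrow>
      cube_means_le r f x M \<Longrightarrow>
      \<exists>c. (\<integral>\<^sup>+y\<in>cube q l. ennreal (cmod (toroidal_op \<sigma> f y - c) powr r) \<partial>lborel) \<le> ennreal (C * (l ^ CARD('n) * M))"
    by (rule sharp_estimate[OF assms]) (rule that; blast)
  define D where "D = C powr (1 / r) + 1"
  have D: "0 < D" by (simp add: D_def add_nonneg_pos)
  have "sharp_maximal r (toroidal_op \<sigma> f) x \<le> ennreal D * maximal r f x" if f: "f \<in> smooth_torus" for f x
  proof (cases "maximal r f x")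
    case top
    then show ?thesis using D by (simp add: ennreal_mult_top)
  next
    case (real M)
    have avg: "cube_means_le r f x (M powr r)"
      unfolding cube_means_le_def
    proof (intro allI impI)
      fix a :: "real ^ 'n" and L :: real
      assume L: "0 < L" "L \<le> 1" and x: "x \<in> cube a L"
      have "cube a L \<in> cubes_at x"
        using L x unfolding cubes_at_def by blast
      then have "Lr_average r (cube a L) f \<le> maximal r f x"
        unfolding maximal_def by (rule SUP_upper)
      then have "Lr_average r (cube a L) f \<le> ennreal M" by (simp add: real)
      then show "Lr_mass r f (cube a L) \<le> ennreal (L ^ CARD('n) * M powr r)"
        by (intro integral_le_of_Lr_average) (use L(1) assms(1) real in auto)
    qed
    show ?thesis
      unfolding sharp_maximal_def
    proof (rule SUP_least)
      fix Q assume "Q \<in> cubes_at x"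
      then obtain q l where Q: "0 < l" "l \<le> 1" "Q = cube q l" "x \<in> Q"
        unfolding cubes_at_def by blast
      from C(2)[OF f Q(1,2) Q(4)[unfolded Q(3)] powr_ge_zero avg]
      obtain c where c: "(\<integral>\<^sup>+y\<in>Q. ennreal (cmod (toroidal_op \<sigma> f y - c) powr r) \<partial>lborel)
          \<le> ennreal (l ^ CARD('n) * (C * M powr r))"
        unfolding Q(3) by (auto simp: mult_ac)
      have "(INF c. Lr_average r Q (\<lambda>y. toroidal_op \<sigma> f y - c)) \<le> Lr_average r Q (\<lambda>y. toroidal_op \<sigma> f y - c)"
        by (rule INF_lower) simp
      also have "\<dots> \<le> ennreal ((C * M powr r) powr (1 / r))"
        unfolding Q(3)
        by (rule Lr_average_le_of_integral[OF Q(1) _ _ c[unfolded Q(3)]]) (use assms(1) C in auto)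
      also have "(C * M powr r) powr (1 / r) = C powr (1 / r) * M"
        using C real assms(1) by (simp add: powr_mult powr_powr)
      also have "ennreal (C powr (1 / r) * M) \<le> ennreal (D * M)"
        using real by (intro ennreal_leI mult_right_mono) (auto simp: D_def)
      also have "\<dots> = ennreal D * maximal r f x"
        using D real by (simp add: ennreal_mult)
      finally show "(INF c. Lr_average r Q (\<lambda>y. toroidal_op \<sigma> f y - c)) \<le> ennreal D * maximal r f x" .
    qed
  qed
  with D show ?thesis by blast
qed


end
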